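(* Let $N\ge 1$ be an integer and let $\alpha\in(0,+\infty)$. For every $\kappa\in\mathbb{N}^*$ the problem $$\min\{\lambda_\kappa(\Omega):\ \Omega\subset\mathbb{R}^N \text{ open},\ D(\Omega)\le\alpha\}$$ has at least one solution $\Omega$ which is convex.
   Context: $\mathbb{N}^*=\{1,2,3,\dots\}$. The competitors $\Omega$ are nonempty open sets. $D(\Omega)=\sup_{x,y\in\Omega}|x-y|$ is the diameter of $\Omega$, and $0<\lambda_1(\Omega)\le\lambda_2(\Omega)\le\cdots$ are the eigenvalues, counted with multiplicity, of the Laplacian $-\Delta$ with Dirichlet boundary conditions on the bounded open set $\Omega$. *)

theory Defs
  imports "HOL-Analysis.Analysis" "HOL-Library.Extended_Nat"
begin

primrec C_k :: "nat \<Rightarrow> ('a::euclidean_space \<Rightarrow> real) \<Rightarrow> bool" where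
  "C_k 0 f \<longleftrightarrow> continuous_on UNIV f"
| "C_k (Suc k) f \<longleftrightarrow>
     (\<forall>x. f differentiable (at x)) \<and>
     (\<forall>i\<in>Basis. C_k k (\<lambda>x. frechet_derivative f (at x) i))"

definition grad :: "('a::euclidean_space \<Rightarrow> real) \<Rightarrow> 'a \<Rightarrow> 'a" where
  "grad f x = (\<Sum>i\<in>Basis. frechet_derivative f (at x) i *\<^sub>R i)"

definition test_function :: "'a::euclidean_space set \<Rightarrow> ('a \<Rightarrow> real) \<Rightarrow> bool" where
  "test_function \<Omega> \<phi> \<longleftrightarrow>
     (\<forall>k. C_k k \<phi>) \<and>
     compact (closure {x. \<phi> x \<noteq> 0}) \<and> closure {x. \<phi> x \<noteq> 0} \<subseteq> \<Omega>"

definition square_integrable :: "('a::euclidean_space \<Rightarrow> 'b::euclidean_space) \<Rightarrow> bool" where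
  "square_integrable f \<longleftrightarrow>
     f \<in> borel_measurable lborel \<and> integrable lborel (\<lambda>x. (norm (f x))\<^sup>2)"

text \<open>The Sobolev space $H^1_0(\Omega)$ is the closure of $C_c^\infty(\Omega)$ in $H^1(R^N)$: its
  elements are functions on the whole space, which vanish almost everywhere outside \<open>\<Omega>\<close>.  The
  predicate says that \<open>u\<close> belongs to $H^1_0(\Omega)$ and that \<open>g\<close> is its weak gradient; \<open>g\<close> is
  determined by \<open>u\<close> up to a null set.\<close>

definition H10_gradient ::
    "'a::euclidean_space set \<Rightarrow> ('a \<Rightarrow> real) \<Rightarrow> ('a \<Rightarrow> 'a) \<Rightarrow> bool" where
  "H10_gradient \<Omega> u g \<longleftrightarrow>
     square_integrable u \<and> square_integrable g \<and>
     (\<exists>\<phi>. (\<forall>n. test_function \<Omega> (\<phi> n)) \<and>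
          (\<lambda>n. \<integral>x. (\<phi> n x - u x)\<^sup>2 \<partial>lborel) \<longlonglongrightarrow> 0 \<and>
          (\<lambda>n. \<integral>x. (norm (grad (\<phi> n) x - g x))\<^sup>2 \<partial>lborel) \<longlonglongrightarrow> 0)"

text \<open>The $u \in H^1_0(\Omega)$ with $-\Delta u = t u$ in the sense of distributions on \<open>\<Omega>\<close>.\<close>

definition dirichlet_eigenspace ::
    "'a::euclidean_space set \<Rightarrow> real \<Rightarrow> ('a \<Rightarrow> real) set" where
  "dirichlet_eigenspace \<Omega> t =
     {u. \<exists>g. H10_gradient \<Omega> u g \<and>
           (\<forall>\<phi>. test_function \<Omega> \<phi> \<longrightarrow>
              (\<integral>x. g x \<bullet> grad \<phi> x \<partial>lborel) = t * (\<integral>x. u x * \<phi> x \<partial>lborel))}"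

text \<open>Linear independence of \<open>f 0, \<dots>, f (m - 1)\<close> as elements of $L^2$, that is, modulo
  equality almost everywhere.\<close>

definition ae_independent :: "nat \<Rightarrow> (nat \<Rightarrow> 'a::euclidean_space \<Rightarrow> real) \<Rightarrow> bool" where
  "ae_independent m f \<longleftrightarrow>
     (\<forall>c::nat \<Rightarrow> real. (AE x in lborel. (\<Sum>i<m. c i * f i x) = 0) \<longrightarrow> (\<forall>i<m. c i = 0))"

text \<open>The dimension of the eigenspace modulo equality almost everywhere; it is \<open>0\<close> exactly when
  \<open>t\<close> is not an eigenvalue.\<close>

definition dirichlet_multiplicity :: "'a::euclidean_space set \<Rightarrow> real \<Rightarrow> enat" where
  "dirichlet_multiplicity \<Omega> t =
     (SUP m \<in> {m. \<exists>f. (\<forall>i<m. f i \<in> dirichlet_eigenspace \<Omega> t) \<and> ae_independent m f}. enat m)"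

text \<open>\<open>l 1 \<le> l 2 \<le> \<dots>\<close> lists the eigenvalues, each as often as its multiplicity.  Indices start
  at \<open>1\<close>; the value \<open>l 0\<close> is irrelevant.\<close>

definition dirichlet_spectrum :: "'a::euclidean_space set \<Rightarrow> (nat \<Rightarrow> real) \<Rightarrow> bool" where
  "dirichlet_spectrum \<Omega> l \<longleftrightarrow>
     mono_on {1..} l \<and>
     (\<forall>t. finite {k\<in>{1..}. l k = t} \<and>
          enat (card {k\<in>{1..}. l k = t}) = dirichlet_multiplicity \<Omega> t)"

definition dirichlet_eigenvalue :: "nat \<Rightarrow> 'a::euclidean_space set \<Rightarrow> real" where
  "dirichlet_eigenvalue k \<Omega> = (THE t. \<exists>l. dirichlet_spectrum \<Omega> l \<and> l k = t)"

text \<open>Boundedness is part of $D(\Omega) \le \alpha$: the value of \<^const>\<open>diameter\<close> is not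
  meaningful on unbounded sets.\<close>

definition admissible :: "real \<Rightarrow> 'a::euclidean_space set \<Rightarrow> bool" where
  "admissible \<alpha> \<Omega> \<longleftrightarrow> open \<Omega> \<and> \<Omega> \<noteq> {} \<and> bounded \<Omega> \<and> diameter \<Omega> \<le> \<alpha>"

end

theory Submission
  imports Defs "HOL-Complex_Analysis.Great_Picard"
begin

text \<open>The eigenvalues obey the min-max principle, which rests on the compactness of the embedding of
  $H^1_0$ into $L^2$.  Let \<open>\<Omega> n\<close> be a minimising sequence, translated into a fixed ball, and let
  \<open>x n i\<close> (\<open>i \<le> k\<close>) be the first eigenfunctions of \<open>\<Omega> n\<close>, paired with their gradients.  After
  passing to a subsequence the functions converge in $L^2$, so the limits are again orthonormal,
  and the domains converge to a compact set of diameter at most \<open>\<alpha>\<close>; by Mazur's lemma suitable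
  convex combinations of the pairs converge strongly, so the Rayleigh quotients on the span of the
  limits are at most the infimum.  The limits vanish outside the convex hull \<open>K\<close> of the limit set,
  which therefore has nonempty interior.  Convexity of \<open>K\<close> allows one to shrink the support by a
  dilation about an interior point and then cut off, so the limits lie in $H^1_0$ of the interior
  of \<open>K\<close>, and the min-max principle shows that this interior is optimal.\<close>

section \<open>Smooth functions and cutoffs\<close>


text \<open>Bounding an eigenvalue of the limit domain needs trial functions in its H^1_0, and here
  lies the obstacle: for a general compact set K a function with L^2 gradient that vanishes almost
  everywhere outside K need not be a limit of test functions of the interior. Passing to a convex
  hull, which costs no diameter, removes it; the convexity of the minimiser comes from there. The
  hull is taken of the limit set only, so no domain is compared with its own hull.

  Gradients are merely bounded along the sequence. Convex combinations replace weak limits, with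
  weights common to all pairs because the Rayleigh bound concerns linear combinations across them.
  Such combinations destroy orthonormality in general; it survives because the functions themselves
  already converge strongly.

  The weak gradient is never reconstructed from the function: H^1_0 is a closed subspace of a
  product of two L^2 spaces. No lower bound on the size of the domains is assumed; orthonormal
  limits cannot live on a null set, and this alone prevents collapse.\<close>

lemma C_k_SucD: "C_k (Suc k) f \<Longrightarrow> C_k k f"
proof (induction k arbitrary: f)
  case 0
  then show ?case
    by (auto intro!: continuous_at_imp_continuous_on differentiable_imp_continuous_within)
qed simp

lemma C_k_mono: "C_k n f \<Longrightarrow> k \<le> n \<Longrightarrow> C_k k f"
  by (induction n) (auto simp: le_Suc_eq simp del: C_k.simps intro: C_k_SucD)

lemma C_k_const: "C_k k (\<lambda>x. c)"
proof (induction k arbitrary: c)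
  case (Suc k)
  have "frechet_derivative (\<lambda>x::'a. c) (at x) = (\<lambda>_. 0)" for x :: 'a
    by (simp add: frechet_derivative_const)
  then show ?case using Suc[of 0] by simp
qed simp

text \<open>By uniqueness of derivatives any derivative that can be exhibited may stand for the
  \<open>frechet_derivative\<close> of the definition; with its counterpart \<open>C_k_SucE\<close>
  this reduces the closure properties to the calculus rules.\<close>

lemma C_k_SucI:
  assumes "\<And>x. (f has_derivative f' x) (at x)" "\<And>i. i \<in> Basis \<Longrightarrow> C_k k (\<lambda>x. f' x i)"
  shows "C_k (Suc k) f"
proof -
  have "frechet_derivative f (at x) = f' x" for x
    using frechet_derivative_at[OF assms(1)[of x]] by simp
  then show ?thesis using assms by (auto simp: differentiable_def)
qed

lemma C_k_SucE:
  assumes "C_k (Suc k) f"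
  shows "(f has_derivative frechet_derivative f (at x)) (at x)"
    "i \<in> Basis \<Longrightarrow> C_k k (\<lambda>x. frechet_derivative f (at x) i)"
  using assms by (auto simp: frechet_derivative_works)

lemma C_k_add: "C_k k f \<Longrightarrow> C_k k g \<Longrightarrow> C_k k (\<lambda>x. f x + g x)"
proof (induction k arbitrary: f g)
  case (Suc k)
  show ?case
    by (rule C_k_SucI[where f'="\<lambda>x y. frechet_derivative f (at x) y + frechet_derivative g (at x) y"])
       (use Suc.prems in \<open>simp_all only: has_derivative_add C_k_SucE Suc.IH\<close>)
qed (auto intro: continuous_intros)

lemma C_k_mult: "C_k k f \<Longrightarrow> C_k k g \<Longrightarrow> C_k k (\<lambda>x. f x * g x)"
proof (induction k arbitrary: f g)
  case (Suc k)
  show ?case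
    by (rule C_k_SucI[where f'="\<lambda>x y. f x * frechet_derivative g (at x) y + frechet_derivative f (at x) y * g x"])
       (use Suc.prems in \<open>simp_all only: has_derivative_mult C_k_SucE C_k_add Suc.IH C_k_SucD\<close>)
qed (auto intro: continuous_intros)

lemma C_k_cmult: "C_k k f \<Longrightarrow> C_k k (\<lambda>x. c * f x)"
  by (intro C_k_mult C_k_const)

lemma C_k_prod: "finite I \<Longrightarrow> (\<And>i. i \<in> I \<Longrightarrow> C_k k (f i)) \<Longrightarrow> C_k k (\<lambda>x. \<Prod>i\<in>I. f i x)"
  by (induction I rule: finite_induct) (auto intro: C_k_const C_k_mult)

lemma C_k_affine:
  assumes "C_k k f"
  shows "C_k k (\<lambda>x. f (s *\<^sub>R x + c))"
  using assms
proof (induction k arbitrary: f)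
  case 0
  then show ?case by (auto intro!: continuous_on_compose2[of UNIV f] continuous_intros)
next
  case (Suc k)
  let ?D = "\<lambda>x. frechet_derivative f (at x)"
  have D: "((\<lambda>x. f (s *\<^sub>R x + c)) has_derivative (\<lambda>y. ?D (s *\<^sub>R x + c) (s *\<^sub>R y))) (at x)" for x
    by (rule has_derivative_compose[where g=f]) (rule derivative_eq_intros C_k_SucE(1)[OF Suc.prems] refl | simp)+
  have "?D y (s *\<^sub>R i) = s * ?D y i" for y i
    using has_derivative_linear[OF C_k_SucE(1)[OF Suc.prems, of y]] by (simp add: linear_cmul)
  then show ?case
    using C_k_cmult[OF Suc.IH[OF C_k_SucE(2)[OF Suc.prems]]]
    by (intro C_k_SucI[OF D]) simp
qed

lemma C_k_inner:
  fixes f :: "real \<Rightarrow> real"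
  assumes "C_k k f"
  shows "C_k k (\<lambda>x::'a::euclidean_space. f (x \<bullet> v))"
  using assms
proof (induction k arbitrary: f)
  case 0
  then show ?case by (auto intro!: continuous_on_compose2[of UNIV f] continuous_intros)
next
  case (Suc k)
  let ?D = "\<lambda>x. frechet_derivative f (at x)"
  have D: "((\<lambda>x::'a. f (x \<bullet> v)) has_derivative (\<lambda>y. ?D (x \<bullet> v) (y \<bullet> v))) (at x)" for x
    by (rule has_derivative_compose[where g=f]) (rule derivative_eq_intros C_k_SucE(1)[OF Suc.prems] refl | simp)+
  have "?D y r = r * ?D y 1" for y r
    using linear_cmul[OF has_derivative_linear[OF C_k_SucE(1)[OF Suc.prems, of y]], of r 1] by simp
  then have *: "(\<lambda>x::'a. ?D (x \<bullet> v) (i \<bullet> v)) = (\<lambda>x. (i \<bullet> v) * ?D (x \<bullet> v) 1)" for i by blast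
  have "C_k k (\<lambda>x. ?D x 1)" using C_k_SucE(2)[OF Suc.prems] by simp
  then show ?case
    by (intro C_k_SucI[OF D]) (use C_k_cmult[OF Suc.IH] in \<open>auto simp: *\<close>)
qed

lemma C_k_Suc_real:
  fixes f :: "real \<Rightarrow> real"
  assumes "\<And>x. (f has_real_derivative f' x) (at x)" "C_k k f'"
  shows "C_k (Suc k) f"
  by (rule C_k_SucI[where f'="\<lambda>x y. f' x * y"])
     (use assms in \<open>auto simp: has_field_derivative_def\<close>)

section \<open>A smooth step and compactly supported cutoff functions\<close>

definition flat :: "nat \<Rightarrow> real \<Rightarrow> real" where
  "flat n x = (if x \<le> 0 then 0 else exp (- 1 / x) / x ^ n)"

text \<open>The powers in \<open>flat\<close> are there for this formula: derivatives of members of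
  the family are linear combinations of members, so one induction, \<open>C_k_flat\<close>, proves
  all of them smooth at once.\<close>

lemma flat_deriv:
  "(flat n has_real_derivative flat (n + 2) x - real n * flat (n + 1) x) (at x)"
proof -
  consider "x < 0" | "x = 0" | "x > 0" by linarith
  then show ?thesis
  proof cases
    case 1
    have "((\<lambda>_. 0) has_real_derivative 0) (at x)" by simp
    moreover have "\<forall>\<^sub>F y in nhds x. flat n y = 0"
      using eventually_nhds_in_open[of "{..<0}" x] 1 by (auto simp: flat_def elim: eventually_mono)
    ultimately show ?thesis
      using 1 DERIV_cong_ev[of x x "flat n" "\<lambda>_. 0" 0] by (simp add: flat_def)
  next
    case 2
    have "((\<lambda>y. flat n y / y) \<longlongrightarrow> 0) (at 0)"
    proof (rule filterlim_split_at_real)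
      show "((\<lambda>y. flat n y / y) \<longlongrightarrow> 0) (at_left 0)"
        by (rule tendsto_eventually) (auto simp: flat_def eventually_at_filter)
      \<comment> \<open>The substitution \<open>z = inverse y\<close> turns the quotient into a
        power of z divided by \<open>exp z\<close>.\<close>
      have "((\<lambda>y. exp (- 1 / y) / y ^ n / y) \<longlongrightarrow> 0) (at_right (0::real))"
      proof -
        have "((\<lambda>z::real. z ^ Suc n / exp z) \<longlongrightarrow> 0) at_top"
          by (rule tendsto_power_div_exp_0)
        from filterlim_compose[OF this filterlim_inverse_at_top_right]
        have "((\<lambda>y::real. inverse y ^ Suc n / exp (inverse y)) \<longlongrightarrow> 0) (at_right 0)" .
        moreover have "inverse y ^ Suc n / exp (inverse y) = exp (- 1 / y) / y ^ n / y" for y :: real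
          by (simp add: divide_inverse exp_minus power_inverse)
        ultimately show ?thesis by simp
      qed
      then show "((\<lambda>y. flat n y / y) \<longlongrightarrow> 0) (at_right 0)"
        by (rule Lim_transform_eventually) (auto simp: flat_def eventually_at_filter)
    qed
    then show ?thesis using 2 by (simp add: has_field_derivative_iff flat_def)
  next
    case 3
    have "((\<lambda>x. exp (- 1 / x) / x ^ n) has_real_derivative flat (n + 2) x - real n * flat (n + 1) x) (at x)"
      using 3 
      apply -
      apply (rule derivative_eq_intros refl | simp)+
      apply (cases n)
      apply (simp_all add: flat_def field_simps power2_eq_square)
      done
    moreover have "\<forall>\<^sub>F y in nhds x. flat n y = exp (- 1 / y) / y ^ n"
      using eventually_nhds_in_open[of "{0<..}" x] 3 by (auto simp: flat_def elim: eventually_mono)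
    ultimately show ?thesis
      using DERIV_cong_ev[of x x "flat n" "\<lambda>x. exp (- 1 / x) / x ^ n"] by simp
  qed
qed

lemma C_k_flat: "C_k k (flat n)"
proof (induction k arbitrary: n)
  case 0
  show ?case using flat_deriv[of n] by (auto intro!: continuous_at_imp_continuous_on DERIV_isCont)
next
  case (Suc k)
  have "C_k k (\<lambda>x. flat (n + 2) x + (- real n) * flat (n + 1) x)"
    by (intro C_k_add C_k_cmult Suc)
  then show ?case by (intro C_k_Suc_real[OF flat_deriv]) simp
qed

text \<open>The step is the antiderivative of a bump supported on [0, 1], divided by its total mass;
  it is constant on both sides because the bump vanishes there.\<close>

lemma smooth_step:
  obtains s :: "real \<Rightarrow> real" where
    "\<And>k. C_k k s" "\<And>x. x \<le> 0 \<Longrightarrow> s x = 0" "\<And>x. x \<ge> 1 \<Longrightarrow> s x = 1"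
proof -
  define h where "h x = flat 0 x * flat 0 (1 - x)" for x
  have Ch: "C_k k h" for k
    unfolding h_def using C_k_affine[OF C_k_flat, of k 0 "-1" 1] by (intro C_k_mult C_k_flat) simp
  have h_cont: "continuous_on A h" for A
    using Ch[of 0] continuous_on_subset[of UNIV h A] by simp
  have h0: "h x = 0" if "x \<le> 0 \<or> x \<ge> 1" for x using that by (auto simp: h_def flat_def)
  have hpos: "h x > 0" if "0 < x" "x < 1" for x using that by (simp add: h_def flat_def)
  have hnn: "h x \<ge> 0" for x using h0[of x] hpos[of x] by fastforce
  have Hint: "h integrable_on {a..b}" for a b by (rule integrable_continuous_interval[OF h_cont])
  define H where "H x = (if x \<le> 0 then 0 else integral {0..x} h)" for x
  have H_eq: "H x = integral {a..x} h" if "a \<le> 0" "a \<le> x" for a x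
  proof (cases "x \<le> 0")
    case True
    have "integral {a..x} h = integral {a..x} (\<lambda>x. 0)"
      by (rule integral_cong) (use True h0 in auto)
    then show ?thesis using True by (simp add: H_def)
  next
    case False
    have "integral {a..0} h = integral {a..0} (\<lambda>x. 0)"
      by (rule integral_cong) (use h0 in auto)
    then show ?thesis
      using False that Henstock_Kurzweil_Integration.integral_combine[OF _ _ Hint, of a 0 x]
      by (simp add: H_def)
  qed
  have HD: "(H has_real_derivative h x) (at x)" for x
  proof -
    \<comment> \<open>The base point lies below both 0 and x: the integral from \<open>a\<close>
      then agrees with \<open>H\<close> near x, and x is interior to the interval of
      differentiation.\<close>
    define a where "a = min 0 x - 1"
    have "((\<lambda>x. integral {a..x} h) has_real_derivative h x) (at x within {a..x+1})"
      by (intro integral_has_real_derivative h_cont) (auto simp: a_def)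
    moreover have "x \<in> interior {a..x+1}" by (auto simp: a_def)
    ultimately have "((\<lambda>x. integral {a..x} h) has_real_derivative h x) (at x)"
      by (metis at_within_interior)
    moreover have "\<forall>\<^sub>F y in nhds x. H y = integral {a..y} h"
    proof -
      have "\<forall>\<^sub>F y in nhds x. y \<in> {a<..}"
        by (rule eventually_nhds_in_open) (auto simp: a_def)
      then show ?thesis by eventually_elim (auto intro!: H_eq simp: a_def)
    qed
    ultimately show ?thesis
      using DERIV_cong_ev[of x x H "\<lambda>x. integral {a..x} h" "h x" "h x"] by simp
  qed
  have CH: "C_k k H" for k
    using C_k_Suc_real[OF HD Ch] C_k_SucD by blast
  define m where "m = H 1"
  have H1: "H x = m" if "x \<ge> 1" for x
  proof -
    have "integral {1..x} h = integral {1..x} (\<lambda>x. 0)"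
      by (rule integral_cong) (use h0 in auto)
    then show ?thesis
      using that Henstock_Kurzweil_Integration.integral_combine[OF _ _ Hint, of 0 1 x]
      by (simp add: H_def m_def)
  qed
  have Hmono: "H x \<le> H y" if "x \<le> y" for x y
    by (rule DERIV_nonneg_imp_nondecreasing[OF that]) (use HD hnn in blast)
  \<comment> \<open>The bump vanishes at 0 and at 1, so strict growth is taken from an interval on
    which it is positive.\<close>
  have "H (1/4) < H (3/4)"
    by (rule DERIV_pos_imp_increasing) (use HD hpos in \<open>auto intro!: exI\<close>)
  moreover have "0 \<le> H (1/4)" using Hmono[of 0 "1/4"] by (simp add: H_def)
  moreover have "H (3/4) \<le> m" using Hmono[of "3/4" 1] by (simp add: m_def)
  ultimately have m: "m > 0" by linarith
  show ?thesis
  proof (rule that[of "\<lambda>x. (1 / m) * H x"])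
    show "C_k k (\<lambda>x. (1 / m) * H x)" for k by (rule C_k_cmult[OF CH])
    show "(1/m) * H x = 0" if "x \<le> 0" for x using that by (simp add: H_def)
    show "(1/m) * H x = 1" if "x \<ge> 1" for x using that H1 m by simp
  qed
qed

lemma C_k_continuous: "C_k k f \<Longrightarrow> continuous_on A f"
  using C_k_mono[of k f 0] continuous_on_subset by auto

lemma C_k_differentiable: "C_k (Suc k) f \<Longrightarrow> f differentiable (at x)"
  by simp

lemma test_functionI:
  assumes "\<And>k. C_k k f" "compact K" "K \<subseteq> \<Omega>" "\<And>x. x \<notin> K \<Longrightarrow> f x = 0"
  shows "test_function \<Omega> f"
proof -
  have "closure {x. f x \<noteq> 0} \<subseteq> K"
    by (rule closure_minimal) (use assms compact_imp_closed in auto)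
  then show ?thesis unfolding test_function_def
    using assms closed_Int_compact[OF closed_closure assms(2), of "{x. f x \<noteq> 0}"]
    by (auto simp: Int_absorb2)
qed

lemma test_functionE:
  assumes "test_function \<Omega> f"
  obtains K where "compact K" "K \<subseteq> \<Omega>" "\<And>x. x \<notin> K \<Longrightarrow> f x = 0"
proof
  show "compact (closure {x. f x \<noteq> 0})" "closure {x. f x \<noteq> 0} \<subseteq> \<Omega>"
    using assms by (auto simp: test_function_def)
  show "f x = 0" if "x \<notin> closure {x. f x \<noteq> 0}" for x
    using that closure_subset[of "{x. f x \<noteq> 0}"] by auto
qed

lemma test_function_C_k: "test_function \<Omega> f \<Longrightarrow> C_k k f"
  by (simp add: test_function_def)

lemma test_function_mono: "test_function \<Omega> f \<Longrightarrow> \<Omega> \<subseteq> \<Omega>' \<Longrightarrow> test_function \<Omega>' f"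
  by (auto simp: test_function_def)

lemma test_function_outside: "test_function \<Omega> f \<Longrightarrow> x \<notin> \<Omega> \<Longrightarrow> f x = 0"
  by (metis test_functionE subsetD)

lemma test_function_zero: "test_function \<Omega> (\<lambda>x. 0)"
  by (rule test_functionI[of _ "{}"]) (auto intro: C_k_const)

lemma test_function_add:
  assumes "test_function \<Omega> f" "test_function \<Omega> g"
  shows "test_function \<Omega> (\<lambda>x. f x + g x)"
proof -
  obtain K where K: "compact K" "K \<subseteq> \<Omega>" "\<And>x. x \<notin> K \<Longrightarrow> f x = 0"
    using test_functionE[OF assms(1)] by blast
  obtain L where L: "compact L" "L \<subseteq> \<Omega>" "\<And>x. x \<notin> L \<Longrightarrow> g x = 0"
    using test_functionE[OF assms(2)] by blast
  show ?thesis
    by (rule test_functionI[of _ "K \<union> L"])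
       (use K L assms in \<open>auto intro!: C_k_add dest: test_function_C_k\<close>)
qed

lemma test_function_mult:
  assumes "test_function \<Omega> f" "\<And>k. C_k k g"
  shows "test_function \<Omega> (\<lambda>x. f x * g x)"
proof -
  obtain K where K: "compact K" "K \<subseteq> \<Omega>" "\<And>x. x \<notin> K \<Longrightarrow> f x = 0"
    using test_functionE[OF assms(1)] by blast
  show ?thesis
    by (rule test_functionI[of _ K])
       (use K assms in \<open>auto intro!: C_k_mult dest: test_function_C_k\<close>)
qed

lemma test_function_cmult:
  assumes "test_function \<Omega> f"
  shows "test_function \<Omega> (\<lambda>x. c * f x)"
  using test_function_mult[OF assms C_k_const[of _ c]] by (simp add: mult.commute)

text \<open>Boxes rather than balls: a product over the coordinates of one-variable steps is smooth
  by \<open>C_k_inner\<close> and \<open>C_k_prod\<close>.\<close>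

lemma smooth_box_bump:
  fixes p :: "'a::euclidean_space"
  assumes "\<delta> > 0"
  obtains b where "\<And>k. C_k k b" "\<And>x. (\<And>i. i \<in> Basis \<Longrightarrow> \<bar>(x - p) \<bullet> i\<bar> \<le> \<delta>) \<Longrightarrow> b x = 1"
    "\<And>x i. i \<in> Basis \<Longrightarrow> \<bar>(x - p) \<bullet> i\<bar> \<ge> 2 * \<delta> \<Longrightarrow> b x = 0"
proof -
  obtain s :: "real \<Rightarrow> real" where s: "\<And>k. C_k k s" "\<And>x. x \<le> 0 \<Longrightarrow> s x = 0" "\<And>x. x \<ge> 1 \<Longrightarrow> s x = 1"
    using smooth_step by blast
  \<comment> \<open>With t = (x - p) \<bullet> i the two factors are s (2 - t / \<delta>) and s (2 +
    t / \<delta>): both are 1 when t has modulus at most \<delta>, and one of them is 0 when the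
    modulus is at least 2 \<delta>. The affine form matches \<open>C_k_affine\<close>.\<close>
  define b where "b x = (\<Prod>i\<in>Basis. s ((- 1 / \<delta>) * (x \<bullet> i) + (2 + p \<bullet> i / \<delta>)) *
    s ((1 / \<delta>) * (x \<bullet> i) + (2 - p \<bullet> i / \<delta>)))" for x
  have eq: "(- 1 / \<delta>) * (x \<bullet> i) + (2 + p \<bullet> i / \<delta>) = 2 - ((x - p) \<bullet> i) / \<delta>"
    "(1 / \<delta>) * (x \<bullet> i) + (2 - p \<bullet> i / \<delta>) = 2 + ((x - p) \<bullet> i) / \<delta>" for x i
    by (simp_all add: inner_diff_left diff_divide_distrib)
  have C: "C_k k (\<lambda>x::'a. s (a * (x \<bullet> i) + c))" for k a c i
    using C_k_inner[OF C_k_affine[OF s(1), of k a c], of i] by simp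
  show thesis
  proof (rule that[of b])
    show "C_k k b" for k unfolding b_def by (intro C_k_prod C_k_mult C) auto
    show "b x = 1" if x: "\<And>i. i \<in> Basis \<Longrightarrow> \<bar>(x - p) \<bullet> i\<bar> \<le> \<delta>" for x
      unfolding b_def eq
    proof (rule prod.neutral, rule ballI)
      fix i :: 'a assume "i \<in> Basis"
      then have "\<bar>((x - p) \<bullet> i) / \<delta>\<bar> \<le> 1" using x assms by (simp only: abs_divide) simp
      then have "-1 \<le> ((x - p) \<bullet> i) / \<delta>" "((x - p) \<bullet> i) / \<delta> \<le> 1" by linarith+
      then show "s (2 - ((x - p) \<bullet> i) / \<delta>) * s (2 + ((x - p) \<bullet> i) / \<delta>) = 1"
        using s(3)[of "2 - ((x - p) \<bullet> i) / \<delta>"] s(3)[of "2 + ((x - p) \<bullet> i) / \<delta>"] by simp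
    qed
    show "b x = 0" if i: "i \<in> Basis" and x: "\<bar>(x - p) \<bullet> i\<bar> \<ge> 2 * \<delta>" for x i
      unfolding b_def eq
    proof (rule prod_zero)
      have "\<bar>((x - p) \<bullet> i) / \<delta>\<bar> \<ge> 2" using x assms by (simp add: abs_divide field_simps)
      then have "s (2 - ((x - p) \<bullet> i) / \<delta>) = 0 \<or> s (2 + ((x - p) \<bullet> i) / \<delta>) = 0"
        using s(2)[of "2 - ((x - p) \<bullet> i) / \<delta>"] s(2)[of "2 + ((x - p) \<bullet> i) / \<delta>"] by linarith
      then show "\<exists>i\<in>Basis. s (2 - ((x - p) \<bullet> i) / \<delta>) * s (2 + ((x - p) \<bullet> i) / \<delta>) = 0"
        using i by auto
    qed simp
  qed
qed

lemma smooth_local_bump: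
  fixes p :: "'a::euclidean_space"
  assumes "open U" "p \<in> U"
  obtains b W where "test_function U b" "open W" "p \<in> W" "\<And>x. x \<in> W \<Longrightarrow> b x = 1"
proof -
  obtain e where e: "e > 0" "cball p e \<subseteq> U"
    using assms open_contains_cball by metis
  \<comment> \<open>In the box of half-width 2 \<delta> the l1 distance from p is at most
    \<open>DIM('a)\<close> times 2 \<delta>, which is \<open>e\<close>; the l1 norm dominates the
    Euclidean one.\<close>
  define \<delta> where "\<delta> = e / (2 * DIM('a))"
  have \<delta>: "\<delta> > 0" using e by (simp add: \<delta>_def)
  obtain b where b: "\<And>k. C_k k b" "\<And>x. (\<And>i. i \<in> Basis \<Longrightarrow> \<bar>(x - p) \<bullet> i\<bar> \<le> \<delta>) \<Longrightarrow> b x = 1"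
    "\<And>x i. i \<in> Basis \<Longrightarrow> \<bar>(x - p) \<bullet> i\<bar> \<ge> 2 * \<delta> \<Longrightarrow> b x = 0"
    using smooth_box_bump[OF \<delta>] by metis
  show thesis
  proof (rule that[of b "ball p \<delta>"])
    have "b x = 0" if "x \<notin> cball p e" for x
    proof (rule ccontr)
      assume "b x \<noteq> 0"
      then have *: "\<bar>(x - p) \<bullet> i\<bar> \<le> 2 * \<delta>" if "i \<in> Basis" for i using b(3)[OF that] by force
      have "norm (x - p) \<le> (\<Sum>i\<in>Basis. \<bar>(x - p) \<bullet> i\<bar>)" by (rule norm_le_l1)
      also have "\<dots> \<le> (\<Sum>i\<in>(Basis::'a set). 2 * \<delta>)" by (intro sum_mono *)
      also have "\<dots> = e" by (simp add: \<delta>_def)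
      finally show False using that by (simp add: dist_norm norm_minus_commute)
    qed
    then show "test_function U b" by (intro test_functionI[OF b(1) compact_cball e(2)])
    show "b x = 1" if "x \<in> ball p \<delta>" for x
    proof (rule b(2))
      fix i :: 'a assume "i \<in> Basis"
      then have "\<bar>(x - p) \<bullet> i\<bar> \<le> norm (x - p)" by (rule Basis_le_norm)
      then show "\<bar>(x - p) \<bullet> i\<bar> \<le> \<delta>" using that by (simp add: dist_norm norm_minus_commute)
    qed
  qed (use \<delta> in auto)
qed

text \<open>Bumps at finitely many points whose plateaus cover \<open>K\<close> are merged into one
  function. Being 1 on a neighbourhood \<open>W\<close>, and not only on \<open>K\<close>, is what
  makes the gradient of the cutoff vanish on \<open>K\<close>.\<close>

lemma smooth_cutoff:
  fixes K :: "'a::euclidean_space set"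
  assumes "compact K" "open U" "K \<subseteq> U"
  obtains \<eta> W where "test_function U \<eta>" "open W" "K \<subseteq> W" "\<And>x. x \<in> W \<Longrightarrow> \<eta> x = 1"
proof -
  have "\<forall>p\<in>K. \<exists>b W. test_function U b \<and> open W \<and> p \<in> W \<and> (\<forall>x\<in>W. b x = 1)"
    using smooth_local_bump[OF assms(2)] assms(3) by (metis subsetD)
  then obtain b W where b: "\<And>p. p \<in> K \<Longrightarrow> test_function U (b p)" "\<And>p. p \<in> K \<Longrightarrow> open (W p)"
    "\<And>p. p \<in> K \<Longrightarrow> p \<in> W p" "\<And>p x. p \<in> K \<Longrightarrow> x \<in> W p \<Longrightarrow> b p x = 1"
    by metis
  obtain F where F: "F \<subseteq> K" "finite F" "K \<subseteq> (\<Union>p\<in>F. W p)"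
    by (rule compactE_image[OF assms(1), of K W]) (use b in auto)
  have "\<exists>\<eta>. test_function U \<eta> \<and> (\<forall>x\<in>(\<Union>p\<in>F. W p). \<eta> x = 1)"
    using F(2,1)
  proof (induction F rule: finite_induct)
    case empty
    then show ?case using test_function_zero by auto
  next
    case (insert p F)
    then obtain \<eta> where c: "test_function U \<eta>" "\<forall>x\<in>(\<Union>p\<in>F. W p). \<eta> x = 1" by auto
    have "C_k k (\<lambda>x. 1 + (-1) * \<eta> x)" for k
      by (intro C_k_add C_k_cmult C_k_const test_function_C_k[OF c(1)])
    \<comment> \<open>The new function is 1 - (1 - \<eta>) (1 - b p), which is 1 wherever \<eta> or
      \<open>b p\<close> is.\<close>
    then have "test_function U (\<lambda>x. \<eta> x + b p x * (1 + (-1) * \<eta> x))"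
      using insert.prems by (intro test_function_add test_function_mult c b) auto
    moreover have "\<eta> x + b p x * (1 + (-1) * \<eta> x) = 1" if "x \<in> (\<Union>p\<in>insert p F. W p)" for x
      using that c b(4)[of p x] insert.prems by (cases "x \<in> W p") auto
    ultimately show ?case by blast
  qed
  then obtain \<eta> where c: "test_function U \<eta>" "\<forall>x\<in>(\<Union>p\<in>F. W p). \<eta> x = 1" by blast
  show thesis
    by (rule that[of \<eta> "\<Union>p\<in>F. W p"]) (use c F b in \<open>auto intro!: open_UN\<close>)
qed

section \<open>Gradients of test functions\<close>

lemma grad_inner: "i \<in> Basis \<Longrightarrow> grad f x \<bullet> i = frechet_derivative f (at x) i"
  by (simp add: grad_def inner_sum_left_Basis)

lemma grad_unique:
  assumes "(f has_derivative (\<lambda>h. v \<bullet> h)) (at x)"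
  shows "grad f x = v"
proof -
  have "frechet_derivative f (at x) = (\<lambda>h. v \<bullet> h)"
    using frechet_derivative_at[OF assms] by simp
  then have "grad f x \<bullet> i = v \<bullet> i" if "i \<in> Basis" for i using that by (simp add: grad_inner)
  then show ?thesis by (rule euclidean_eqI)
qed

lemma has_derivative_grad:
  assumes "f differentiable (at x)"
  shows "(f has_derivative (\<lambda>h. grad f x \<bullet> h)) (at x)"
proof -
  let ?D = "frechet_derivative f (at x)"
  have D: "(f has_derivative ?D) (at x)" using assms by (simp add: frechet_derivative_works)
  have "?D h = grad f x \<bullet> h" for h
  proof -
    have "?D h = ?D (\<Sum>i\<in>Basis. (h \<bullet> i) *\<^sub>R i)" by (simp add: euclidean_representation)
    also have "\<dots> = (\<Sum>i\<in>Basis. (h \<bullet> i) * ?D i)"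
      using has_derivative_linear[OF D] by (simp add: linear_sum linear_cmul)
    also have "\<dots> = grad f x \<bullet> h"
      by (subst euclidean_inner[of "grad f x" h]) (simp add: grad_inner mult.commute)
    finally show ?thesis .
  qed
  then have "?D = (\<lambda>h. grad f x \<bullet> h)" by blast
  then show ?thesis using D by simp
qed

lemma has_derivative_grad_test:
  "test_function \<Omega> f \<Longrightarrow> (f has_derivative (\<lambda>h. grad f x \<bullet> h)) (at x)"
  by (rule has_derivative_grad, rule C_k_differentiable[of 0], rule test_function_C_k)

lemma continuous_on_grad:
  assumes "test_function \<Omega> f" shows "continuous_on A (grad f)"
  unfolding grad_def
  by (intro continuous_intros C_k_continuous[of 0] C_k_SucE(2) test_function_C_k[OF assms])

lemma grad_zero:
  "grad (\<lambda>x. 0) x = 0"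
  by (rule grad_unique) simp

lemma grad_eq_on_open:
  assumes "open W" "x \<in> W" "\<And>y. y \<in> W \<Longrightarrow> f y = g y" "(g has_derivative (\<lambda>h. v \<bullet> h)) (at x)"
  shows "grad f x = v"
  by (rule grad_unique, rule has_derivative_transform_within_open[OF assms(4,1,2)]) (simp add: assms(3))

text \<open>Off the compact set the function is locally zero, the complement being open, so its
  gradient vanishes there too.\<close>

lemma test_function_grad_supp:
  assumes "test_function \<Omega> f"
  obtains K where "compact K" "K \<subseteq> \<Omega>" "\<And>x. x \<notin> K \<Longrightarrow> f x = 0" "\<And>x. x \<notin> K \<Longrightarrow> grad f x = 0"
proof -
  obtain K where K: "compact K" "K \<subseteq> \<Omega>" "\<And>x. x \<notin> K \<Longrightarrow> f x = 0"
    using test_functionE[OF assms] by blast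
  have "grad f x = 0" if "x \<notin> K" for x
    by (rule grad_eq_on_open[of "- K" _ _ "\<lambda>x. 0"]) (use K that compact_imp_closed in auto)
  with K that show thesis by blast
qed

lemma grad_add:
  assumes "test_function \<Omega> f" "test_function \<Omega> g"
  shows "grad (\<lambda>x. f x + g x) x = grad f x + grad g x"
  using has_derivative_add[OF has_derivative_grad_test[OF assms(1)] has_derivative_grad_test[OF assms(2)]]
  by (intro grad_unique) (simp add: inner_add_left)

lemma grad_cmult:
  assumes "test_function \<Omega> f"
  shows "grad (\<lambda>x. c * f x) x = c *\<^sub>R grad f x"
  using has_derivative_mult_right[OF has_derivative_grad_test[OF assms]]
  by (intro grad_unique) simp

lemma grad_mult:
  assumes "test_function \<Omega> f" "test_function \<Omega>' g"
  shows "grad (\<lambda>x. f x * g x) x = f x *\<^sub>R grad g x + g x *\<^sub>R grad f x"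
proof (rule grad_unique)
  show "((\<lambda>x. f x * g x) has_derivative (\<lambda>h. (f x *\<^sub>R grad g x + g x *\<^sub>R grad f x) \<bullet> h)) (at x)"
    by (rule has_derivative_eq_rhs[OF has_derivative_mult[OF has_derivative_grad_test[OF assms(1)] has_derivative_grad_test[OF assms(2)]]])
       (simp add: inner_add_left fun_eq_iff)
qed

lemma grad_affine:
  assumes "test_function \<Omega> f"
  shows "grad (\<lambda>x. f (s *\<^sub>R x + c)) x = s *\<^sub>R grad f (s *\<^sub>R x + c)"
proof (rule grad_unique)
  have "((\<lambda>x. f (s *\<^sub>R x + c)) has_derivative (\<lambda>h. grad f (s *\<^sub>R x + c) \<bullet> (s *\<^sub>R h))) (at x)"
    by (rule has_derivative_compose[where g=f, OF _ has_derivative_grad_test[OF assms]])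
       (rule derivative_eq_intros refl | simp)+
  then show "((\<lambda>x. f (s *\<^sub>R x + c)) has_derivative (\<lambda>h. (s *\<^sub>R grad f (s *\<^sub>R x + c)) \<bullet> h)) (at x)"
    by simp
qed

lemma test_function_affine:
  fixes f :: "'a::euclidean_space \<Rightarrow> real"
  assumes "test_function \<Omega> f" "s \<noteq> 0"
  shows "test_function {x. s *\<^sub>R x + c \<in> \<Omega>} (\<lambda>x. f (s *\<^sub>R x + c))"
proof -
  obtain K where K: "compact K" "K \<subseteq> \<Omega>" "\<And>x. x \<notin> K \<Longrightarrow> f x = 0"
    using test_functionE[OF assms(1)] by blast
  let ?g = "\<lambda>y. (1 / s) *\<^sub>R (y - c)"
  have g: "s *\<^sub>R ?g y + c = y" "?g (s *\<^sub>R x + c) = x" for x y using assms(2) by simp_all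
  show ?thesis
  proof (rule test_functionI[of _ "?g ` K"])
    show "compact (?g ` K)" by (intro compact_continuous_image continuous_intros K)
    show "?g ` K \<subseteq> {x. s *\<^sub>R x + c \<in> \<Omega>}" using K(2) g(1) by auto
    show "f (s *\<^sub>R x + c) = 0" if "x \<notin> ?g ` K" for x
      using that K(3) g(2)[of x] by (metis image_eqI)
    show "C_k k (\<lambda>x. f (s *\<^sub>R x + c))" for k
      by (rule C_k_affine[OF test_function_C_k[OF assms(1)]])
  qed
qed

section \<open>The Hilbert space of square-integrable functions\<close>


lemma square_integrable_inner:
  assumes "square_integrable f" "square_integrable g"
  shows "integrable lborel (\<lambda>x. f x \<bullet> g x)"
proof (rule Bochner_Integration.integrable_bound)
  show "integrable lborel (\<lambda>x. (norm (f x))\<^sup>2 + (norm (g x))\<^sup>2)"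
    using assms by (simp add: square_integrable_def)
  have [measurable]: "f \<in> borel_measurable lborel" "g \<in> borel_measurable lborel"
    using assms by (simp_all add: square_integrable_def)
  show "(\<lambda>x. f x \<bullet> g x) \<in> borel_measurable lborel" by measurable
  have "\<bar>f x \<bullet> g x\<bar> \<le> (norm (f x))\<^sup>2 + (norm (g x))\<^sup>2" for x
  proof -
    have "\<bar>f x \<bullet> g x\<bar> \<le> norm (f x) * norm (g x)" by (rule Cauchy_Schwarz_ineq2)
    also have "\<dots> \<le> (norm (f x))\<^sup>2 + (norm (g x))\<^sup>2"
      using sum_squares_bound[of "norm (f x)" "norm (g x)"] mult_nonneg_nonneg[OF norm_ge_zero[of "f x"] norm_ge_zero[of "g x"]]
      by linarith
    finally show ?thesis .
  qed
  then show "AE x in lborel. norm (f x \<bullet> g x) \<le> norm ((norm (f x))\<^sup>2 + (norm (g x))\<^sup>2)"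
    by (intro always_eventually) simp
qed

lemma square_integrable_add:
  assumes "square_integrable f" "square_integrable g"
  shows "square_integrable (\<lambda>x. f x + g x)"
proof -
  have "integrable lborel (\<lambda>x. (norm (f x))\<^sup>2 + 2 * (f x \<bullet> g x) + (norm (g x))\<^sup>2)"
    using assms square_integrable_inner[OF assms] by (simp add: square_integrable_def)
  moreover have "(norm (f x + g x))\<^sup>2 = (norm (f x))\<^sup>2 + 2 * (f x \<bullet> g x) + (norm (g x))\<^sup>2" for x
    by (simp add: power2_norm_eq_inner algebra_simps inner_commute)
  ultimately show ?thesis using assms by (auto simp: square_integrable_def)
qed

lemma square_integrable_scaleR:
  assumes "square_integrable f" shows "square_integrable (\<lambda>x. c *\<^sub>R f x)"
  using assms by (auto simp: square_integrable_def power_mult_distrib)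

lemma square_integrable_zero: "square_integrable (\<lambda>x. 0)"
  by (simp add: square_integrable_def)

lemma square_integrable_uminus:
  assumes "square_integrable f" shows "square_integrable (\<lambda>x. - f x)"
  using square_integrable_scaleR[OF assms, of "-1"] by simp

lemma square_integrable_diff:
  assumes "square_integrable f" "square_integrable g"
  shows "square_integrable (\<lambda>x. f x - g x)"
  using square_integrable_add[OF assms(1) square_integrable_uminus[OF assms(2)]] by simp

section \<open>The space L^2 as a type, with its inner product\<close>

definition l2_rel :: "('a::euclidean_space \<Rightarrow> 'b::euclidean_space) \<Rightarrow> ('a \<Rightarrow> 'b) \<Rightarrow> bool" where
  "l2_rel f g \<longleftrightarrow> square_integrable f \<and> square_integrable g \<and> (AE x in lborel. f x = g x)"

\<comment> \<open>The relation is reflexive only at square-integrable functions, so the partial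
  quotient contains exactly their classes. Having a type makes the general theory of complete inner
  product spaces applicable.\<close>
quotient_type (overloaded) ('a, 'b) l2 = "'a::euclidean_space \<Rightarrow> 'b::euclidean_space" / partial: l2_rel
proof (rule part_equivpI)
  show "\<exists>f :: 'a \<Rightarrow> 'b. l2_rel f f"
    by (rule exI[of _ "\<lambda>x. 0"]) (simp add: l2_rel_def square_integrable_zero)
  show "symp (l2_rel :: ('a \<Rightarrow> 'b) \<Rightarrow> _)"
    by (rule sympI) (auto simp: l2_rel_def elim: eventually_mono)
  show "transp (l2_rel :: ('a \<Rightarrow> 'b) \<Rightarrow> _)"
    by (rule transpI) (auto simp: l2_rel_def elim: eventually_elim2)
qed

lemma square_integrable_rep: "square_integrable (rep_l2 x)"
  using Quotient_rep_reflp[OF Quotient_l2, of x] by (simp add: l2_rel_def)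

lemma abs_rep_l2: "abs_l2 (rep_l2 x) = x"
  by (rule Quotient_abs_rep[OF Quotient_l2])

lemma abs_l2_eq_iff:
  assumes "square_integrable f" "square_integrable g"
  shows "abs_l2 f = abs_l2 g \<longleftrightarrow> (AE x in lborel. f x = g x)"
  using Quotient_rel[OF Quotient_l2, of f g] assms by (simp add: l2_rel_def)

lemma rep_abs_l2: "square_integrable f \<Longrightarrow> AE x in lborel. rep_l2 (abs_l2 f) x = f x"
  by (simp add: abs_l2_eq_iff[symmetric] square_integrable_rep abs_rep_l2)

instantiation l2 :: (euclidean_space, euclidean_space) real_vector
begin

lift_definition zero_l2 :: "('a, 'b) l2" is "\<lambda>x. 0"
  by (simp add: l2_rel_def square_integrable_zero)

lift_definition plus_l2 :: "('a, 'b) l2 \<Rightarrow> ('a, 'b) l2 \<Rightarrow> ('a, 'b) l2" is "\<lambda>f g x. f x + g x"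
  by (auto simp: l2_rel_def square_integrable_add elim: eventually_elim2)

lift_definition minus_l2 :: "('a, 'b) l2 \<Rightarrow> ('a, 'b) l2 \<Rightarrow> ('a, 'b) l2" is "\<lambda>f g x. f x - g x"
  by (auto simp: l2_rel_def square_integrable_diff elim: eventually_elim2)

lift_definition uminus_l2 :: "('a, 'b) l2 \<Rightarrow> ('a, 'b) l2" is "\<lambda>f x. - f x"
  by (auto simp: l2_rel_def square_integrable_uminus elim: eventually_mono)

lift_definition scaleR_l2 :: "real \<Rightarrow> ('a, 'b) l2 \<Rightarrow> ('a, 'b) l2" is "\<lambda>c f x. c *\<^sub>R f x"
  by (auto simp: l2_rel_def square_integrable_scaleR elim: eventually_mono)

instance
proof
  fix x y z :: "('a, 'b) l2" and a b :: real
  show "x + y + z = x + (y + z)" by transfer (auto simp: l2_rel_def add.assoc intro!: square_integrable_add)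
  show "x + y = y + x" by transfer (auto simp: l2_rel_def add.commute intro!: square_integrable_add)
  show "0 + x = x" by transfer (auto simp: l2_rel_def)
  show "- x + x = 0" by transfer (auto simp: l2_rel_def square_integrable_zero)
  show "x - y = x + - y" by transfer (auto simp: l2_rel_def square_integrable_diff)
  show "a *\<^sub>R (x + y) = a *\<^sub>R x + a *\<^sub>R y"
    by transfer (auto simp: l2_rel_def scaleR_add_right intro!: square_integrable_add square_integrable_scaleR)
  show "(a + b) *\<^sub>R x = a *\<^sub>R x + b *\<^sub>R x"
    by transfer (auto simp: l2_rel_def scaleR_add_left intro!: square_integrable_add square_integrable_scaleR)
  show "a *\<^sub>R b *\<^sub>R x = (a * b) *\<^sub>R x"
    by transfer (auto simp: l2_rel_def intro!: square_integrable_scaleR)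
  show "1 *\<^sub>R x = x" by transfer (auto simp: l2_rel_def)
qed

end

instantiation l2 :: (euclidean_space, euclidean_space) real_inner
begin

lift_definition inner_l2 :: "('a, 'b) l2 \<Rightarrow> ('a, 'b) l2 \<Rightarrow> real" is "\<lambda>f g. \<integral>x. f x \<bullet> g x \<partial>lborel"
proof -
  fix f f' g g' :: "'a \<Rightarrow> 'b"
  assume r: "l2_rel f f'" "l2_rel g g'"
  then have [measurable]: "f \<in> borel_measurable lborel" "g \<in> borel_measurable lborel"
     "f' \<in> borel_measurable lborel" "g' \<in> borel_measurable lborel"
    by (auto simp: l2_rel_def square_integrable_def)
  show "(\<integral>x. f x \<bullet> g x \<partial>lborel) = (\<integral>x. f' x \<bullet> g' x \<partial>lborel)"
    by (rule integral_cong_AE) (use r in \<open>auto simp: l2_rel_def elim: eventually_elim2\<close>)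
qed

definition norm_l2 :: "('a, 'b) l2 \<Rightarrow> real" where "norm_l2 x = sqrt (inner x x)"
definition dist_l2 :: "('a, 'b) l2 \<Rightarrow> ('a, 'b) l2 \<Rightarrow> real" where "dist_l2 x y = norm (x - y)"
definition sgn_l2 :: "('a, 'b) l2 \<Rightarrow> ('a, 'b) l2" where "sgn_l2 x = x /\<^sub>R norm x"
definition uniformity_l2 :: "(('a, 'b) l2 \<times> ('a, 'b) l2) filter" where
  "uniformity_l2 = (INF e\<in>{0<..}. principal {(x, y). dist x y < e})"
definition open_l2 :: "('a, 'b) l2 set \<Rightarrow> bool" where
  "open_l2 U \<longleftrightarrow> (\<forall>x\<in>U. eventually (\<lambda>(x', y). x' = x \<longrightarrow> y \<in> U) uniformity)"

instance
proof
  fix x y z :: "('a, 'b) l2" and a :: real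
  show "dist x y = norm (x - y)" by (rule dist_l2_def)
  show "sgn x = x /\<^sub>R norm x" by (rule sgn_l2_def)
  show "uniformity = (INF e\<in>{0<..}. principal {(x :: ('a, 'b) l2, y). dist x y < e})" by (rule uniformity_l2_def)
  show "open U \<longleftrightarrow> (\<forall>x\<in>U. eventually (\<lambda>(x', y). x' = x \<longrightarrow> y \<in> U) uniformity)"
    for U :: "('a, 'b) l2 set" by (rule open_l2_def)
  show "x \<bullet> y = y \<bullet> x" by transfer (simp add: inner_commute)
  show "(x + y) \<bullet> z = x \<bullet> z + y \<bullet> z"
    by transfer (auto simp: inner_add_left l2_rel_def intro!: Bochner_Integration.integral_add square_integrable_inner)
  show "(a *\<^sub>R x) \<bullet> y = a * (x \<bullet> y)" by transfer simp
  show "0 \<le> x \<bullet> x" by transfer simp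
  show "x \<bullet> x = 0 \<longleftrightarrow> x = 0"
  proof transfer
    fix f :: "'a \<Rightarrow> 'b" assume "l2_rel f f"
    then have f: "square_integrable f" by (simp add: l2_rel_def)
    have "(\<integral>x. f x \<bullet> f x \<partial>lborel) = 0 \<longleftrightarrow> (AE x in lborel. f x \<bullet> f x = 0)"
      by (rule integral_nonneg_eq_0_iff_AE) (use square_integrable_inner[OF f f] in auto)
    then show "((\<integral>x. f x \<bullet> f x \<partial>lborel) = 0) = l2_rel f (\<lambda>x. 0)"
      using f by (simp add: l2_rel_def square_integrable_zero)
  qed
  show "norm x = sqrt (x \<bullet> x)" by (rule norm_l2_def)
qed

end

lemma inner_abs_l2:
  "square_integrable f \<Longrightarrow> square_integrable g \<Longrightarrow> abs_l2 f \<bullet> abs_l2 g = (\<integral>x. f x \<bullet> g x \<partial>lborel)"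
  by (rule inner_l2.abs_eq) (auto simp: l2_rel_def)

lemma norm_abs_l2:
  "square_integrable f \<Longrightarrow> (norm (abs_l2 f))\<^sup>2 = (\<integral>x. (norm (f x))\<^sup>2 \<partial>lborel)"
  by (simp add: power2_norm_eq_inner inner_abs_l2)

lemma abs_l2_zero: "abs_l2 (\<lambda>x. 0) = 0"
  by (simp add: zero_l2_def)

lemma abs_l2_add:
  "square_integrable f \<Longrightarrow> square_integrable g \<Longrightarrow> abs_l2 (\<lambda>x. f x + g x) = abs_l2 f + abs_l2 g"
  by (subst plus_l2.abs_eq) (auto simp: l2_rel_def)

lemma abs_l2_diff:
  "square_integrable f \<Longrightarrow> square_integrable g \<Longrightarrow> abs_l2 (\<lambda>x. f x - g x) = abs_l2 f - abs_l2 g"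
  by (subst minus_l2.abs_eq) (auto simp: l2_rel_def)

lemma abs_l2_scaleR:
  "square_integrable f \<Longrightarrow> abs_l2 (\<lambda>x. c *\<^sub>R f x) = c *\<^sub>R abs_l2 f"
  by (subst scaleR_l2.abs_eq) (auto simp: l2_rel_def)

lemma square_integrable_sum:
  "(\<And>i. i \<in> I \<Longrightarrow> square_integrable (f i)) \<Longrightarrow> square_integrable (\<lambda>x. \<Sum>i\<in>I. f i x)"
  by (induction I rule: infinite_finite_induct) (auto intro: square_integrable_zero square_integrable_add)

lemma abs_l2_sum:
  "(\<And>i. i \<in> I \<Longrightarrow> square_integrable (f i)) \<Longrightarrow> abs_l2 (\<lambda>x. \<Sum>i\<in>I. f i x) = (\<Sum>i\<in>I. abs_l2 (f i))"
  by (induction I rule: infinite_finite_induct) (auto simp: abs_l2_zero abs_l2_add square_integrable_sum)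

lemma norm_diff_abs_l2:
  assumes "square_integrable f" "square_integrable g"
  shows "(norm (abs_l2 f - abs_l2 g))\<^sup>2 = (\<integral>x. (norm (f x - g x))\<^sup>2 \<partial>lborel)"
  using assms by (simp add: abs_l2_diff[symmetric] norm_abs_l2 square_integrable_diff)

lemma nn_integral_norm_abs_l2:
  assumes "square_integrable f"
  shows "(\<integral>\<^sup>+x. ennreal ((norm (f x))\<^sup>2) \<partial>lborel) = ennreal ((norm (abs_l2 f))\<^sup>2)"
  using assms by (simp add: norm_abs_l2 nn_integral_eq_integral square_integrable_def)

text \<open>Links convergence in the quotient to the integrals in \<open>H10_gradient\<close>; the
  square is removed by continuity of the square root.\<close>

lemma tendsto_abs_l2_iff:
  assumes "\<And>n. square_integrable (f n)" "square_integrable g"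
  shows "(\<lambda>n. abs_l2 (f n)) \<longlonglongrightarrow> abs_l2 g \<longleftrightarrow> (\<lambda>n. \<integral>x. (norm (f n x - g x))\<^sup>2 \<partial>lborel) \<longlonglongrightarrow> 0"
proof -
  have "(\<lambda>n. abs_l2 (f n)) \<longlonglongrightarrow> abs_l2 g \<longleftrightarrow> (\<lambda>n. norm (abs_l2 (f n) - abs_l2 g)) \<longlonglongrightarrow> 0"
    using LIM_zero_iff tendsto_norm_zero_iff by metis
  also have "\<dots> \<longleftrightarrow> (\<lambda>n. (norm (abs_l2 (f n) - abs_l2 g))\<^sup>2) \<longlonglongrightarrow> 0"
    using tendsto_null_power[of "\<lambda>n. norm (abs_l2 (f n) - abs_l2 g)" sequentially 2]
      tendsto_real_sqrt[of "\<lambda>n. (norm (abs_l2 (f n) - abs_l2 g))\<^sup>2" 0 sequentially] by auto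
  also have "\<dots> \<longleftrightarrow> (\<lambda>n. \<integral>x. (norm (f n x - g x))\<^sup>2 \<partial>lborel) \<longlonglongrightarrow> 0"
    using assms by (simp add: norm_diff_abs_l2)
  finally show ?thesis .
qed

section \<open>Completeness of L^2\<close>

lemma Cauchy_subseq_fast:
  fixes X :: "nat \<Rightarrow> 'a::metric_space"
  assumes "Cauchy X"
  obtains r :: "nat \<Rightarrow> nat" where "strict_mono r" "\<And>n. dist (X (r (Suc n))) (X (r n)) < (1/2) ^ n"
proof -
  have "\<exists>M. \<forall>m\<ge>M. \<forall>n\<ge>M. dist (X m) (X n) < (1/2) ^ k" for k
    using metric_CauchyD[OF assms, of "(1/2) ^ k"] by simp
  then obtain M where M: "\<And>k m n. m \<ge> M k \<Longrightarrow> n \<ge> M k \<Longrightarrow> dist (X m) (X n) < (1/2) ^ k" by metis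
  \<comment> \<open>The sum dominates every \<open>M i\<close> with i \<le> k, and adding k makes
    the sequence strictly increasing.\<close>
  define r where "r k = (\<Sum>i\<le>k. M i) + k" for k
  have "M k \<le> r k" for k
    unfolding r_def using member_le_sum[of k "{..k}" M] by simp
  moreover have "r k < r (Suc k)" for k by (simp add: r_def)
  ultimately show thesis
    by (intro that[of r] M) (auto simp: strict_mono_Suc_iff intro: order_trans[OF _ less_imp_le])
qed

text \<open>The Riesz-Fischer argument: along a fast subsequence the increments are summable almost
  everywhere, the pointwise limit is the candidate, and Fatou's lemma bounds its distance from the
  sequence.\<close>

instance l2 :: (euclidean_space, euclidean_space) complete_space
proof
  fix X :: "nat \<Rightarrow> ('a, 'b) l2"
  assume X: "Cauchy X"
  obtain r :: "nat \<Rightarrow> nat" where r: "strict_mono r" "\<And>n. dist (X (r (Suc n))) (X (r n)) < (1/2) ^ n"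
    using Cauchy_subseq_fast[OF X] by blast
  define f where "f n = rep_l2 (X (r n))" for n
  have f: "square_integrable (f n)" and Xf: "X (r n) = abs_l2 (f n)" for n
    by (simp_all add: f_def square_integrable_rep abs_rep_l2)
  have [measurable]: "f n \<in> borel_measurable lborel" for n using f by (simp add: square_integrable_def)
  \<comment> \<open>The increments have L^2 norm below 2^-n, so their squares leave room for the
    weight 2^n; this weight turns summability of the squares into absolute summability of the
    increments.\<close>
  have "(\<integral>\<^sup>+x. (\<Sum>n. ennreal (2 ^ n * (norm (f (Suc n) x - f n x))\<^sup>2)) \<partial>lborel)
      = (\<Sum>n. \<integral>\<^sup>+x. ennreal (2 ^ n * (norm (f (Suc n) x - f n x))\<^sup>2) \<partial>lborel)"
    by (rule nn_integral_suminf) measurable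
  also have "\<dots> \<le> (\<Sum>n. ennreal ((1/2) ^ n))"
  proof (rule suminf_le[OF _ summableI summableI])
    fix n
    have "(\<integral>\<^sup>+x. ennreal (2 ^ n * (norm (f (Suc n) x - f n x))\<^sup>2) \<partial>lborel)
        = ennreal (2 ^ n) * (\<integral>\<^sup>+x. ennreal ((norm (f (Suc n) x - f n x))\<^sup>2) \<partial>lborel)"
      by (subst nn_integral_cmult[symmetric]) (auto simp: ennreal_mult)
    also have "\<dots> = ennreal (2 ^ n * (dist (X (r (Suc n))) (X (r n)))\<^sup>2)"
      by (simp add: nn_integral_norm_abs_l2 square_integrable_diff f Xf dist_norm abs_l2_diff ennreal_mult)
    also have "\<dots> \<le> ennreal (2 ^ n * ((1/2) ^ n)\<^sup>2)"
      using r(2)[of n] by (intro ennreal_leI mult_left_mono power_mono) auto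
    also have "2 ^ n * ((1/2) ^ n)\<^sup>2 = (1/2 :: real) ^ n"
      by (simp add: power2_eq_square power_mult_distrib[symmetric] mult.assoc[symmetric])
    finally show "(\<integral>\<^sup>+x. ennreal (2 ^ n * (norm (f (Suc n) x - f n x))\<^sup>2) \<partial>lborel) \<le> ennreal ((1/2) ^ n)" .
  qed
  also have "\<dots> < \<infinity>"
    by (simp add: suminf_ennreal2 summable_geometric less_top)
  finally have "AE x in lborel. (\<Sum>n. ennreal (2 ^ n * (norm (f (Suc n) x - f n x))\<^sup>2)) \<noteq> \<infinity>"
    by (intro nn_integral_noteq_infinite) auto
  then have conv: "AE x in lborel. convergent (\<lambda>n. f n x)"
  proof eventually_elim
    fix x assume "(\<Sum>n. ennreal (2 ^ n * (norm (f (Suc n) x - f n x))\<^sup>2)) \<noteq> \<infinity>"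
    then have "summable (\<lambda>n. 2 ^ n * (norm (f (Suc n) x - f n x))\<^sup>2)"
      by (intro summable_suminf_not_top) auto
    then have "summable (\<lambda>n. 2 ^ n * (norm (f (Suc n) x - f n x))\<^sup>2 + (1/2) ^ n)"
      by (intro summable_add summable_geometric) auto
    then have "summable (\<lambda>n. f (Suc n) x - f n x)"
    proof (rule summable_comparison_test'[of _ 0])
      fix n
      define d where "d = norm (f (Suc n) x - f n x)"
      \<comment> \<open>Expanded and divided by 2^n, this is the comparison 2 d \<le> 2^n d^2 +
        2^-n.\<close>
      have "0 \<le> (2 ^ n * d - 1)\<^sup>2" by simp
      then have "2 ^ n * (2 * d) \<le> 2 ^ n * (2 ^ n * d\<^sup>2 + (1/2) ^ n)"
        by (simp add: power2_eq_square algebra_simps power_one_over)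
      then have "2 * d \<le> 2 ^ n * d\<^sup>2 + (1/2) ^ n" by simp
      moreover have "d \<ge> 0" by (simp add: d_def)
      ultimately show "norm (f (Suc n) x - f n x) \<le> 2 ^ n * (norm (f (Suc n) x - f n x))\<^sup>2 + (1/2) ^ n"
        unfolding d_def by linarith
    qed
    then have "convergent (\<lambda>n. (\<Sum>i<n. f (Suc i) x - f i x))" by (simp add: summable_iff_convergent)
    then have "convergent (\<lambda>n. f n x - f 0 x)" by (simp only: sum_lessThan_telescope[of "\<lambda>i. f i x"])
    from convergent_add[OF this convergent_const[of "f 0 x"]]
    show "convergent (\<lambda>n. f n x)" by simp
  qed
  define F where "F x = lim (\<lambda>n. f n x)" for x
  have [measurable]: "F \<in> borel_measurable lborel" unfolding F_def by measurable
  have lim: "AE x in lborel. (\<lambda>n. f n x) \<longlonglongrightarrow> F x"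
    using conv by eventually_elim (simp add: F_def convergent_LIMSEQ_iff)
  \<comment> \<open>Fatou's lemma, with n fixed and m tending to infinity.\<close>
  have bound: "(\<integral>\<^sup>+x. ennreal ((norm (F x - f n x))\<^sup>2) \<partial>lborel) \<le> ennreal (e\<^sup>2)"
    if n: "\<And>m. m \<ge> n \<Longrightarrow> dist (X (r m)) (X (r n)) \<le> e" and e: "e \<ge> 0" for n e
  proof -
    have "(\<integral>\<^sup>+x. ennreal ((norm (F x - f n x))\<^sup>2) \<partial>lborel)
       = (\<integral>\<^sup>+x. liminf (\<lambda>m. ennreal ((norm (f m x - f n x))\<^sup>2)) \<partial>lborel)"
    proof (rule nn_integral_cong_AE)
      show "AE x in lborel. ennreal ((norm (F x - f n x))\<^sup>2) = liminf (\<lambda>m. ennreal ((norm (f m x - f n x))\<^sup>2))"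
        using lim
      proof eventually_elim
        fix x assume "(\<lambda>n. f n x) \<longlonglongrightarrow> F x"
        then have "(\<lambda>m. ennreal ((norm (f m x - f n x))\<^sup>2)) \<longlonglongrightarrow> ennreal ((norm (F x - f n x))\<^sup>2)"
          by (intro tendsto_intros)
        then show "ennreal ((norm (F x - f n x))\<^sup>2) = liminf (\<lambda>m. ennreal ((norm (f m x - f n x))\<^sup>2))"
          by (rule lim_imp_Liminf[OF sequentially_bot, symmetric])
      qed
    qed
    also have "\<dots> \<le> liminf (\<lambda>m. \<integral>\<^sup>+x. ennreal ((norm (f m x - f n x))\<^sup>2) \<partial>lborel)"
      by (rule nn_integral_liminf) measurable
    also have "\<dots> \<le> ennreal (e\<^sup>2)"
    proof (rule Liminf_le)
      have "(\<integral>\<^sup>+x. ennreal ((norm (f m x - f n x))\<^sup>2) \<partial>lborel) \<le> ennreal (e\<^sup>2)" if "m \<ge> n" for m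
        using n[OF that] e
        by (simp add: nn_integral_norm_abs_l2 square_integrable_diff f Xf dist_norm abs_l2_diff power_mono)
      then show "\<forall>\<^sub>F m in sequentially. (\<integral>\<^sup>+x. ennreal ((norm (f m x - f n x))\<^sup>2) \<partial>lborel) \<le> ennreal (e\<^sup>2)"
        using eventually_sequentially by blast
    qed simp
    finally show ?thesis .
  qed
  have Xr: "Cauchy (X \<circ> r)" using Cauchy_subseq_Cauchy[OF X r(1)] .
  have ev: "\<exists>N. \<forall>n\<ge>N. (\<integral>\<^sup>+x. ennreal ((norm (F x - f n x))\<^sup>2) \<partial>lborel) \<le> ennreal (e\<^sup>2)" if e: "e > 0" for e
  proof -
    obtain N where N: "\<And>m n. m \<ge> N \<Longrightarrow> n \<ge> N \<Longrightarrow> dist (X (r m)) (X (r n)) < e"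
      using metric_CauchyD[OF Xr e] by auto
    show ?thesis
      by (rule exI[of _ N]) (use N e in \<open>auto intro!: bound intro: less_imp_le\<close>)
  qed
  obtain N where "(\<integral>\<^sup>+x. ennreal ((norm (F x - f N x))\<^sup>2) \<partial>lborel) \<le> ennreal (1\<^sup>2)"
    using ev[of 1] by auto
  then have "(\<integral>\<^sup>+x. ennreal (norm ((norm (F x - f N x))\<^sup>2)) \<partial>lborel) < \<infinity>"
    by (simp add: le_less_trans[of _ 1])
  then have "square_integrable (\<lambda>x. F x - f N x)"
    unfolding square_integrable_def by (intro conjI integrableI_bounded) measurable
  from square_integrable_add[OF this f[of N]] have F: "square_integrable F" by simp
  have "(\<lambda>n. X (r n)) \<longlonglongrightarrow> abs_l2 F"
  proof (rule metric_LIMSEQ_I)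
    fix e :: real assume "e > 0"
    then obtain N where N: "\<And>n. n \<ge> N \<Longrightarrow> (\<integral>\<^sup>+x. ennreal ((norm (F x - f n x))\<^sup>2) \<partial>lborel) \<le> ennreal ((e/2)\<^sup>2)"
      using ev[of "e/2"] by auto
    have "dist (X (r n)) (abs_l2 F) < e" if "n \<ge> N" for n
    proof -
      have "(norm (abs_l2 F - X (r n)))\<^sup>2 \<le> (e/2)\<^sup>2"
        using N[OF that] by (simp add: nn_integral_norm_abs_l2 square_integrable_diff f Xf abs_l2_diff F)
      then have "norm (abs_l2 F - X (r n)) \<le> e/2"
        using \<open>e > 0\<close> by (simp add: power2_le_iff_abs_le)
      then show ?thesis using \<open>e > 0\<close> by (simp add: dist_norm norm_minus_commute)
    qed
    then show "\<exists>N. \<forall>n\<ge>N. dist (X (r n)) (abs_l2 F) < e" by blast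
  qed
  then show "convergent X"
    using Cauchy_converges_subseq[OF X r(1)] by (auto simp: convergent_def o_def)
qed

section \<open>Eigenvalues of compact forms\<close>


text \<open>Gaussian elimination, by induction on the equations: a nonzero coefficient serves as
  pivot, its unknown is eliminated, and back substitution recovers it. The dimension counts behind
  the min-max principle and behind the multiplicities both reduce to this.\<close>

lemma underdetermined_system:
  fixes A :: "'j \<Rightarrow> 'i \<Rightarrow> real"
  assumes "finite J" "finite I" "card J < card I"
  shows "\<exists>c. (\<exists>i\<in>I. c i \<noteq> 0) \<and> (\<forall>j\<in>J. (\<Sum>i\<in>I. c i * A j i) = 0)"
  using assms
proof (induction J arbitrary: I A rule: finite_induct)
  case empty
  then have "I \<noteq> {}" by auto
  then show ?case by (intro exI[of _ "\<lambda>_. 1"]) auto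
next
  case (insert m J)
  show ?case
  proof (cases "\<exists>p\<in>I. A m p \<noteq> 0")
    case False
    have "card J < card I" using insert by simp
    from insert.IH[OF insert.prems(1) this, of A] False show ?thesis by auto
  next
    case True
    then obtain p where p: "p \<in> I" "A m p \<noteq> 0" by blast
    define I' where "I' = I - {p}"
    have I': "finite I'" "card J < card I'" "p \<notin> I'" "I = insert p I'"
      using insert p by (auto simp: I'_def card_Diff_singleton)
    \<comment> \<open>The coefficients left after the unknown p has been eliminated by means of
      equation m.\<close>
    define B where "B j i = A j i - A j p * A m i / A m p" for j i
    obtain c where c: "\<exists>i\<in>I'. c i \<noteq> 0" "\<forall>j\<in>J. (\<Sum>i\<in>I'. c i * B j i) = 0"
      using insert.IH[OF I'(1,2), of B] by blast
    define s where "s = (\<Sum>i\<in>I'. c i * A m i)"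
    define c' where "c' = c(p := - s / A m p)"
    have sum: "(\<Sum>i\<in>I. c' i * A j i) = - s / A m p * A j p + (\<Sum>i\<in>I'. c i * A j i)" for j
    proof -
      have "(\<Sum>i\<in>I'. c' i * A j i) = (\<Sum>i\<in>I'. c i * A j i)"
        by (rule sum.cong) (use I'(3) in \<open>auto simp: c'_def\<close>)
      then show ?thesis using I' by (simp add: c'_def)
    qed
    have "(\<Sum>i\<in>I. c' i * A j i) = 0" if "j \<in> insert m J" for j
    proof (cases "j = m")
      case True
      then show ?thesis using p by (simp add: sum s_def)
    next
      case False
      have "(\<Sum>i\<in>I'. c i * B j i) = (\<Sum>i\<in>I'. c i * A j i) - s * (A j p / A m p)"
        unfolding B_def s_def sum_distrib_right sum_subtractf[symmetric]
        by (rule sum.cong) (auto simp: algebra_simps)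
      then show ?thesis using False that c(2) by (simp add: sum)
    qed
    moreover have "\<exists>i\<in>I. c' i \<noteq> 0" using c(1) I' by (auto simp: c'_def)
    ultimately show ?thesis by blast
  qed
qed

text \<open>The first-order condition at a minimum: for small s of suitable sign a nonzero linear
  term would outweigh the quadratic one.\<close>

lemma quadratic_nonneg_imp_zero:
  fixes a b :: real
  assumes "\<And>s. 0 \<le> s\<^sup>2 * a + 2 * s * b"
  shows "b = 0"
proof (rule ccontr)
  assume b: "b \<noteq> 0"
  have a: "a \<ge> 0" using assms[of 1] assms[of "-1"] by simp
  \<comment> \<open>With \<open>a + 1\<close> the denominator is nonzero even for a = 0.\<close>
  define s where "s = - b / (a + 1)"
  have "b = - s * (a + 1)" using a by (simp add: s_def)
  then have "s\<^sup>2 * a + 2 * s * b = s\<^sup>2 * a + 2 * s * (- s * (a + 1))" by simp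
  also have "\<dots> = - (s\<^sup>2 * (a + 2))" by (simp add: power2_eq_square algebra_simps)
  finally have "s\<^sup>2 * a + 2 * s * b = - (s\<^sup>2 * (a + 2))" .
  moreover have "s \<noteq> 0" using a b by (simp add: s_def)
  then have "s\<^sup>2 * (a + 2) > 0" using a by simp
  ultimately show False using assms[of s] by simp
qed

lemma norm_add_scaleR_sq:
  fixes a b :: "'a::real_inner"
  shows "(norm (a + s *\<^sub>R b))\<^sup>2 = (norm a)\<^sup>2 + 2 * s * (a \<bullet> b) + s\<^sup>2 * (norm b)\<^sup>2"
  unfolding dot_square_norm[symmetric]
  by (simp add: inner_add_left inner_add_right inner_commute[of b a] power2_eq_square algebra_simps)

text \<open>An element of \<open>V\<close> stands for a function paired with its weak gradient.\<close>

locale compact_form =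
  fixes V :: "('e::{real_inner, complete_space} \<times> 'f::{real_inner, complete_space}) set"
  assumes subspace_V: "subspace V" and closed_V: "closed V"
    and compact_fst: "\<And>x. (\<And>n. x n \<in> V) \<Longrightarrow> bounded (range x) \<Longrightarrow>
          \<exists>r :: nat \<Rightarrow> nat. strict_mono r \<and> Cauchy (\<lambda>n. fst (x (r n)))"
    and infinite_dim: "\<And>m. \<exists>x. (\<forall>i<m. x i \<in> V) \<and>
          (\<forall>c. (\<Sum>i<m. c i *\<^sub>R fst (x i)) = 0 \<longrightarrow> (\<forall>i<m::nat. c i = 0))"
begin

text \<open>The direct method without weak limits. Compactness controls only the first components;
  the parallelogram law makes the second components of a minimising sequence Cauchy as well, so a
  limit exists and stays in the closed set \<open>W\<close>.\<close>

lemma exists_minimiser: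
  assumes W: "subspace W" "closed W" "W \<subseteq> V" and ne: "\<exists>x\<in>W. fst x \<noteq> 0"
  shows "\<exists>x\<in>W. norm (fst x) = 1 \<and> (\<forall>y\<in>W. (norm (snd x))\<^sup>2 * (norm (fst y))\<^sup>2 \<le> (norm (snd y))\<^sup>2)"
proof -
  define S where "S = (\<lambda>y. (norm (snd y))\<^sup>2) ` {y\<in>W. norm (fst y) = 1}"
  define \<mu> where "\<mu> = Inf S"
  have norm_in: "(1 / norm (fst y)) *\<^sub>R y \<in> {y\<in>W. norm (fst y) = 1}" if "y \<in> W" "fst y \<noteq> 0" for y
    using that W(1) by (simp add: subspace_scale)
  have S: "S \<noteq> {}" "bdd_below S"
    using ne norm_in unfolding S_def by (blast, auto intro!: bdd_belowI[of _ 0])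
  have low: "\<mu> * (norm (fst y))\<^sup>2 \<le> (norm (snd y))\<^sup>2" if "y \<in> W" for y
  proof (cases "fst y = 0")
    case False
    have "\<mu> \<le> (norm (snd ((1 / norm (fst y)) *\<^sub>R y)))\<^sup>2"
      unfolding \<mu>_def by (rule cInf_lower[OF _ S(2)]) (use norm_in[OF that False] in \<open>unfold S_def, blast\<close>)
    also have "\<dots> = (norm (snd y))\<^sup>2 / (norm (fst y))\<^sup>2" by (simp add: power_divide)
    finally show ?thesis using False by (simp add: field_simps)
  qed simp
  have \<mu>0: "\<mu> \<ge> 0" unfolding \<mu>_def by (rule cInf_greatest[OF S(1)]) (auto simp: S_def)
  have "\<exists>x\<in>W. norm (fst x) = 1 \<and> (norm (snd x))\<^sup>2 < \<mu> + inverse (Suc n)" for n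
  proof -
    have "Inf S < \<mu> + inverse (Suc n)" by (simp add: \<mu>_def)
    from cInf_lessD[OF S(1) this] show ?thesis by (auto simp: S_def Bex_def)
  qed
  then obtain x where x: "\<And>n. x n \<in> W" "\<And>n. norm (fst (x n)) = 1"
    "\<And>n. (norm (snd (x n)))\<^sup>2 < \<mu> + inverse (Suc n)" by metis
  have "norm (x n) \<le> 1 + sqrt (\<mu> + 1)" for n
  proof -
    have "(norm (snd (x n)))\<^sup>2 \<le> \<mu> + 1"
      using x(3)[of n] by (smt (verit) inverse_le_1_iff of_nat_1 of_nat_mono le_add1 plus_1_eq_Suc)
    then have "norm (snd (x n)) \<le> sqrt (\<mu> + 1)" by (rule real_le_rsqrt)
    then show ?thesis using norm_Pair_le[of "fst (x n)" "snd (x n)"] x(2)[of n] by simp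
  qed
  then have "bounded (range x)" unfolding bounded_iff by blast
  then obtain r :: "nat \<Rightarrow> nat" where r: "strict_mono r" "Cauchy (\<lambda>n. fst (x (r n)))"
    using compact_fst[of x] x(1) W(3) by blast
  \<comment> \<open>Sums of two terms lie in \<open>W\<close>, so their quotient is at least \<mu>,
    while the quotient of each term exceeds \<mu> by less than its error; the parallelogram law
    converts this into closeness of the second components.\<close>
  have para: "(norm (snd (x n) - snd (x m)))\<^sup>2 \<le> \<mu> * (norm (fst (x n) - fst (x m)))\<^sup>2
      + 2 * inverse (Suc n) + 2 * inverse (Suc m)" for n m
  proof -
    have "\<mu> * (norm (fst (x n + x m)))\<^sup>2 \<le> (norm (snd (x n + x m)))\<^sup>2"
      by (rule low, rule subspace_add[OF W(1)]) (rule x)+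
    then have 1: "\<mu> * (norm (fst (x n) + fst (x m)))\<^sup>2 \<le> (norm (snd (x n) + snd (x m)))\<^sup>2" by simp
    have pl: "(norm (a - b))\<^sup>2 = 2 * (norm a)\<^sup>2 + 2 * (norm b)\<^sup>2 - (norm (a + b))\<^sup>2" for a b :: "'c::real_inner"
      by (simp add: power2_norm_eq_inner algebra_simps)
    have 2: "\<mu> * (norm (fst (x n) - fst (x m)))\<^sup>2 = 4 * \<mu> - \<mu> * (norm (fst (x n) + fst (x m)))\<^sup>2"
      by (simp add: pl[of "fst (x n)"] x(2) right_diff_distrib)
    show ?thesis using 1 2 x(3)[of n] x(3)[of m] pl[of "snd (x n)" "snd (x m)"] by linarith
  qed
  have "Cauchy (\<lambda>n. snd (x (r n)))"
  proof (rule metric_CauchyI)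
    fix e :: real assume e: "e > 0"
    \<comment> \<open>The two errors, each below e^2 / 8 and counted twice, use up half of e^2;
      \<open>d\<close> is chosen so that the first components take the other half. The 1 added to
      \<mu> covers \<mu> = 0.\<close>
    define d where "d = sqrt (e\<^sup>2 / (2 * (\<mu> + 1)))"
    have d: "d > 0" "(\<mu> + 1) * d\<^sup>2 = e\<^sup>2 / 2" using e \<mu>0 by (auto simp: d_def field_simps)
    obtain N1 where N1: "\<And>m n. m \<ge> N1 \<Longrightarrow> n \<ge> N1 \<Longrightarrow> dist (fst (x (r m))) (fst (x (r n))) < d"
      using metric_CauchyD[OF r(2) d(1)] by blast
    obtain N2 where N2: "inverse (real (Suc N2)) < e\<^sup>2 / 8"
      using reals_Archimedean[of "e\<^sup>2 / 8"] e by auto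
    have small: "inverse (real (Suc (r n))) < e\<^sup>2 / 8" if "n \<ge> N2" for n
    proof -
      have "n \<le> r n" using r(1) by (rule seq_suble)
      then have "inverse (real (Suc (r n))) \<le> inverse (real (Suc N2))"
        using that by (intro le_imp_inverse_le) auto
      then show ?thesis using N2 by linarith
    qed
    have "dist (snd (x (r m))) (snd (x (r n))) < e" if mn: "m \<ge> max N1 N2" "n \<ge> max N1 N2" for m n
    proof -
      have "(dist (fst (x (r m))) (fst (x (r n))))\<^sup>2 \<le> d\<^sup>2"
        using N1[of m n] mn by (intro power_mono) auto
      then have "\<mu> * (norm (fst (x (r m)) - fst (x (r n))))\<^sup>2 \<le> (\<mu> + 1) * d\<^sup>2"
        using \<mu>0 by (intro mult_mono) (auto simp: dist_norm)
      then have "(norm (snd (x (r m)) - snd (x (r n))))\<^sup>2 < e\<^sup>2"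
        using para[of "r m" "r n"] small[of m] small[of n] mn d(2) by simp
      then show ?thesis using e by (simp add: dist_norm power2_less_imp_less)
    qed
    then show "\<exists>M. \<forall>m\<ge>M. \<forall>n\<ge>M. dist (snd (x (r m))) (snd (x (r n))) < e" by blast
  qed
  then obtain u g where lim: "(\<lambda>n. fst (x (r n))) \<longlonglongrightarrow> u" "(\<lambda>n. snd (x (r n))) \<longlonglongrightarrow> g"
    using r(2) Cauchy_convergent_iff convergent_def by metis
  have "(\<lambda>n. (fst (x (r n)), snd (x (r n)))) \<longlonglongrightarrow> (u, g)" by (intro tendsto_Pair lim)
  then have "(\<lambda>n. x (r n)) \<longlonglongrightarrow> (u, g)" by simp
  then have "(u, g) \<in> W" using closed_sequentially[OF W(2)] x(1) by metis
  moreover have "norm u = 1"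
    using tendsto_norm[OF lim(1)] x(2) LIMSEQ_unique[OF tendsto_const] by fastforce
  moreover have "(norm g)\<^sup>2 \<le> \<mu>"
  proof (rule LIMSEQ_le)
    show "(\<lambda>n. (norm (snd (x (r n))))\<^sup>2) \<longlonglongrightarrow> (norm g)\<^sup>2" by (intro tendsto_intros lim)
    have "(\<lambda>n. \<mu> + inverse (real (Suc (r n)))) \<longlonglongrightarrow> \<mu> + 0"
      using LIMSEQ_subseq_LIMSEQ[OF LIMSEQ_inverse_real_of_nat r(1)]
      by (intro tendsto_intros) (simp add: o_def)
    then show "(\<lambda>n. \<mu> + inverse (real (Suc (r n)))) \<longlonglongrightarrow> \<mu>" by simp
    show "\<exists>N. \<forall>n\<ge>N. (norm (snd (x (r n))))\<^sup>2 \<le> \<mu> + inverse (real (Suc (r n)))"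
      using x(3) less_imp_le by blast
  qed
  then have "(norm g)\<^sup>2 * (norm (fst y))\<^sup>2 \<le> (norm (snd y))\<^sup>2" if "y \<in> W" for y
    using low[OF that] mult_right_mono[of "(norm g)\<^sup>2" \<mu> "(norm (fst y))\<^sup>2"] by simp
  ultimately show ?thesis by (intro bexI[of _ "(u, g)"]) auto
qed

text \<open>Orthogonality is in the first component, that is in L^2, and only the vectors
  \<open>e j\<close> with j < k enter; the latter is what allows the vectors to be chosen
  recursively.\<close>

definition orth_complement :: "(nat \<Rightarrow> 'e \<times> 'f) \<Rightarrow> nat \<Rightarrow> ('e \<times> 'f) set" where
  "orth_complement e k = {x\<in>V. \<forall>j<k. fst x \<bullet> fst (e j) = 0}"

lemma subspace_orth_complement: "subspace (orth_complement e k)"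
  using subspace_V by (auto simp: subspace_def orth_complement_def inner_add_left)

lemma closed_orth_complement: "closed (orth_complement e k)"
proof -
  have "orth_complement e k = V \<inter> (\<Inter>j\<in>{..<k}. {x. fst x \<bullet> fst (e j) = 0})"
    by (auto simp: orth_complement_def)
  moreover have "closed {x. fst x \<bullet> fst (e j) = 0}" for j
    by (intro closed_Collect_eq continuous_intros)
  ultimately show ?thesis using closed_V by (auto intro!: closed_Int closed_INT)
qed

text \<open>There are k + 1 coefficients and only k orthogonality conditions.\<close>

lemma exists_orthogonal_combination:
  assumes "\<And>i. i \<le> k \<Longrightarrow> x i \<in> V"
  shows "\<exists>c. (\<exists>i\<le>k. c i \<noteq> 0) \<and> (\<Sum>i\<le>k. c i *\<^sub>R x i) \<in> orth_complement e k"
proof -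
  obtain c where c: "\<exists>i\<in>{..k}. c i \<noteq> 0" "\<forall>j\<in>{..<k}. (\<Sum>i\<le>k. c i * (fst (x i) \<bullet> fst (e j))) = 0"
    using underdetermined_system[of "{..<k}" "{..k}" "\<lambda>j i. fst (x i) \<bullet> fst (e j)"] by auto
  have "(\<Sum>i\<le>k. c i *\<^sub>R x i) \<in> V"
    by (intro subspace_sum[OF subspace_V] subspace_scale[OF subspace_V] assms) simp
  with c show ?thesis
    by (intro exI[of _ c]) (auto simp: orth_complement_def fst_sum inner_sum_left)
qed

text \<open>Recursion over all earlier values: the set on which \<open>e k\<close> minimises depends
  only on the vectors with smaller index. By \<open>infinite_dim\<close> and
  \<open>exists_orthogonal_combination\<close> it contains an element with nonzero first
  component.\<close>

lemma exists_minimisers: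
  "\<exists>e. \<forall>k. e k \<in> orth_complement e k \<and> norm (fst (e k)) = 1 \<and>
     (\<forall>y\<in>orth_complement e k. (norm (snd (e k)))\<^sup>2 * (norm (fst y))\<^sup>2 \<le> (norm (snd y))\<^sup>2)"
proof (rule dependent_wellorder_choice)
  fix r and f g :: "nat \<Rightarrow> 'e \<times> 'f" and k :: nat
  assume "\<And>y. y < k \<Longrightarrow> f y = g y"
  then have "orth_complement f k = orth_complement g k" by (auto simp: orth_complement_def)
  then show "(r \<in> orth_complement f k \<and> norm (fst r) = 1 \<and>
     (\<forall>y\<in>orth_complement f k. (norm (snd r))\<^sup>2 * (norm (fst y))\<^sup>2 \<le> (norm (snd y))\<^sup>2)) =
    (r \<in> orth_complement g k \<and> norm (fst r) = 1 \<and>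
     (\<forall>y\<in>orth_complement g k. (norm (snd r))\<^sup>2 * (norm (fst y))\<^sup>2 \<le> (norm (snd y))\<^sup>2))" by simp
next
  fix k :: nat and f :: "nat \<Rightarrow> 'e \<times> 'f"
  obtain x where x: "\<And>i. i < Suc k \<Longrightarrow> x i \<in> V"
    "\<And>c i. (\<Sum>i<Suc k. c i *\<^sub>R fst (x i)) = 0 \<Longrightarrow> i < Suc k \<Longrightarrow> c i = 0"
    using infinite_dim[of "Suc k"] by blast
  obtain c where c: "\<exists>i\<le>k. c i \<noteq> 0" "(\<Sum>i\<le>k. c i *\<^sub>R x i) \<in> orth_complement f k"
    using exists_orthogonal_combination[of k x f] x(1) by auto
  have "fst (\<Sum>i\<le>k. c i *\<^sub>R x i) \<noteq> 0"
    using x(2)[of c] c(1) by (auto simp: fst_sum lessThan_Suc_atMost less_Suc_eq_le)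
  with c(2) have "\<exists>x\<in>orth_complement f k. fst x \<noteq> 0" by blast
  from exists_minimiser[OF subspace_orth_complement closed_orth_complement _ this]
  show "\<exists>r. r \<in> orth_complement f k \<and> norm (fst r) = 1 \<and>
     (\<forall>y\<in>orth_complement f k. (norm (snd r))\<^sup>2 * (norm (fst y))\<^sup>2 \<le> (norm (snd y))\<^sup>2)"
    by (auto simp: orth_complement_def Bex_def)
qed

definition eigenspace :: "real \<Rightarrow> 'e set" where
  "eigenspace t = {u. \<exists>g. (u, g) \<in> V \<and> (\<forall>y\<in>V. g \<bullet> snd y = t * (u \<bullet> fst y))}"

text \<open>Completeness is not part of the definition: the divergence of \<open>l\<close> together
  with the lower bounds on the complements supplies what is needed of it, in
  \<open>eigenspace_expansion\<close>. Numbering starts at 0.\<close>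

definition eigenbasis :: "(nat \<Rightarrow> 'e \<times> 'f) \<Rightarrow> (nat \<Rightarrow> real) \<Rightarrow> bool" where
  "eigenbasis e l \<longleftrightarrow> mono l \<and> filterlim l at_top sequentially \<and> (\<forall>k. e k \<in> V) \<and>
     (\<forall>i j. fst (e i) \<bullet> fst (e j) = (if i = j then 1 else 0)) \<and>
     (\<forall>k. \<forall>y\<in>V. snd (e k) \<bullet> snd y = l k * (fst (e k) \<bullet> fst y)) \<and>
     (\<forall>k. \<forall>y\<in>orth_complement e k. l k * (norm (fst y))\<^sup>2 \<le> (norm (snd y))\<^sup>2)"

lemma exists_eigenbasis: "\<exists>e l. eigenbasis e l"
proof -
  obtain e where e: "\<And>k. e k \<in> orth_complement e k" "\<And>k. norm (fst (e k)) = 1"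
     "\<And>k y. y \<in> orth_complement e k \<Longrightarrow> (norm (snd (e k)))\<^sup>2 * (norm (fst y))\<^sup>2 \<le> (norm (snd y))\<^sup>2"
    using exists_minimisers by blast
  define l where "l k = (norm (snd (e k)))\<^sup>2" for k
  have eV: "e k \<in> V" for k using e(1)[of k] by (simp add: orth_complement_def)
  have "orth_complement e n \<subseteq> orth_complement e m" if "m \<le> n" for m n
    using that by (auto simp: orth_complement_def)
  then have "l m \<le> l n" if "m \<le> n" for m n
    using e(3)[of "e n" m] e(1)[of n] e(2)[of n] that by (auto simp: l_def)
  then have mono: "mono l" by (rule monoI)
  have orth: "fst (e i) \<bullet> fst (e j) = (if i = j then 1 else 0)" for i j
    using e(1)[of i] e(1)[of j] e(2)[of i]
    by (cases i j rule: linorder_cases) (auto simp: orth_complement_def inner_commute norm_eq_1)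
  \<comment> \<open>The Euler-Lagrange equation, at this stage only for variations inside the
    complement on which \<open>e k\<close> is minimal.\<close>
  have EL: "snd (e k) \<bullet> snd y = l k * (fst (e k) \<bullet> fst y)" if y: "y \<in> orth_complement e k" for k y
  proof -
    let ?q = "\<lambda>y. (norm (snd y))\<^sup>2 - l k * (norm (fst y))\<^sup>2"
    have "0 \<le> s\<^sup>2 * ?q y + 2 * s * (snd (e k) \<bullet> snd y - l k * (fst (e k) \<bullet> fst y))" for s
    proof -
      have "e k + s *\<^sub>R y \<in> orth_complement e k"
        by (intro subspace_add subspace_scale subspace_orth_complement e(1) y)
      from e(3)[OF this] have "0 \<le> ?q (e k + s *\<^sub>R y)" by (simp add: l_def)
      also have "?q (e k + s *\<^sub>R y) = ?q (e k) + (s\<^sup>2 * ?q y + 2 * s * (snd (e k) \<bullet> snd y - l k * (fst (e k) \<bullet> fst y)))"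
        by (simp add: norm_add_scaleR_sq algebra_simps)
      also have "?q (e k) = 0" by (simp add: e(2) l_def)
      finally show ?thesis by simp
    qed
    from quadratic_nonneg_imp_zero[OF this] show ?thesis by simp
  qed
  have "snd (e k) \<bullet> snd y = l k * (fst (e k) \<bullet> fst y)" if y: "y \<in> V" for k y
  proof -
    \<comment> \<open>Subtracting the L^2 projection on the earlier vectors moves y into the
      complement; both forms vanish between \<open>e k\<close> and the subtracted part, since
      \<open>e k\<close> belongs to every earlier complement.\<close>
    define p where "p = (\<Sum>j<k. (fst y \<bullet> fst (e j)) *\<^sub>R e j)"
    have "p \<in> V" unfolding p_def
      by (intro subspace_sum[OF subspace_V] subspace_scale[OF subspace_V] eV)
    moreover have "fst p \<bullet> fst (e j) = fst y \<bullet> fst (e j)" if "j < k" for j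
      using that by (simp add: p_def fst_sum inner_sum_left orth if_distrib[of "\<lambda>t. _ * t"] cong: if_cong)
    ultimately have "y - p \<in> orth_complement e k"
      using y subspace_diff[OF subspace_V] by (auto simp: orth_complement_def inner_diff_left)
    note 1 = EL[OF this]
    have 2: "snd (e k) \<bullet> snd (e j) = 0 \<and> fst (e k) \<bullet> fst (e j) = 0" if "j < k" for j
    proof -
      have "e k \<in> orth_complement e j"
        using e(1)[of k] that by (auto simp: orth_complement_def)
      from EL[OF this] show ?thesis using that by (simp add: orth inner_commute)
    qed
    have "snd (e k) \<bullet> snd p = 0" "fst (e k) \<bullet> fst p = 0"
      using 2 by (simp_all add: p_def snd_sum fst_sum inner_sum_right)
    with 1 show ?thesis by (simp add: inner_diff_right)
  qed
  \<comment> \<open>Bounded eigenvalues would make \<open>e\<close> a bounded sequence in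
    \<open>V\<close>, so two of the first components would be closer than 1, whereas distinct
    orthonormal vectors have squared distance 2.\<close>
  moreover have "filterlim l at_top sequentially"
  proof (rule ccontr)
    assume "\<not> filterlim l at_top sequentially"
    then obtain M where M: "\<And>N. \<exists>n\<ge>N. l n < M"
      unfolding filterlim_at_top eventually_sequentially by (metis linorder_not_less)
    then have lM: "l n \<le> M" for n
      using M[of n] monoD[OF mono] by (meson less_imp_le order_trans)
    have "norm (e n) \<le> 1 + sqrt M" for n
    proof -
      have "norm (snd (e n)) \<le> sqrt M" using lM[of n] by (intro real_le_rsqrt) (simp add: l_def)
      then show ?thesis using norm_Pair_le[of "fst (e n)" "snd (e n)"] e(2)[of n] by simp
    qed
    then have "bounded (range e)" unfolding bounded_iff by blast
    then obtain r :: "nat \<Rightarrow> nat" where r: "strict_mono r" "Cauchy (\<lambda>n. fst (e (r n)))"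
      using compact_fst[of e] eV by blast
    obtain N where "\<And>m n. m \<ge> N \<Longrightarrow> n \<ge> N \<Longrightarrow> dist (fst (e (r m))) (fst (e (r n))) < 1"
      using metric_CauchyD[OF r(2), of 1] by auto
    then have "dist (fst (e (r N))) (fst (e (r (Suc N)))) < 1" by simp
    then have "(norm (fst (e (r N)) - fst (e (r (Suc N)))))\<^sup>2 < 1"
      by (simp add: dist_norm power_less_one_iff)
    moreover have "r N \<noteq> r (Suc N)" using r(1) by (metis strict_mono_eq n_not_Suc_n)
    ultimately show False
      by (simp add: power2_norm_eq_inner inner_diff_left inner_diff_right orth)
  qed
  ultimately have "eigenbasis e l"
    unfolding eigenbasis_def using mono eV orth e(3) by (auto simp: l_def)
  then show ?thesis by blast
qed

section \<open>Multiplicities and the min-max principle for an eigenbasis\<close>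

context
  fixes e l assumes basis: "eigenbasis e l"
begin

lemma basis_orth: "fst (e i) \<bullet> fst (e j) = (if i = j then 1 else 0)"
  using basis by (simp add: eigenbasis_def)

lemma basis_in: "e k \<in> V"
  using basis by (simp add: eigenbasis_def)

lemma basis_eigen: "y \<in> V \<Longrightarrow> snd (e k) \<bullet> snd y = l k * (fst (e k) \<bullet> fst y)"
  using basis by (simp add: eigenbasis_def)

lemma finite_eigenvalue: "finite {k. l k = t}"
proof -
  have "eventually (\<lambda>k. l k > t) sequentially"
    using basis by (auto simp: eigenbasis_def filterlim_at_top_dense)
  then obtain N where "\<And>k. k \<ge> N \<Longrightarrow> l k > t" unfolding eventually_sequentially by blast
  then have "{k. l k = t} \<subseteq> {..<N}" by (metis (mono_tags) less_irrefl linorder_not_less lessThan_iff mem_Collect_eq subsetI)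
  then show ?thesis by (rule finite_subset) simp
qed

text \<open>After subtraction of the projection on the vectors with eigenvalue t, the remainder z is
  orthogonal to every \<open>e j\<close>: for \<open>l j = t\<close> by construction, for the others
  by symmetry of the form. All the lower bounds \<open>l k\<close> then apply to z, and their
  divergence forces its first component to vanish.\<close>

lemma eigenspace_expansion:
  assumes "u \<in> eigenspace t"
  shows "u = (\<Sum>k\<in>{k. l k = t}. (u \<bullet> fst (e k)) *\<^sub>R fst (e k))"
proof -
  obtain g where g: "(u, g) \<in> V" "\<And>y. y \<in> V \<Longrightarrow> g \<bullet> snd y = t * (u \<bullet> fst y)"
    using assms by (auto simp: eigenspace_def)
  define p where "p = (\<Sum>k\<in>{k. l k = t}. (u \<bullet> fst (e k)) *\<^sub>R e k)"
  define z where "z = (u, g) - p"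
  have pV: "p \<in> V" unfolding p_def
    by (intro subspace_sum[OF subspace_V] subspace_scale[OF subspace_V] basis_in)
  have zV: "z \<in> V" unfolding z_def by (intro subspace_diff[OF subspace_V] g pV)
  have "fst z \<bullet> fst (e j) = 0" for j
  proof (cases "l j = t")
    case True
    then show ?thesis using finite_eigenvalue[of t]
      by (simp add: z_def p_def fst_sum inner_sum_left inner_diff_left basis_orth if_distrib[of "\<lambda>t. _ * t"] cong: if_cong)
  next
    case False
    have "l j * (fst (e j) \<bullet> u) = snd (e j) \<bullet> g"
      using basis_eigen[OF g(1), of j] by simp
    also have "\<dots> = t * (u \<bullet> fst (e j))"
      using g(2)[OF basis_in, of j] by (simp only: inner_commute[of g])
    finally have "(l j - t) * (u \<bullet> fst (e j)) = 0" by (simp add: inner_commute left_diff_distrib)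
    then have "u \<bullet> fst (e j) = 0" using False by simp
    then show ?thesis using False
      by (auto simp: z_def p_def fst_sum inner_sum_left inner_diff_left basis_orth intro!: sum.neutral)
  qed
  then have "l k * (norm (fst z))\<^sup>2 \<le> (norm (snd z))\<^sup>2" for k
    using basis zV by (auto simp: eigenbasis_def orth_complement_def)
  moreover have "\<exists>k. l k > (norm (snd z))\<^sup>2 / (norm (fst z))\<^sup>2"
    using basis unfolding eigenbasis_def filterlim_at_top_dense eventually_sequentially by blast
  ultimately have "fst z = 0"
    by (metis divide_less_eq linorder_not_less norm_eq_zero zero_less_norm_iff zero_less_power)
  then show ?thesis by (simp add: z_def p_def fst_sum)
qed

lemma basis_in_eigenspace: "fst (e k) \<in> eigenspace (l k)"
  unfolding eigenspace_def using basis_in[of k] basis_eigen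
  by (auto intro!: exI[of _ "snd (e k)"])

text \<open>A family larger than the number of indices with \<open>l k = t\<close> has, by
  elimination, a nontrivial combination whose coordinates in \<open>eigenspace_expansion\<close> are
  all zero, so it is dependent; the vectors of the basis attain the number.\<close>

lemma multiplicity_eq:
  "(SUP m \<in> {m. \<exists>f. (\<forall>i<m. f i \<in> eigenspace t) \<and> (\<forall>c. (\<Sum>i<m. c i *\<^sub>R f i) = 0 \<longrightarrow> (\<forall>i<m. c i = 0))}. enat m)
    = enat (card {k. l k = t})" (is "Sup (enat ` ?M) = _")
proof (rule antisym)
  let ?K = "{k. l k = t}"
  have "m \<le> card ?K" if m: "m \<in> ?M" for m
  proof (rule ccontr)
    assume "\<not> m \<le> card ?K"
    then have lt: "card ?K < card {..<m}" by simp
    obtain f where f: "\<And>i. i < m \<Longrightarrow> f i \<in> eigenspace t" "\<And>c. (\<Sum>i<m. c i *\<^sub>R f i) = 0 \<Longrightarrow> \<forall>i<m. c i = 0"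
      using m by blast
    obtain c where c: "\<exists>i\<in>{..<m}. c i \<noteq> 0" "\<forall>k\<in>?K. (\<Sum>i<m. c i * (f i \<bullet> fst (e k))) = 0"
      using underdetermined_system[OF finite_eigenvalue _ lt, of "\<lambda>k i. f i \<bullet> fst (e k)"] by auto
    have "(\<Sum>i<m. c i *\<^sub>R f i) = (\<Sum>i<m. c i *\<^sub>R (\<Sum>k\<in>?K. (f i \<bullet> fst (e k)) *\<^sub>R fst (e k)))"
      using f(1) by (intro sum.cong) (auto simp: eigenspace_expansion[symmetric])
    also have "\<dots> = (\<Sum>k\<in>?K. (\<Sum>i<m. c i * (f i \<bullet> fst (e k))) *\<^sub>R fst (e k))"
      by (simp add: scaleR_sum_right scaleR_sum_left sum.swap[of _ ?K])
    also have "\<dots> = 0" using c(2) by (intro sum.neutral) auto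
    finally show False using f(2) c(1) by blast
  qed
  then show "Sup (enat ` ?M) \<le> enat (card ?K)" by (intro SUP_least) (simp only: enat_ord_simps)
  obtain h where h: "bij_betw h {..<card ?K} ?K"
    using ex_bij_betw_nat_finite[OF finite_eigenvalue] by (auto simp: atLeast0LessThan)
  have "card ?K \<in> ?M"
  proof (intro CollectI exI[of _ "\<lambda>i. fst (e (h i))"] conjI allI impI)
    fix i assume "i < card ?K"
    then have "l (h i) = t" using h by (auto simp: bij_betw_def)
    then show "fst (e (h i)) \<in> eigenspace t" using basis_in_eigenspace by metis
  next
    fix c i assume c: "(\<Sum>i<card ?K. c i *\<^sub>R fst (e (h i))) = 0" and i: "i < card ?K"
    have "(\<Sum>j<card ?K. c j *\<^sub>R fst (e (h j))) \<bullet> fst (e (h i)) = (\<Sum>j<card ?K. if j = i then c j else 0)"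
      unfolding inner_sum_left
    proof (rule sum.cong)
      fix j assume "j \<in> {..<card ?K}"
      then have "h j = h i \<longleftrightarrow> j = i" using h i by (auto simp: bij_betw_def inj_on_def)
      then show "(c j *\<^sub>R fst (e (h j))) \<bullet> fst (e (h i)) = (if j = i then c j else 0)" by (simp add: basis_orth)
    qed simp
    then show "c i = 0" using c i by simp
  qed
  then show "enat (card ?K) \<le> Sup (enat ` ?M)" by (intro SUP_upper)
qed

text \<open>Some nontrivial combination of the k + 1 trial vectors is orthogonal to the first k
  eigenvectors, and there the quotient is at least \<open>l k\<close>.\<close>

lemma eigenvalue_le_rayleigh:
  assumes x: "\<And>i. i \<le> k \<Longrightarrow> x i \<in> V"
    and indep: "\<And>c. (\<Sum>i\<le>k. c i *\<^sub>R fst (x i)) = 0 \<Longrightarrow> \<forall>i\<le>k. c i = 0"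
    and rayleigh: "\<And>c. (norm (\<Sum>i\<le>k. c i *\<^sub>R snd (x i)))\<^sup>2 \<le> T * (norm (\<Sum>i\<le>k. c i *\<^sub>R fst (x i)))\<^sup>2"
  shows "l k \<le> T"
proof -
  obtain c where c: "\<exists>i\<le>k. c i \<noteq> 0" "(\<Sum>i\<le>k. c i *\<^sub>R x i) \<in> orth_complement e k"
    using exists_orthogonal_combination[of k x e] x by blast
  let ?u = "\<Sum>i\<le>k. c i *\<^sub>R fst (x i)"
  have "l k * (norm ?u)\<^sup>2 \<le> (norm (\<Sum>i\<le>k. c i *\<^sub>R snd (x i)))\<^sup>2"
    using basis c(2) unfolding eigenbasis_def by (force simp: fst_sum snd_sum)
  then have "l k * (norm ?u)\<^sup>2 \<le> T * (norm ?u)\<^sup>2" using rayleigh order_trans by blast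
  moreover have "?u \<noteq> 0" using indep c(1) by blast
  ultimately show ?thesis by simp
qed

text \<open>The span of the first k + 1 eigenvectors attains the min-max value; by orthonormality
  the sum of squares is the squared norm of the first component.\<close>

lemma rayleigh_basis:
  "(norm (\<Sum>i\<le>k. c i *\<^sub>R snd (e i)))\<^sup>2 \<le> l k * (\<Sum>i\<le>k. (c i)\<^sup>2)"
proof -
  have s: "snd (e i) \<bullet> snd (e j) = (if i = j then l i else 0)" for i j
    using basis_eigen[OF basis_in, of i j] by (simp add: basis_orth)
  have "(norm (\<Sum>i\<le>k. c i *\<^sub>R snd (e i)))\<^sup>2 = (\<Sum>i\<le>k. (c i)\<^sup>2 * l i)"
    unfolding power2_norm_eq_inner
    by (simp add: inner_sum_left inner_sum_right s power2_eq_square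
        if_distrib[of "\<lambda>t. _ * t"] mult.assoc cong: if_cong)
  also have "\<dots> \<le> (\<Sum>i\<le>k. (c i)\<^sup>2 * l k)"
    using basis by (intro sum_mono mult_left_mono) (auto simp: eigenbasis_def mono_def)
  finally show ?thesis by (simp add: sum_distrib_left mult.commute)
qed

end

end

text \<open>One half of the uniqueness of a nondecreasing enumeration with given finite
  multiplicities. The values \<open>l 1\<close>, ..., \<open>l k\<close> occupy at least k places of
  \<open>l\<close>, hence of \<open>l'\<close>, and if \<open>l k < l' k\<close> all these places of
  \<open>l'\<close> would lie strictly below k.\<close>

lemma counting_le:
  fixes l l' :: "nat \<Rightarrow> real"
  assumes mono: "mono_on {1..} l" "mono_on {1..} l'"
    and fin: "\<And>t. finite {k\<in>{1..}. l k = t}" "\<And>t. finite {k\<in>{1..}. l' k = t}"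
    and card: "\<And>t. card {k\<in>{1..}. l k = t} = card {k\<in>{1..}. l' k = t}" and k: "1 \<le> k"
  shows "l' k \<le> l k"
proof (rule ccontr)
  assume "\<not> l' k \<le> l k"
  then have less: "l k < l' k" by simp
  define B where "B = {j\<in>{1..}. l' j \<le> l k}"
  have B: "B \<subseteq> {1..<k}"
  proof
    fix j assume "j \<in> B"
    then have "\<not> k \<le> j" using mono_onD[OF mono(2), of k j] less k by (auto simp: B_def)
    then show "j \<in> {1..<k}" using \<open>j \<in> B\<close> by (auto simp: B_def)
  qed
  then have finB: "finite B" by (rule finite_subset) simp
  let ?T = "l ` {1..k}"
  let ?F = "\<lambda>t. {j\<in>{1..}. l j = t}" and ?F' = "\<lambda>t. {j\<in>{1..}. l' j = t}"
  have "k = card {1..k}" by simp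
  also have "\<dots> \<le> card (\<Union>t\<in>?T. ?F t)"
    using fin by (intro card_mono) auto
  also have "\<dots> \<le> (\<Sum>t\<in>?T. card (?F t))" by (rule card_UN_le) simp
  also have "\<dots> = (\<Sum>t\<in>?T. card (?F' t))" by (simp only: card)
  also have "\<dots> = card (\<Union>t\<in>?T. ?F' t)"
    using fin by (intro card_UN_disjoint[symmetric]) auto
  also have "\<dots> \<le> card B"
  proof (rule card_mono[OF finB])
    have "l j \<le> l k" if "j \<in> {1..k}" for j
      using that by (intro mono_onD[OF mono(1)]) auto
    then show "(\<Union>t\<in>?T. ?F' t) \<subseteq> B" by (auto simp: B_def)
  qed
  also have "\<dots> \<le> card {1..<k}" by (rule card_mono[OF _ B]) simp
  also have "\<dots> < k" using k by simp
  finally show False by simp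
qed

section \<open>The Sobolev space and its compact embedding\<close>


lemma square_integrable_continuous:
  fixes f :: "'a::euclidean_space \<Rightarrow> 'b::euclidean_space"
  assumes "continuous_on UNIV f" "compact K" "\<And>x. x \<notin> K \<Longrightarrow> f x = 0"
  shows "square_integrable f"
proof -
  have "integrable lborel (\<lambda>x. indicator K x *\<^sub>R (norm (f x))\<^sup>2)"
    using continuous_on_subset[OF assms(1), of K]
    by (intro borel_integrable_compact assms(2) continuous_on_power continuous_on_norm) simp
  moreover have "(\<lambda>x. indicator K x *\<^sub>R (norm (f x))\<^sup>2) = (\<lambda>x. (norm (f x))\<^sup>2)"
    using assms(3) by (auto simp: indicator_def fun_eq_iff)
  moreover have "f \<in> borel_measurable lborel"
    using borel_measurable_continuous_onI[OF assms(1)] by simp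
  ultimately show ?thesis by (simp only: square_integrable_def)
qed

lemma test_square_integrable:
  assumes "test_function \<Omega> \<phi>" shows "square_integrable \<phi>"
proof -
  obtain K where "compact K" "K \<subseteq> \<Omega>" "\<And>x. x \<notin> K \<Longrightarrow> \<phi> x = 0" using test_functionE[OF assms] by blast
  then show ?thesis
    by (intro square_integrable_continuous[where K=K, OF C_k_continuous[OF test_function_C_k[OF assms, of 0]]])
qed

lemma grad_square_integrable:
  assumes "test_function \<Omega> \<phi>" shows "square_integrable (grad \<phi>)"
proof -
  obtain K where "compact K" "K \<subseteq> \<Omega>" "\<And>x. x \<notin> K \<Longrightarrow> \<phi> x = 0"
    "\<And>x. x \<notin> K \<Longrightarrow> grad \<phi> x = 0" using test_function_grad_supp[OF assms] by blast
  then show ?thesis by (intro square_integrable_continuous[OF continuous_on_grad[OF assms], of K])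
qed

section \<open>The translation estimate for test functions\<close>

lemma square_of_mean_le:
  fixes h :: "'a::euclidean_space \<Rightarrow> real"
  assumes A: "compact A" "measure lborel A > 0" and h: "continuous_on UNIV h"
  shows "(\<integral>x. indicator A x * h x \<partial>lborel)\<^sup>2 \<le> measure lborel A * (\<integral>x. indicator A x * (h x)\<^sup>2 \<partial>lborel)"
proof -
  define m where "m = measure lborel A"
  \<comment> \<open>The mean of h over \<open>A\<close>; the inequality expresses that the variance
    is nonnegative.\<close>
  define k where "k = (\<integral>x. indicator A x * h x \<partial>lborel) / m"
  have m: "m > 0" using A(2) by (simp add: m_def)
  have int: "integrable lborel (\<lambda>x. indicator A x * f x)" if "continuous_on UNIV f" for f :: "'a \<Rightarrow> real"
    using borel_integrable_compact[OF A(1) continuous_on_subset[OF that]] by simp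
  have i1: "integrable lborel (\<lambda>x. indicator A x * (h x)\<^sup>2)" by (intro int continuous_intros h)
  have i2: "integrable lborel (\<lambda>x. indicator A x * h x)" by (intro int h)
  have i3: "integrable lborel (indicator A :: 'a \<Rightarrow> real)" using int[of "\<lambda>_. 1"] by simp
  have "0 \<le> (\<integral>x. indicator A x * (h x - k)\<^sup>2 \<partial>lborel)" by simp
  also have "\<dots> = (\<integral>x. indicator A x * (h x)\<^sup>2 - 2 * k * (indicator A x * h x) + k\<^sup>2 * indicator A x \<partial>lborel)"
    by (rule Bochner_Integration.integral_cong) (auto simp: power2_eq_square algebra_simps)
  also have "\<dots> = (\<integral>x. indicator A x * (h x)\<^sup>2 \<partial>lborel) - 2 * k * (k * m) + k\<^sup>2 * m"
    using m by (simp add: i1 i2 i3 k_def m_def)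
  finally have "k\<^sup>2 * m \<le> (\<integral>x. indicator A x * (h x)\<^sup>2 \<partial>lborel)" by (simp add: power2_eq_square algebra_simps)
  then have "m * (k\<^sup>2 * m) \<le> m * (\<integral>x. indicator A x * (h x)\<^sup>2 \<partial>lborel)"
    using m by (intro mult_left_mono) auto
  moreover have "m * (k\<^sup>2 * m) = (\<integral>x. indicator A x * h x \<partial>lborel)\<^sup>2"
    using m by (simp add: k_def power2_eq_square)
  ultimately show ?thesis by (simp add: m_def)
qed

lemma nn_integral_translate:
  fixes c :: "'a::euclidean_space"
  assumes [measurable]: "f \<in> borel_measurable borel"
  shows "(\<integral>\<^sup>+x. f (x + c) \<partial>lborel) = (\<integral>\<^sup>+x. f x \<partial>lborel)"
proof -
  have "(\<integral>\<^sup>+x. f x \<partial>lborel) = (\<integral>\<^sup>+x. f x \<partial>(distr lborel borel ((+) c)))"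
    by (simp add: lborel_distr_plus)
  also have "\<dots> = (\<integral>\<^sup>+x. f (c + x) \<partial>lborel)"
    by (rule nn_integral_distr) measurable
  finally show ?thesis by (simp add: add.commute)
qed

text \<open>The fundamental theorem of calculus along the segment from x to x + z, combined with
  \<open>square_of_mean_le\<close> on the unit interval.\<close>

lemma translation_pointwise:
  fixes \<phi> :: "'a::euclidean_space \<Rightarrow> real"
  assumes \<phi>: "test_function \<Omega> \<phi>"
  shows "(\<phi> (x + z) - \<phi> x)\<^sup>2 \<le> (\<integral>t. indicator {0..1} t * ((norm z)\<^sup>2 * (norm (grad \<phi> (x + t *\<^sub>R z)))\<^sup>2) \<partial>lborel)"
proof -
  let ?h = "\<lambda>t. grad \<phi> (x + t *\<^sub>R z) \<bullet> z"
  have grad_cont: "continuous_on UNIV (\<lambda>t. grad \<phi> (x + t *\<^sub>R z))"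
    by (rule continuous_on_compose2[OF continuous_on_grad[OF \<phi>, of UNIV]]) (auto intro!: continuous_intros)
  then have cont: "continuous_on UNIV ?h" by (intro continuous_intros)
  have D: "((\<lambda>t. \<phi> (x + t *\<^sub>R z)) has_real_derivative ?h t) (at t)" for t
  proof -
    have "((\<lambda>t. \<phi> (x + t *\<^sub>R z)) has_derivative (\<lambda>s. grad \<phi> (x + t *\<^sub>R z) \<bullet> (s *\<^sub>R z))) (at t)"
      by (rule has_derivative_compose[where g=\<phi>, OF _ has_derivative_grad_test[OF \<phi>]])
         (rule derivative_eq_intros refl | simp)+
    then show ?thesis by (simp add: has_field_derivative_def mult.commute[of _ "?h t"])
  qed
  have int: "integrable lborel (\<lambda>t. indicator {0..1} t * f t)" if "continuous_on UNIV f" for f :: "real \<Rightarrow> real"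
    using borel_integrable_compact[OF compact_Icc continuous_on_subset[OF that], of 0 1] by simp
  have "(\<integral>t. ?h t * indicator {0..1} t \<partial>lborel) = \<phi> (x + 1 *\<^sub>R z) - \<phi> (x + 0 *\<^sub>R z)"
    by (rule integral_FTC_Icc_real) (use D cont in \<open>auto simp: continuous_on_eq_continuous_at\<close>)
  then have "(\<phi> (x + z) - \<phi> x)\<^sup>2 = (\<integral>t. indicator {0..1} t * ?h t \<partial>lborel)\<^sup>2"
    by (simp add: mult.commute)
  also have "\<dots> \<le> measure lborel {0..1::real} * (\<integral>t. indicator {0..1} t * (?h t)\<^sup>2 \<partial>lborel)"
    by (rule square_of_mean_le) (use cont in auto)
  also have "\<dots> = (\<integral>t. indicator {0..1} t * (?h t)\<^sup>2 \<partial>lborel)" by simp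
  also have "\<dots> \<le> (\<integral>t. indicator {0..1} t * ((norm z)\<^sup>2 * (norm (grad \<phi> (x + t *\<^sub>R z)))\<^sup>2) \<partial>lborel)"
  proof (rule integral_mono)
    show "integrable lborel (\<lambda>t. indicator {0..1} t * (?h t)\<^sup>2)" by (intro int continuous_intros cont)
    show "integrable lborel (\<lambda>t. indicator {0..1} t * ((norm z)\<^sup>2 * (norm (grad \<phi> (x + t *\<^sub>R z)))\<^sup>2))"
      by (intro int continuous_intros grad_cont)
    fix t
    have "(?h t)\<^sup>2 \<le> (norm z)\<^sup>2 * (norm (grad \<phi> (x + t *\<^sub>R z)))\<^sup>2"
      using Cauchy_Schwarz_ineq[of "grad \<phi> (x + t *\<^sub>R z)" z]
      by (simp add: power2_norm_eq_inner mult.commute)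
    then show "indicator {0..1} t * (?h t)\<^sup>2 \<le> indicator {0..1} t * ((norm z)\<^sup>2 * (norm (grad \<phi> (x + t *\<^sub>R z)))\<^sup>2)"
      by (intro mult_left_mono) auto
  qed
  finally show ?thesis .
qed

text \<open>Integrating the pointwise bound in x and exchanging the integrals leaves the same
  gradient integral for each t, by translation invariance. With nonnegative integrals the exchange
  needs measurability only.\<close>

lemma translation_estimate:
  fixes \<phi> :: "'a::euclidean_space \<Rightarrow> real"
  assumes \<phi>: "test_function \<Omega> \<phi>"
  shows "(\<integral>\<^sup>+x. ennreal ((\<phi> (x + z) - \<phi> x)\<^sup>2) \<partial>lborel)
    \<le> ennreal ((norm z)\<^sup>2) * (\<integral>\<^sup>+x. ennreal ((norm (grad \<phi> x))\<^sup>2) \<partial>lborel)"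
proof -
  have g[measurable]: "grad \<phi> \<in> borel_measurable borel"
    by (rule borel_measurable_continuous_onI[OF continuous_on_grad[OF \<phi>]])
  have grad_cont: "continuous_on UNIV (\<lambda>t. grad \<phi> (x + t *\<^sub>R z))" for x
    by (rule continuous_on_compose2[OF continuous_on_grad[OF \<phi>, of UNIV]]) (auto intro!: continuous_intros)
  have "ennreal ((\<phi> (x + z) - \<phi> x)\<^sup>2)
      \<le> (\<integral>\<^sup>+t. ennreal (indicator {0..1} t) * (ennreal ((norm z)\<^sup>2) * ennreal ((norm (grad \<phi> (x + t *\<^sub>R z)))\<^sup>2)) \<partial>lborel)" for x
  proof -
    have "integrable lborel (\<lambda>t. indicator {0..1} t *\<^sub>R ((norm z)\<^sup>2 * (norm (grad \<phi> (x + t *\<^sub>R z)))\<^sup>2))"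
      by (intro borel_integrable_compact compact_Icc continuous_intros continuous_on_subset[OF grad_cont]) auto
    then have "ennreal (\<integral>t. indicator {0..1} t * ((norm z)\<^sup>2 * (norm (grad \<phi> (x + t *\<^sub>R z)))\<^sup>2) \<partial>lborel)
       = (\<integral>\<^sup>+t. ennreal (indicator {0..1} t * ((norm z)\<^sup>2 * (norm (grad \<phi> (x + t *\<^sub>R z)))\<^sup>2)) \<partial>lborel)"
      by (intro nn_integral_eq_integral[symmetric]) auto
    then show ?thesis
      using ennreal_leI[OF translation_pointwise[OF \<phi>, of x z]] by (simp add: ennreal_mult)
  qed
  then have "(\<integral>\<^sup>+x. ennreal ((\<phi> (x + z) - \<phi> x)\<^sup>2) \<partial>lborel)
    \<le> (\<integral>\<^sup>+x. (\<integral>\<^sup>+t. ennreal (indicator {0..1} t) * (ennreal ((norm z)\<^sup>2) * ennreal ((norm (grad \<phi> (x + t *\<^sub>R z)))\<^sup>2)) \<partial>lborel) \<partial>lborel)"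
    by (intro nn_integral_mono)
  also have "\<dots> = (\<integral>\<^sup>+t. (\<integral>\<^sup>+x. ennreal (indicator {0..1} t) * (ennreal ((norm z)\<^sup>2) * ennreal ((norm (grad \<phi> (x + t *\<^sub>R z)))\<^sup>2)) \<partial>lborel) \<partial>(lborel :: real measure))"
    by (rule lborel_pair.Fubini'[symmetric]) measurable
  also have "\<dots> = (\<integral>\<^sup>+t. ennreal (indicator {0..1} t) * (ennreal ((norm z)\<^sup>2) * (\<integral>\<^sup>+x. ennreal ((norm (grad \<phi> x))\<^sup>2) \<partial>lborel)) \<partial>(lborel :: real measure))"
  proof (rule nn_integral_cong)
    fix t :: real
    have "(\<integral>\<^sup>+x. ennreal ((norm (grad \<phi> (x + t *\<^sub>R z)))\<^sup>2) \<partial>lborel) = (\<integral>\<^sup>+x. ennreal ((norm (grad \<phi> x))\<^sup>2) \<partial>lborel)"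
      by (rule nn_integral_translate) measurable
    then show "(\<integral>\<^sup>+x. ennreal (indicator {0..1} t) * (ennreal ((norm z)\<^sup>2) * ennreal ((norm (grad \<phi> (x + t *\<^sub>R z)))\<^sup>2)) \<partial>lborel)
      = ennreal (indicator {0..1} t) * (ennreal ((norm z)\<^sup>2) * (\<integral>\<^sup>+x. ennreal ((norm (grad \<phi> x))\<^sup>2) \<partial>lborel))"
      by (simp add: nn_integral_cmult)
  qed
  also have "\<dots> = (\<integral>\<^sup>+t. ennreal (indicator {0..1::real} t) \<partial>lborel) * (ennreal ((norm z)\<^sup>2) * (\<integral>\<^sup>+x. ennreal ((norm (grad \<phi> x))\<^sup>2) \<partial>lborel))"
    by (rule nn_integral_multc) measurable
  also have "(\<integral>\<^sup>+t. ennreal (indicator {0..1::real} t) \<partial>lborel) = 1"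
    by (simp add: ennreal_indicator)
  finally show ?thesis by simp
qed

text \<open>The closure is taken of pairs, so limits of gradients are recorded alongside limits of
  functions. \<open>H10_gradient_iff\<close> identifies this with the space of the
  definitions.\<close>

definition H10 :: "'a::euclidean_space set \<Rightarrow> (('a, real) l2 \<times> ('a, 'a) l2) set" where
  "H10 \<Omega> = closure {(abs_l2 \<phi>, abs_l2 (grad \<phi>)) |\<phi>. test_function \<Omega> \<phi>}"

text \<open>A value differs from the average over the ball by an average of differences. Seen from a
  point x of the ball, its points are x + z with z of norm at most 2 h, and this region of shifts no
  longer depends on p.\<close>

lemma ball_average_bound:
  fixes \<phi> :: "'a::euclidean_space \<Rightarrow> real"
  assumes \<phi>: "test_function \<Omega> \<phi>" and h: "h > 0" and x: "x \<in> cball p h"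
  defines "v \<equiv> measure lborel (cball (0::'a) h)"
  shows "ennreal ((\<phi> x)\<^sup>2) \<le> ennreal (2 * ((\<integral>y. indicator (cball p h) y * \<phi> y \<partial>lborel) / v)\<^sup>2)
     + ennreal (2 / v) * (\<integral>\<^sup>+z. indicator (cball 0 (2 * h)) z * ennreal ((\<phi> (x + z) - \<phi> x)\<^sup>2) \<partial>lborel)"
proof -
  have v: "v > 0" "measure lborel (cball p h) = v"
    using h by (simp_all add: v_def content_cball unit_ball_vol_pos)
  define A where "A = (\<integral>y. indicator (cball p h) y * \<phi> y \<partial>lborel) / v"
  have cont: "continuous_on S \<phi>" for S by (rule C_k_continuous[OF test_function_C_k[OF \<phi>, of 0]])
  have [measurable]: "\<phi> \<in> borel_measurable borel" by (rule borel_measurable_continuous_onI[OF cont])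
  have int: "integrable lborel (\<lambda>y. indicator (cball p h) y * f y)" if "continuous_on UNIV f" for f :: "'a \<Rightarrow> real"
    using borel_integrable_compact[OF compact_cball continuous_on_subset[OF that], of p h] by simp
  define I where "I = (\<integral>y. indicator (cball p h) y * (\<phi> y - \<phi> x)\<^sup>2 \<partial>lborel)"
  have "(\<integral>y. indicator (cball p h) y * (\<phi> y - \<phi> x) \<partial>lborel)
     = (\<integral>y. indicator (cball p h) y * \<phi> y - \<phi> x * indicator (cball p h) y \<partial>lborel)"
    by (rule Bochner_Integration.integral_cong) (auto simp: algebra_simps)
  also have "\<dots> = v * A - \<phi> x * v"
    using int[OF cont] int[of "\<lambda>_. 1"] v by (simp add: A_def)
  also have "\<dots> = v * (A - \<phi> x)" by (simp add: algebra_simps)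
  finally have mean: "(\<integral>y. indicator (cball p h) y * (\<phi> y - \<phi> x) \<partial>lborel) = v * (A - \<phi> x)" .
  have "(v * (A - \<phi> x))\<^sup>2 \<le> v * I"
    using square_of_mean_le[of "cball p h" "\<lambda>y. \<phi> y - \<phi> x"] v
    by (simp only: mean I_def v(2)) (simp add: continuous_on_diff cont)
  then have "v * (A - \<phi> x)\<^sup>2 \<le> I" using v by (simp add: power2_eq_square mult.assoc mult.left_commute)
  then have "(A - \<phi> x)\<^sup>2 \<le> I / v" using v by (simp add: field_simps)
  \<comment> \<open>The square of a difference is at most twice the sum of the squares, applied to A
    - (A - \<phi> x).\<close>
  moreover have "(\<phi> x)\<^sup>2 \<le> 2 * A\<^sup>2 + 2 * (A - \<phi> x)\<^sup>2"
    using zero_le_power2[of "2 * A - \<phi> x"] by (simp add: power2_eq_square algebra_simps)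
  ultimately have "(\<phi> x)\<^sup>2 \<le> 2 * A\<^sup>2 + 2 / v * I" by simp
  moreover have I0: "I \<ge> 0" by (simp add: I_def)
  ultimately have 1: "ennreal ((\<phi> x)\<^sup>2) \<le> ennreal (2 * A\<^sup>2) + ennreal (2 / v) * ennreal I"
    using v by (simp add: ennreal_mult[symmetric] ennreal_plus[symmetric] ennreal_leI del: ennreal_plus)
  have "ennreal I = (\<integral>\<^sup>+y. ennreal (indicator (cball p h) y * (\<phi> y - \<phi> x)\<^sup>2) \<partial>lborel)"
    unfolding I_def by (intro nn_integral_eq_integral[symmetric] int continuous_intros cont) simp
  also have "\<dots> = (\<integral>\<^sup>+z. ennreal (indicator (cball p h) (z + x) * (\<phi> (z + x) - \<phi> x)\<^sup>2) \<partial>lborel)"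
  proof (rule nn_integral_translate[symmetric])
    have "(indicator (cball p h) :: 'a \<Rightarrow> real) \<in> borel_measurable borel" by (intro borel_measurable_indicator borel_closed closed_cball)
    moreover have "(\<lambda>y. (\<phi> y - \<phi> x)\<^sup>2) \<in> borel_measurable borel"
      by (intro borel_measurable_continuous_onI continuous_intros cont)
    ultimately show "(\<lambda>y. ennreal (indicator (cball p h) y * (\<phi> y - \<phi> x)\<^sup>2)) \<in> borel_measurable borel"
      by (intro measurable_compose[OF _ measurable_ennreal] borel_measurable_times)
  qed
  also have "\<dots> \<le> (\<integral>\<^sup>+z. indicator (cball 0 (2 * h)) z * ennreal ((\<phi> (x + z) - \<phi> x)\<^sup>2) \<partial>lborel)"
  proof (rule nn_integral_mono)
    fix z
    have "z \<in> cball 0 (2 * h)" if "z + x \<in> cball p h"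
      using that x norm_triangle_ineq[of "z + x - p" "p - x"] by (simp add: dist_norm norm_minus_commute)
    then show "ennreal (indicator (cball p h) (z + x) * (\<phi> (z + x) - \<phi> x)\<^sup>2)
       \<le> indicator (cball 0 (2 * h)) z * ennreal ((\<phi> (x + z) - \<phi> x)\<^sup>2)"
      by (auto simp: indicator_def add.commute)
  qed
  finally show ?thesis
    using 1 unfolding A_def by (meson add_left_mono mult_left_mono order_trans zero_le)
qed

lemma square_integrable_indicator:
  assumes "compact K"
  shows "square_integrable (\<lambda>x::'a::euclidean_space. c * indicator K x :: real)"
proof -
  have "integrable lborel (\<lambda>x. c\<^sup>2 * indicator K x)"
    using borel_integrable_compact[OF assms continuous_on_const[of K "c\<^sup>2"]] by (simp add: mult.commute)
  moreover have "(norm (c * indicator K x :: real))\<^sup>2 = c\<^sup>2 * indicator K x" for x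
    by (simp add: indicator_def)
  moreover have "K \<in> sets borel" using assms by (rule borel_compact)
  ultimately show ?thesis by (simp add: square_integrable_def)
qed

text \<open>The functionals given by \<open>F\<close> are multiples of the averages over the balls of a fine finite cover
  of \<open>B\<close>; the deviation from the averages is controlled by the translation estimate.\<close>

lemma friedrichs_inequality_test:
  fixes B :: "'a::euclidean_space set"
  assumes B: "bounded B" and \<epsilon>: "\<epsilon> > 0"
  shows "\<exists>F :: ('a, real) l2 set. finite F \<and> (\<forall>\<phi>. test_function B \<phi> \<longrightarrow>
     (norm (abs_l2 \<phi>))\<^sup>2 \<le> (\<Sum>w\<in>F. (abs_l2 \<phi> \<bullet> w)\<^sup>2) + \<epsilon> * (norm (abs_l2 (grad \<phi>)))\<^sup>2)"
proof -
  \<comment> \<open>In dimension N the factor 2 / v of \<open>ball_average_bound\<close>, the volume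
    2^N v of the ball of radius 2 h and the bound 4 h^2 for the squared length of the shifts
    multiply to 8 2^N h^2. The radius \<open>h\<close> makes this equal to \<epsilon>.\<close>
  define C :: real where "C = 8 * 2 ^ DIM('a)"
  have C: "C > 0" by (simp add: C_def)
  define h where "h = sqrt (\<epsilon> / C)"
  have h: "h > 0" "C * h\<^sup>2 = \<epsilon>" using \<epsilon> C by (simp_all add: h_def)
  define v where "v = measure lborel (cball (0::'a) h)"
  have v: "v > 0" using h by (simp add: v_def content_cball unit_ball_vol_pos)
  have v2: "measure lborel (cball (0::'a) (2 * h)) = 2 ^ DIM('a) * v"
    using h by (simp add: v_def content_cball power_mult_distrib)
  obtain R where R: "R > 0" "B \<subseteq> cball 0 R" using B by (auto simp: bounded_pos subset_iff)
  define Q where "Q = cball (0::'a) R"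
  define b where "b = measure lborel Q"
  have Qe: "emeasure lborel Q = ennreal b"
    unfolding b_def Q_def by (rule emeasure_eq_ennreal_measure) (use R in \<open>simp add: emeasure_cball less_imp_le\<close>)
  obtain P where P: "finite P" "P \<subseteq> Q" "Q \<subseteq> (\<Union>p\<in>P. ball p h)"
    using compactE_image[of Q Q "\<lambda>p. ball p h"] h(1) unfolding Q_def
    by (metis (no_types, lifting) UN_I centre_in_ball compact_cball open_ball subsetI)
  \<comment> \<open>Normalised so that the squared product with \<phi> is 2 b times the squared
    average; after division by b, integration over \<open>Q\<close>, whose measure is b, gives back
    the sum of these squares.\<close>
  define w :: "'a \<Rightarrow> ('a, real) l2" where "w p = abs_l2 (\<lambda>y. sqrt (2 * b) / v * indicator (cball p h) y)" for p
  have w: "2 * b * ((\<integral>y. indicator (cball p h) y * \<phi> y \<partial>lborel) / v)\<^sup>2 = (abs_l2 \<phi> \<bullet> w p)\<^sup>2" if "test_function B \<phi>" for p \<phi>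
  proof -
    have "abs_l2 \<phi> \<bullet> w p = (\<integral>y. \<phi> y * (sqrt (2 * b) / v * indicator (cball p h) y) \<partial>lborel)"
      unfolding w_def
      by (subst inner_abs_l2[OF test_square_integrable[OF that] square_integrable_indicator[OF compact_cball]]) simp
    also have "\<dots> = sqrt (2 * b) / v * (\<integral>y. indicator (cball p h) y * \<phi> y \<partial>lborel)"
      by (subst Bochner_Integration.integral_mult_right_zero[symmetric]) (auto simp: mult_ac intro!: Bochner_Integration.integral_cong)
    finally show ?thesis using v by (simp add: power_mult_distrib power_divide b_def)
  qed
  show ?thesis
  proof (intro exI[of _ "w ` P"] conjI allI impI)
    fix \<phi> assume \<phi>: "test_function B \<phi>"
    have \<phi>c: "continuous_on UNIV \<phi>" by (rule C_k_continuous[OF test_function_C_k[OF \<phi>, of 0]])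
    have [measurable]: "\<phi> \<in> borel_measurable borel" by (rule borel_measurable_continuous_onI[OF \<phi>c])
    define s where "s = (\<Sum>w\<in>w ` P. (abs_l2 \<phi> \<bullet> w)\<^sup>2)"
    define G where "G = (norm (abs_l2 (grad \<phi>)))\<^sup>2"
    define D where "D = cball (0::'a) (2 * h)"
    have D[measurable]: "D \<in> sets borel" by (simp add: D_def)
    define J where "J x = (\<integral>\<^sup>+z. indicator D z * ennreal ((\<phi> (x + z) - \<phi> x)\<^sup>2) \<partial>lborel)" for x
    have b: "b > 0" using R by (simp add: b_def Q_def content_cball unit_ball_vol_pos)
    have Jm[measurable]: "J \<in> borel_measurable borel" unfolding J_def by measurable
    have pt: "ennreal ((\<phi> x)\<^sup>2) \<le> ennreal (s / b) * indicator Q x + ennreal (2 / v) * J x" for x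
    proof (cases "x \<in> Q")
      case False
      then have "\<phi> x = 0" using test_function_outside[OF \<phi>, of x] R(2) unfolding Q_def by blast
      then show ?thesis by simp
    next
      case True
      then obtain p where p: "p \<in> P" "x \<in> cball p h" using P(3) by (auto simp: less_imp_le)
      have "2 * b * ((\<integral>y. indicator (cball p h) y * \<phi> y \<partial>lborel) / v)\<^sup>2 \<le> s"
        unfolding w[OF \<phi>] s_def by (rule member_le_sum) (use p P in auto)
      then have "2 * ((\<integral>y. indicator (cball p h) y * \<phi> y \<partial>lborel) / v)\<^sup>2 \<le> s / b"
        using b by (simp add: field_simps)
      then have "ennreal (2 * ((\<integral>y. indicator (cball p h) y * \<phi> y \<partial>lborel) / v)\<^sup>2) \<le> ennreal (s / b)" by (rule ennreal_leI)
      then show ?thesis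
        using ball_average_bound[OF \<phi> h(1) p(2)] True unfolding v_def[symmetric] D_def[symmetric] J_def[symmetric]
        by (simp add: order_trans[OF _ add_right_mono])
    qed
    \<comment> \<open>Exchanging the integrals brings in the translation estimate, for one shift z
      of length at most 2 h at a time.\<close>
    have "(\<integral>\<^sup>+x. J x \<partial>lborel) = (\<integral>\<^sup>+z. (\<integral>\<^sup>+x. indicator D z * ennreal ((\<phi> (x + z) - \<phi> x)\<^sup>2) \<partial>lborel) \<partial>lborel)"
      unfolding J_def by (rule lborel_pair.Fubini'[symmetric]) measurable
    also have "\<dots> \<le> (\<integral>\<^sup>+z. indicator D z * ennreal (4 * h\<^sup>2 * G) \<partial>lborel)"
    proof (rule nn_integral_mono)
      fix z :: 'a
      have "(\<integral>\<^sup>+x. ennreal ((\<phi> (x + z) - \<phi> x)\<^sup>2) \<partial>lborel) \<le> ennreal (4 * h\<^sup>2 * G)" if "z \<in> D"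
      proof -
        have "(norm z)\<^sup>2 \<le> (2 * h)\<^sup>2" using that by (intro power_mono) (auto simp: D_def)
        then have "(norm z)\<^sup>2 * G \<le> 4 * h\<^sup>2 * G" by (intro mult_right_mono) (auto simp: G_def power2_eq_square)
        then show ?thesis
          using translation_estimate[OF \<phi>, of z] nn_integral_norm_abs_l2[OF grad_square_integrable[OF \<phi>]]
          by (simp add: G_def ennreal_mult[symmetric] order_trans[OF _ ennreal_leI])
      qed
      then show "(\<integral>\<^sup>+x. indicator D z * ennreal ((\<phi> (x + z) - \<phi> x)\<^sup>2) \<partial>lborel)
         \<le> indicator D z * ennreal (4 * h\<^sup>2 * G)"
        by (simp add: indicator_def)
    qed
    also have "\<dots> = ennreal (2 ^ DIM('a) * v * (4 * h\<^sup>2 * G))"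
    proof -
      have "emeasure lborel D = ennreal (2 ^ DIM('a) * v)"
        unfolding v2[symmetric] D_def by (rule emeasure_eq_ennreal_measure) (use h in \<open>simp add: emeasure_cball less_imp_le\<close>)
      then show ?thesis using v by (simp add: nn_integral_multc ennreal_mult G_def)
    qed
    finally have J: "(\<integral>\<^sup>+x. J x \<partial>lborel) \<le> ennreal (2 ^ DIM('a) * v * (4 * h\<^sup>2 * G))" .
    have "ennreal ((norm (abs_l2 \<phi>))\<^sup>2) = (\<integral>\<^sup>+x. ennreal ((\<phi> x)\<^sup>2) \<partial>lborel)"
      using nn_integral_norm_abs_l2[OF test_square_integrable[OF \<phi>]] by simp
    also have "\<dots> \<le> (\<integral>\<^sup>+x. ennreal (s / b) * indicator Q x + ennreal (2 / v) * J x \<partial>lborel)"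
      by (intro nn_integral_mono pt)
    also have "\<dots> = ennreal (s / b) * ennreal b + ennreal (2 / v) * (\<integral>\<^sup>+x. J x \<partial>lborel)"
    proof -
      have Qs: "Q \<in> sets borel" by (simp add: Q_def)
      have "(\<integral>\<^sup>+x. ennreal (s / b) * indicator Q x + ennreal (2 / v) * J x \<partial>lborel)
         = (\<integral>\<^sup>+x. ennreal (s / b) * indicator Q x \<partial>lborel) + (\<integral>\<^sup>+x. ennreal (2 / v) * J x \<partial>lborel)"
        by (rule nn_integral_add) (use Jm Qs in auto)
      then show ?thesis using Qs Jm by (simp add: nn_integral_cmult nn_integral_cmult_indicator Qe)
    qed
    also have "\<dots> \<le> ennreal (s / b) * ennreal b + ennreal (2 / v) * ennreal (2 ^ DIM('a) * v * (4 * h\<^sup>2 * G))"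
      by (intro add_left_mono mult_left_mono J) simp
    also have "\<dots> = ennreal (s + \<epsilon> * G)"
    proof -
      have "s \<ge> 0" "G \<ge> 0" by (simp_all add: s_def G_def sum_nonneg)
      moreover have "2 / v * (2 ^ DIM('a) * v * (4 * h\<^sup>2 * G)) = \<epsilon> * G"
        using v by (simp add: h(2)[symmetric] C_def)
      ultimately show ?thesis using b v \<epsilon>
        by (simp add: ennreal_mult[symmetric] ennreal_plus[symmetric] del: ennreal_plus)
    qed
    finally have "(norm (abs_l2 \<phi>))\<^sup>2 \<le> s + \<epsilon> * G"
      by (subst (asm) ennreal_le_iff) (use \<epsilon> in \<open>auto simp: s_def G_def intro!: add_nonneg_nonneg sum_nonneg\<close>)
    then show "(norm (abs_l2 \<phi>))\<^sup>2 \<le> (\<Sum>w\<in>w ` P. (abs_l2 \<phi> \<bullet> w)\<^sup>2) + \<epsilon> * (norm (abs_l2 (grad \<phi>)))\<^sup>2"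
      by (simp add: s_def G_def)
  qed (use P in auto)
qed

lemma closed_H10: "closed (H10 \<Omega>)"
  by (simp add: H10_def)

lemma test_in_H10: "test_function \<Omega> \<phi> \<Longrightarrow> (abs_l2 \<phi>, abs_l2 (grad \<phi>)) \<in> H10 \<Omega>"
  unfolding H10_def by (rule subsetD[OF closure_subset]) blast

lemma H10_mono: "\<Omega> \<subseteq> \<Omega>' \<Longrightarrow> H10 \<Omega> \<subseteq> H10 \<Omega>'"
  unfolding H10_def by (rule closure_mono) (auto dest: test_function_mono)

text \<open>The way in which statements about all of \<open>H10\<close> are reached: a closed
  condition has to be checked on test functions only.\<close>

lemma H10_closed_induct:
  assumes "closed S" "\<And>\<phi>. test_function \<Omega> \<phi> \<Longrightarrow> (abs_l2 \<phi>, abs_l2 (grad \<phi>)) \<in> S"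
  shows "H10 \<Omega> \<subseteq> S"
  unfolding H10_def by (rule closure_minimal) (use assms in auto)

lemma subspace_closure:
  fixes S :: "'a::real_normed_vector set"
  assumes "subspace S" shows "subspace (closure S)"
  unfolding subspace_def
proof (intro conjI ballI allI)
  show "0 \<in> closure S" using subspace_0[OF assms] closure_subset by blast
next
  fix x y assume "x \<in> closure S" "y \<in> closure S"
  then obtain f g where "\<And>n. f n \<in> S" "f \<longlonglongrightarrow> x" "\<And>n. g n \<in> S" "g \<longlonglongrightarrow> y"
    unfolding closure_sequential by blast
  then have "\<And>n. f n + g n \<in> S" "(\<lambda>n. f n + g n) \<longlonglongrightarrow> x + y"
    using assms by (auto intro: subspace_add tendsto_intros)
  then show "x + y \<in> closure S"
    unfolding closure_sequential by (intro exI[of _ "\<lambda>n. f n + g n"]) blast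
next
  fix c :: real and x assume "x \<in> closure S"
  then obtain f where "\<And>n. f n \<in> S" "f \<longlonglongrightarrow> x" unfolding closure_sequential by blast
  then have "\<And>n. c *\<^sub>R f n \<in> S" "(\<lambda>n. c *\<^sub>R f n) \<longlonglongrightarrow> c *\<^sub>R x"
    using assms by (auto intro: subspace_scale tendsto_intros)
  then show "c *\<^sub>R x \<in> closure S"
    unfolding closure_sequential by (intro exI[of _ "\<lambda>n. c *\<^sub>R f n"]) blast
qed

lemma subspace_H10: "subspace (H10 \<Omega>)"
  unfolding H10_def
proof (rule subspace_closure, unfold subspace_def, intro conjI ballI allI)
  let ?T = "{(abs_l2 \<phi>, abs_l2 (grad \<phi>)) |\<phi>. test_function \<Omega> \<phi>}"
  have "(abs_l2 (\<lambda>x. 0), abs_l2 (grad (\<lambda>x. 0))) \<in> ?T" using test_function_zero by blast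
  then show "0 \<in> ?T" by (simp add: abs_l2_zero grad_zero[abs_def] zero_prod_def)
  fix x y assume "x \<in> ?T" "y \<in> ?T"
  then obtain f g where fg: "test_function \<Omega> f" "test_function \<Omega> g"
     "x = (abs_l2 f, abs_l2 (grad f))" "y = (abs_l2 g, abs_l2 (grad g))" by blast
  have "grad (\<lambda>x. f x + g x) = (\<lambda>x. grad f x + grad g x)"
    by (simp add: fun_eq_iff grad_add[OF fg(1,2)])
  then have "x + y = (abs_l2 (\<lambda>x. f x + g x), abs_l2 (grad (\<lambda>x. f x + g x)))"
    using fg by (simp add: abs_l2_add test_square_integrable grad_square_integrable)
  then show "x + y \<in> ?T" using test_function_add[OF fg(1,2)] by blast
next
  fix c x let ?T = "{(abs_l2 \<phi>, abs_l2 (grad \<phi>)) |\<phi>. test_function \<Omega> \<phi>}"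
  assume "x \<in> ?T"
  then obtain f where f: "test_function \<Omega> f" "x = (abs_l2 f, abs_l2 (grad f))" by blast
  have "grad (\<lambda>x. c * f x) = (\<lambda>x. c *\<^sub>R grad f x)"
    by (simp add: fun_eq_iff grad_cmult[OF f(1)])
  then have "c *\<^sub>R x = (abs_l2 (\<lambda>x. c * f x), abs_l2 (grad (\<lambda>x. c * f x)))"
    using f abs_l2_scaleR[OF test_square_integrable[OF f(1)], of c]
      abs_l2_scaleR[OF grad_square_integrable[OF f(1)], of c] by simp
  then show "c *\<^sub>R x \<in> ?T" using test_function_cmult[OF f(1)] by blast
qed

lemma friedrichs_inequality:
  fixes B :: "'a::euclidean_space set"
  assumes "bounded B" "\<epsilon> > 0"
  shows "\<exists>F :: ('a, real) l2 set. finite F \<and> (\<forall>x\<in>H10 B.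
     (norm (fst x))\<^sup>2 \<le> (\<Sum>w\<in>F. (fst x \<bullet> w)\<^sup>2) + \<epsilon> * (norm (snd x))\<^sup>2)"
proof -
  obtain F :: "('a, real) l2 set" where F: "finite F" "\<And>\<phi>. test_function B \<phi> \<Longrightarrow>
     (norm (abs_l2 \<phi>))\<^sup>2 \<le> (\<Sum>w\<in>F. (abs_l2 \<phi> \<bullet> w)\<^sup>2) + \<epsilon> * (norm (abs_l2 (grad \<phi>)))\<^sup>2"
    using friedrichs_inequality_test[OF assms] by blast
  have "H10 B \<subseteq> {x. (norm (fst x))\<^sup>2 \<le> (\<Sum>w\<in>F. (fst x \<bullet> w)\<^sup>2) + \<epsilon> * (norm (snd x))\<^sup>2}"
    by (rule H10_closed_induct) (auto intro!: closed_Collect_le continuous_intros simp: F(2))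
  with F(1) show ?thesis by blast
qed

text \<open>Rellich's theorem without weak limits. The countably many functionals of the Friedrichs
  inequalities converge along one subsequence; the inequality, applied to differences of its
  members, bounds their L^2 distance by these functionals plus a small multiple of the bounded
  gradients.\<close>

lemma H10_compact:
  fixes B :: "'a::euclidean_space set"
  assumes B: "bounded B" and x: "\<And>n. x n \<in> H10 B" and bdd: "bounded (range x)"
  shows "\<exists>r :: nat \<Rightarrow> nat. strict_mono r \<and> Cauchy (\<lambda>n. fst (x (r n)))"
proof -
  obtain C where C: "\<And>n. norm (x n) \<le> C" "C > 0" using bdd unfolding bounded_pos by auto
  have fstC: "norm (fst (x n)) \<le> C" and sndC: "norm (snd (x n)) \<le> C" for n
    using C(1)[of n] norm_fst_le[of "fst (x n)" "snd (x n)"] norm_snd_le[of "snd (x n)" "fst (x n)"] by auto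
  have "\<forall>k. \<exists>F :: ('a, real) l2 set. finite F \<and> (\<forall>x\<in>H10 B.
     (norm (fst x))\<^sup>2 \<le> (\<Sum>w\<in>F. (fst x \<bullet> w)\<^sup>2) + inverse (real (Suc k)) * (norm (snd x))\<^sup>2)"
    by (intro allI friedrichs_inequality[OF B]) simp
  then obtain F :: "nat \<Rightarrow> ('a, real) l2 set" where F: "\<And>k. finite (F k)" "\<And>k x. x \<in> H10 B \<Longrightarrow>
     (norm (fst x))\<^sup>2 \<le> (\<Sum>w\<in>F k. (fst x \<bullet> w)\<^sup>2) + inverse (real (Suc k)) * (norm (snd x))\<^sup>2" by metis
  \<comment> \<open>The selection of the subsequence asks for one bound valid for all w; the factor,
    never zero, is undone afterwards.\<close>
  define f where "f n w = (fst (x n) \<bullet> w) / (norm w + 1)" for n w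
  have "norm (f n w) \<le> C" for n w
  proof -
    have "\<bar>fst (x n) \<bullet> w\<bar> \<le> C * norm w"
      using Cauchy_Schwarz_ineq2[of "fst (x n)" w] mult_right_mono[OF fstC, of "norm w" n] by simp
    also have "\<dots> \<le> C * (norm w + 1)" using C(2) by simp
    finally show ?thesis by (simp add: f_def abs_divide divide_le_eq add_pos_nonneg add.commute add_nonneg_pos)
  qed
  moreover have "countable (\<Union>k. F k)" by (simp add: F(1) countable_finite)
  ultimately obtain r :: "nat \<Rightarrow> nat" where r: "strict_mono r" "\<And>w. w \<in> (\<Union>k. F k) \<Longrightarrow> \<exists>l. (\<lambda>n. f (r n) w) \<longlonglongrightarrow> l"
    using function_convergent_subsequence[of "\<Union>k. F k" f C] by blast
  have "\<exists>l. (\<lambda>n. fst (x (r n)) \<bullet> w) \<longlonglongrightarrow> l" if w: "w \<in> (\<Union>k. F k)" for w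
  proof -
    obtain l where "(\<lambda>n. f (r n) w) \<longlonglongrightarrow> l" using r(2)[OF w] by blast
    then have "(\<lambda>n. (norm w + 1) * f (r n) w) \<longlonglongrightarrow> (norm w + 1) * l" by (intro tendsto_intros)
    moreover have "norm w + 1 \<noteq> 0" using norm_ge_zero[of w] by linarith
    ultimately show ?thesis by (auto simp: f_def)
  qed
  then obtain L where L: "\<And>w k. w \<in> F k \<Longrightarrow> (\<lambda>n. fst (x (r n)) \<bullet> w) \<longlonglongrightarrow> L w" by (metis UN_I UNIV_I)
  have "Cauchy (\<lambda>n. fst (x (r n)))"
  proof (rule metric_CauchyI)
    fix e :: real assume e: "e > 0"
    \<comment> \<open>Differences have gradients of norm at most 2 C, so the gradient term stays
      within e^2 / 2; the other half is left to the functionals.\<close>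
    obtain k where k: "inverse (real (Suc k)) < e\<^sup>2 / (8 * C\<^sup>2)"
      using reals_Archimedean[of "e\<^sup>2 / (8 * C\<^sup>2)"] e C(2) by auto
    define s where "s n = (\<Sum>w\<in>F k. (fst (x (r n)) \<bullet> w - L w)\<^sup>2)" for n
    have "s \<longlonglongrightarrow> (\<Sum>w\<in>F k. (L w - L w)\<^sup>2)"
      unfolding s_def by (intro tendsto_intros L)
    then have "eventually (\<lambda>n. s n < e\<^sup>2 / 8) sequentially"
      using e by (intro order_tendstoD(2)[where y=0]) auto
    then obtain N where N: "\<And>n. n \<ge> N \<Longrightarrow> s n < e\<^sup>2 / 8" unfolding eventually_sequentially by blast
    have "dist (fst (x (r m))) (fst (x (r n))) < e" if mn: "m \<ge> N" "n \<ge> N" for m n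
    proof -
      let ?y = "x (r m) - x (r n)"
      have "norm (snd ?y) \<le> 2 * C" using norm_triangle_ineq4[of "snd (x (r m))" "snd (x (r n))"] sndC[of "r m"] sndC[of "r n"] by simp
      then have "(norm (snd ?y))\<^sup>2 \<le> (2 * C)\<^sup>2" by (intro power_mono) auto
      then have "inverse (real (Suc k)) * (norm (snd ?y))\<^sup>2 \<le> e\<^sup>2 / (8 * C\<^sup>2) * (2 * C)\<^sup>2"
        using k e by (intro mult_mono) auto
      also have "\<dots> = e\<^sup>2 / 2" using C(2) by (simp add: power2_eq_square)
      finally have 1: "inverse (real (Suc k)) * (norm (snd ?y))\<^sup>2 \<le> e\<^sup>2 / 2" .
      have "(fst ?y \<bullet> w)\<^sup>2 \<le> 2 * (fst (x (r m)) \<bullet> w - L w)\<^sup>2 + 2 * (fst (x (r n)) \<bullet> w - L w)\<^sup>2" for w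
        using zero_le_power2[of "(fst (x (r m)) \<bullet> w - L w) + (fst (x (r n)) \<bullet> w - L w)"]
        by (simp add: inner_diff_left power2_eq_square algebra_simps)
      then have "(\<Sum>w\<in>F k. (fst ?y \<bullet> w)\<^sup>2) \<le> (\<Sum>w\<in>F k. 2 * (fst (x (r m)) \<bullet> w - L w)\<^sup>2 + 2 * (fst (x (r n)) \<bullet> w - L w)\<^sup>2)"
        by (rule sum_mono)
      also have "\<dots> = 2 * s m + 2 * s n" by (simp add: s_def sum.distrib sum_distrib_left)
      also have "\<dots> < e\<^sup>2 / 2" using N[OF mn(1)] N[OF mn(2)] by simp
      finally have "(norm (fst ?y))\<^sup>2 < e\<^sup>2"
        using 1 F(2)[OF subspace_diff[OF subspace_H10 x x], of "r m" "r n" k] by simp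
      then show ?thesis using e by (simp add: dist_norm power2_less_imp_less)
    qed
    then show "\<exists>M. \<forall>m\<ge>M. \<forall>n\<ge>M. dist (fst (x (r m))) (fst (x (r n))) < e" by blast
  qed
  with r(1) show ?thesis by blast
qed

section \<open>Dirichlet eigenvalues\<close>


lemma continuous_AE_zero:
  fixes f :: "'a::euclidean_space \<Rightarrow> real"
  assumes cont: "continuous_on UNIV f" and ae: "AE x in lborel. f x = 0"
  shows "f x = 0"
proof (rule ccontr)
  assume "f x \<noteq> 0"
  have op: "open {x. f x \<noteq> 0}" by (intro open_Collect_neq cont continuous_intros)
  have "AE x in lborel. x \<notin> {x. f x \<noteq> 0}" using ae by simp
  then have "{x. f x \<noteq> 0} \<in> null_sets lborel"
    using op by (subst AE_iff_null_sets) (auto simp: borel_open)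
  then have "negligible {x. f x \<noteq> 0}"
    using null_sets_completionI[of _ lborel] by (simp add: negligible_iff_null_sets)
  with op \<open>f x \<noteq> 0\<close> open_not_negligible show False by blast
qed

text \<open>Bumps at m distinct points, each vanishing at the other points, are independent by
  evaluation. Evaluation of the class is legitimate because a continuous function that is zero
  almost everywhere is zero.\<close>

lemma H10_infinite_dim:
  fixes \<Omega> :: "'a::euclidean_space set"
  assumes "open \<Omega>" "\<Omega> \<noteq> {}"
  shows "\<exists>x. (\<forall>i<m. x i \<in> H10 \<Omega>) \<and>
    (\<forall>c. (\<Sum>i<m. c i *\<^sub>R fst (x i)) = 0 \<longrightarrow> (\<forall>i<m::nat. c i = 0))"
proof -
  have "infinite \<Omega>" using assms finite_imp_not_open by blast
  then obtain T where T: "finite T" "card T = m" "T \<subseteq> \<Omega>"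
    using infinite_arbitrarily_large by blast
  obtain p where p: "bij_betw p {..<m} T"
    using ex_bij_betw_nat_finite[OF T(1)] T(2) by (auto simp: atLeast0LessThan)
  have pT: "p i \<in> T" if "i < m" for i using p that by (auto simp: bij_betw_def)
  have "\<exists>b. test_function (\<Omega> - (T - {p i})) b \<and> b (p i) = 1" if "i < m" for i
  proof -
    have "open (\<Omega> - (T - {p i}))" using assms T(1) by (intro open_Diff finite_imp_closed) auto
    moreover have "p i \<in> \<Omega> - (T - {p i})" using pT[OF that] T by auto
    ultimately show ?thesis using smooth_local_bump by metis
  qed
  then obtain b where b: "\<And>i. i < m \<Longrightarrow> test_function (\<Omega> - (T - {p i})) (b i)" "\<And>i. i < m \<Longrightarrow> b i (p i) = 1"
    by metis
  have bt: "test_function \<Omega> (b i)" if "i < m" for i using test_function_mono[OF b(1)[OF that]] by blast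
  show ?thesis
  proof (intro exI[of _ "\<lambda>i. (abs_l2 (b i), abs_l2 (grad (b i)))"] conjI allI impI)
    show "(abs_l2 (b i), abs_l2 (grad (b i))) \<in> H10 \<Omega>" if "i < m" for i
      by (rule test_in_H10[OF bt[OF that]])
  next
    fix c i assume c: "(\<Sum>i<m. c i *\<^sub>R fst (abs_l2 (b i), abs_l2 (grad (b i)))) = 0" and i: "i < m"
    define f where "f x = (\<Sum>i<m. c i *\<^sub>R b i x)" for x
    have sq: "square_integrable (\<lambda>x. c i *\<^sub>R b i x)" if "i < m" for i
      by (intro square_integrable_scaleR test_square_integrable[OF bt[OF that]])
    have "abs_l2 f = (\<Sum>i<m. abs_l2 (\<lambda>x. c i *\<^sub>R b i x))"
      unfolding f_def by (rule abs_l2_sum) (simp only: lessThan_iff sq)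
    also have "\<dots> = (\<Sum>i<m. c i *\<^sub>R abs_l2 (b i))"
      by (intro sum.cong refl abs_l2_scaleR test_square_integrable[OF bt]) simp
    finally have "abs_l2 f = abs_l2 (\<lambda>x. 0)" using c by (simp add: abs_l2_zero)
    moreover have "square_integrable f"
      unfolding f_def by (rule square_integrable_sum) (simp only: lessThan_iff sq)
    ultimately have "AE x in lborel. f x = 0"
      by (simp add: abs_l2_eq_iff square_integrable_zero)
    moreover have "continuous_on UNIV f" unfolding f_def
      by (intro continuous_on_sum continuous_on_scaleR continuous_on_const C_k_continuous[of 0] test_function_C_k[OF bt]) simp
    ultimately have "f (p i) = 0" using continuous_AE_zero by blast
    moreover have "f (p i) = (\<Sum>j<m. if j = i then c j else 0)"
      unfolding f_def
    proof (rule sum.cong)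
      fix j assume j: "j \<in> {..<m}"
      then have "b j (p i) = (if j = i then 1 else 0)"
        using b(2) test_function_outside[OF b(1), of j "p i"] pT[OF i] p i
        by (auto simp: bij_betw_def inj_on_def)
      then show "c j *\<^sub>R b j (p i) = (if j = i then c j else 0)" by simp
    qed simp
    ultimately show "c i = 0" using i by simp
  qed
qed

lemma compact_form_H10:
  assumes "open \<Omega>" "\<Omega> \<noteq> {}" "bounded \<Omega>"
  shows "compact_form (H10 \<Omega>)"
proof unfold_locales
  fix m :: nat
  show "\<exists>x. (\<forall>i<m. x i \<in> H10 \<Omega>) \<and> (\<forall>c. (\<Sum>i<m. c i *\<^sub>R fst (x i)) = 0 \<longrightarrow> (\<forall>i<m. c i = 0))"
    by (rule H10_infinite_dim[OF assms(1,2)])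
qed (rule subspace_H10 closed_H10 H10_compact[OF assms(3)] | assumption)+

section \<open>Agreement with the eigenvalues of the definitions\<close>

lemma H10_gradient_iff:
  "H10_gradient \<Omega> u g \<longleftrightarrow> square_integrable u \<and> square_integrable g \<and> (abs_l2 u, abs_l2 g) \<in> H10 \<Omega>"
proof (cases "square_integrable u \<and> square_integrable g")
  case True
  have conv: "(\<lambda>n. (abs_l2 (\<phi> n), abs_l2 (grad (\<phi> n)))) \<longlonglongrightarrow> (abs_l2 u, abs_l2 g) \<longleftrightarrow>
      (\<lambda>n. \<integral>x. (\<phi> n x - u x)\<^sup>2 \<partial>lborel) \<longlonglongrightarrow> 0 \<and>
      (\<lambda>n. \<integral>x. (norm (grad (\<phi> n) x - g x))\<^sup>2 \<partial>lborel) \<longlonglongrightarrow> 0"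
    if "\<And>n. test_function \<Omega> (\<phi> n)" for \<phi>
  proof -
    have "(\<lambda>n. (abs_l2 (\<phi> n), abs_l2 (grad (\<phi> n)))) \<longlonglongrightarrow> (abs_l2 u, abs_l2 g) \<longleftrightarrow>
      (\<lambda>n. abs_l2 (\<phi> n)) \<longlonglongrightarrow> abs_l2 u \<and> (\<lambda>n. abs_l2 (grad (\<phi> n))) \<longlonglongrightarrow> abs_l2 g"
      using tendsto_fst[of "\<lambda>n. (abs_l2 (\<phi> n), abs_l2 (grad (\<phi> n)))" "(abs_l2 u, abs_l2 g)" sequentially]
        tendsto_snd[of "\<lambda>n. (abs_l2 (\<phi> n), abs_l2 (grad (\<phi> n)))" "(abs_l2 u, abs_l2 g)" sequentially]
      by (auto intro: tendsto_Pair)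
    then show ?thesis
      using True tendsto_abs_l2_iff[of \<phi> u, OF test_square_integrable[OF that]]
        tendsto_abs_l2_iff[of "\<lambda>n. grad (\<phi> n)" g, OF grad_square_integrable[OF that]] by simp
  qed
  have "(abs_l2 u, abs_l2 g) \<in> H10 \<Omega> \<longleftrightarrow>
    (\<exists>\<phi>. (\<forall>n. test_function \<Omega> (\<phi> n)) \<and> (\<lambda>n. (abs_l2 (\<phi> n), abs_l2 (grad (\<phi> n)))) \<longlonglongrightarrow> (abs_l2 u, abs_l2 g))"
  proof
    assume "(abs_l2 u, abs_l2 g) \<in> H10 \<Omega>"
    then obtain X where X: "\<forall>n. X n \<in> {(abs_l2 \<phi>, abs_l2 (grad \<phi>)) |\<phi>. test_function \<Omega> \<phi>}"
       "X \<longlonglongrightarrow> (abs_l2 u, abs_l2 g)"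
      unfolding H10_def closure_sequential by (elim exE conjE)
    then have "\<forall>n. \<exists>\<phi>. test_function \<Omega> \<phi> \<and> X n = (abs_l2 \<phi>, abs_l2 (grad \<phi>))" by auto
    then obtain \<phi> where \<phi>: "\<And>n. test_function \<Omega> (\<phi> n)" "\<And>n. X n = (abs_l2 (\<phi> n), abs_l2 (grad (\<phi> n)))"
      by metis
    then have "X = (\<lambda>n. (abs_l2 (\<phi> n), abs_l2 (grad (\<phi> n))))" by blast
    then show "\<exists>\<phi>. (\<forall>n. test_function \<Omega> (\<phi> n)) \<and> (\<lambda>n. (abs_l2 (\<phi> n), abs_l2 (grad (\<phi> n)))) \<longlonglongrightarrow> (abs_l2 u, abs_l2 g)"
      using X(2) \<phi>(1) by blast
  next
    assume "\<exists>\<phi>. (\<forall>n. test_function \<Omega> (\<phi> n)) \<and> (\<lambda>n. (abs_l2 (\<phi> n), abs_l2 (grad (\<phi> n)))) \<longlonglongrightarrow> (abs_l2 u, abs_l2 g)"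
    then obtain \<phi> where \<phi>: "\<And>n. test_function \<Omega> (\<phi> n)"
      "(\<lambda>n. (abs_l2 (\<phi> n), abs_l2 (grad (\<phi> n)))) \<longlonglongrightarrow> (abs_l2 u, abs_l2 g)" by blast
    show "(abs_l2 u, abs_l2 g) \<in> H10 \<Omega>"
      by (rule closed_sequentially[OF closed_H10 _ \<phi>(2)]) (rule test_in_H10[OF \<phi>(1)])
  qed
  also have "\<dots> \<longleftrightarrow> H10_gradient \<Omega> u g"
  proof -
    have "((\<forall>n. test_function \<Omega> (\<phi> n)) \<and> (\<lambda>n. (abs_l2 (\<phi> n), abs_l2 (grad (\<phi> n)))) \<longlonglongrightarrow> (abs_l2 u, abs_l2 g)) \<longleftrightarrow>
      ((\<forall>n. test_function \<Omega> (\<phi> n)) \<and> (\<lambda>n. \<integral>x. (\<phi> n x - u x)\<^sup>2 \<partial>lborel) \<longlonglongrightarrow> 0 \<and>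
      (\<lambda>n. \<integral>x. (norm (grad (\<phi> n) x - g x))\<^sup>2 \<partial>lborel) \<longlonglongrightarrow> 0)" for \<phi>
      by (intro conj_cong refl conv) simp
    then show ?thesis using True by (simp only: H10_gradient_def simp_thms)
  qed
  finally show ?thesis using True by simp
qed (auto simp: H10_gradient_def)

text \<open>Both sides of the weak equation are continuous in the test pair, so its validity for
  test functions extends to the closure.\<close>

lemma dirichlet_eigenspace_iff:
  assumes "open \<Omega>" "\<Omega> \<noteq> {}" "bounded \<Omega>"
  shows "u \<in> dirichlet_eigenspace \<Omega> t \<longleftrightarrow>
    square_integrable u \<and> abs_l2 u \<in> compact_form.eigenspace (H10 \<Omega>) t"
proof -
  interpret compact_form "H10 \<Omega>" using compact_form_H10[OF assms] .
  have weak: "(\<forall>\<phi>. test_function \<Omega> \<phi> \<longrightarrow> (\<integral>x. g x \<bullet> grad \<phi> x \<partial>lborel) = t * (\<integral>x. u x * \<phi> x \<partial>lborel)) \<longleftrightarrow>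
     (\<forall>y\<in>H10 \<Omega>. abs_l2 g \<bullet> snd y = t * (abs_l2 u \<bullet> fst y))" (is "?L \<longleftrightarrow> ?R")
    if "square_integrable u" "square_integrable g" for g
  proof -
    have eq: "(\<integral>x. g x \<bullet> grad \<phi> x \<partial>lborel) = abs_l2 g \<bullet> abs_l2 (grad \<phi>)"
      "(\<integral>x. u x * \<phi> x \<partial>lborel) = abs_l2 u \<bullet> abs_l2 \<phi>" if "test_function \<Omega> \<phi>" for \<phi>
      using that \<open>square_integrable u\<close> \<open>square_integrable g\<close>
      by (simp_all add: inner_abs_l2 test_square_integrable grad_square_integrable)
    show ?thesis
    proof
      assume L: ?L
      have "H10 \<Omega> \<subseteq> {y. abs_l2 g \<bullet> snd y = t * (abs_l2 u \<bullet> fst y)}"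
        by (rule H10_closed_induct) (use L eq in \<open>auto intro!: closed_Collect_eq continuous_intros\<close>)
      then show ?R by blast
    next
      assume ?R
      then show ?L using eq test_in_H10 by fastforce
    qed
  qed
  show ?thesis
  proof
    assume "u \<in> dirichlet_eigenspace \<Omega> t"
    then obtain g where g: "square_integrable u" "square_integrable g" "(abs_l2 u, abs_l2 g) \<in> H10 \<Omega>"
      "\<forall>\<phi>. test_function \<Omega> \<phi> \<longrightarrow> (\<integral>x. g x \<bullet> grad \<phi> x \<partial>lborel) = t * (\<integral>x. u x * \<phi> x \<partial>lborel)"
      by (auto simp: dirichlet_eigenspace_def H10_gradient_iff)
    then show "square_integrable u \<and> abs_l2 u \<in> eigenspace t"
      using weak[of g] unfolding eigenspace_def by blast
  next
    assume u: "square_integrable u \<and> abs_l2 u \<in> eigenspace t"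
    then obtain g where g: "(abs_l2 u, g) \<in> H10 \<Omega>" "\<forall>y\<in>H10 \<Omega>. g \<bullet> snd y = t * (abs_l2 u \<bullet> fst y)"
      unfolding eigenspace_def by blast
    then have "H10_gradient \<Omega> u (rep_l2 g)"
      using u by (simp add: H10_gradient_iff square_integrable_rep abs_rep_l2)
    moreover have "(\<forall>\<phi>. test_function \<Omega> \<phi> \<longrightarrow> (\<integral>x. rep_l2 g x \<bullet> grad \<phi> x \<partial>lborel) = t * (\<integral>x. u x * \<phi> x \<partial>lborel))"
      using weak[of "rep_l2 g"] u g by (simp add: square_integrable_rep abs_rep_l2)
    ultimately show "u \<in> dirichlet_eigenspace \<Omega> t"
      unfolding dirichlet_eigenspace_def by (intro CollectI exI[of _ "rep_l2 g"] conjI)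
  qed
qed

lemma ae_independent_iff:
  assumes "\<And>i. i < m \<Longrightarrow> square_integrable (f i)"
  shows "ae_independent m f \<longleftrightarrow> (\<forall>c. (\<Sum>i<m. c i *\<^sub>R abs_l2 (f i)) = 0 \<longrightarrow> (\<forall>i<m. c i = 0))"
proof -
  have "(AE x in lborel. (\<Sum>i<m. c i * f i x) = 0) \<longleftrightarrow> (\<Sum>i<m. c i *\<^sub>R abs_l2 (f i)) = 0" for c
  proof -
    have sq: "square_integrable (\<lambda>x. c i *\<^sub>R f i x)" if "i < m" for i
      by (rule square_integrable_scaleR[OF assms[OF that]])
    have "(\<Sum>i<m. c i *\<^sub>R abs_l2 (f i)) = (\<Sum>i<m. abs_l2 (\<lambda>x. c i *\<^sub>R f i x))"
      by (intro sum.cong refl abs_l2_scaleR[symmetric] assms) simp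
    also have "\<dots> = abs_l2 (\<lambda>x. \<Sum>i<m. c i *\<^sub>R f i x)"
      by (rule abs_l2_sum[symmetric]) (simp only: lessThan_iff sq)
    finally have "(\<Sum>i<m. c i *\<^sub>R abs_l2 (f i)) = abs_l2 (\<lambda>x. \<Sum>i<m. c i *\<^sub>R f i x)" .
    moreover have "square_integrable (\<lambda>x. \<Sum>i<m. c i *\<^sub>R f i x)"
      by (rule square_integrable_sum) (simp only: lessThan_iff sq)
    ultimately show ?thesis
      using abs_l2_eq_iff[of "\<lambda>x. \<Sum>i<m. c i *\<^sub>R f i x" "\<lambda>x. 0"]
      by (simp add: square_integrable_zero abs_l2_zero)
  qed
  then show ?thesis by (simp add: ae_independent_def)
qed

lemma dirichlet_multiplicity_eq:
  assumes \<Omega>: "open \<Omega>" "\<Omega> \<noteq> {}" "bounded \<Omega>" and basis: "compact_form.eigenbasis (H10 \<Omega>) e l"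
  shows "dirichlet_multiplicity \<Omega> t = enat (card {k. l k = t})"
proof -
  interpret compact_form "H10 \<Omega>" using compact_form_H10[OF \<Omega>] .
  have "{m. \<exists>f. (\<forall>i<m. f i \<in> dirichlet_eigenspace \<Omega> t) \<and> ae_independent m f} =
    {m. \<exists>f. (\<forall>i<m. f i \<in> eigenspace t) \<and> (\<forall>c. (\<Sum>i<m. c i *\<^sub>R f i) = 0 \<longrightarrow> (\<forall>i<m. c i = 0))}" (is "?A = ?B")
  proof (intro equalityI subsetI)
    fix m assume "m \<in> ?A"
    then obtain f where f: "\<And>i. i < m \<Longrightarrow> f i \<in> dirichlet_eigenspace \<Omega> t" "ae_independent m f" by blast
    then have "\<And>i. i < m \<Longrightarrow> square_integrable (f i)" by (simp add: dirichlet_eigenspace_iff[OF \<Omega>])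
    then have "\<forall>c. (\<Sum>i<m. c i *\<^sub>R abs_l2 (f i)) = 0 \<longrightarrow> (\<forall>i<m. c i = 0)"
      using f(2) by (simp only: ae_independent_iff)
    moreover have "\<forall>i<m. abs_l2 (f i) \<in> eigenspace t" using f(1) by (simp add: dirichlet_eigenspace_iff[OF \<Omega>])
    ultimately show "m \<in> ?B" by (intro CollectI exI[of _ "\<lambda>i. abs_l2 (f i)"] conjI)
  next
    fix m assume "m \<in> ?B"
    then obtain f where f: "\<And>i. i < m \<Longrightarrow> f i \<in> eigenspace t"
      "\<forall>c. (\<Sum>i<m. c i *\<^sub>R f i) = 0 \<longrightarrow> (\<forall>i<m. c i = 0)" by blast
    then have "ae_independent m (\<lambda>i. rep_l2 (f i))"
      by (simp add: ae_independent_iff square_integrable_rep abs_rep_l2)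
    moreover have "\<forall>i<m. rep_l2 (f i) \<in> dirichlet_eigenspace \<Omega> t"
      using f(1) by (simp add: dirichlet_eigenspace_iff[OF \<Omega>] square_integrable_rep abs_rep_l2)
    ultimately show "m \<in> ?A" by (intro CollectI exI[of _ "\<lambda>i. rep_l2 (f i)"] conjI)
  qed
  then show ?thesis unfolding dirichlet_multiplicity_def using multiplicity_eq[OF basis] by simp
qed

text \<open>An eigenbasis provides one spectrum and \<open>counting_le\<close> in both directions
  excludes any other value, so the definite description in \<open>dirichlet_eigenvalue\<close>
  denotes.\<close>

lemma dirichlet_eigenvalue_eq:
  assumes \<Omega>: "open \<Omega>" "\<Omega> \<noteq> {}" "bounded \<Omega>" and basis: "compact_form.eigenbasis (H10 \<Omega>) e l" and k: "1 \<le> k"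
  shows "dirichlet_eigenvalue k \<Omega> = l (k - 1)"
proof -
  interpret compact_form "H10 \<Omega>" using compact_form_H10[OF \<Omega>] .
  \<comment> \<open>The abstract eigenvalues are numbered from 0, the Dirichlet eigenvalues from
    1.\<close>
  define L where "L k = l (k - 1)" for k
  have eq: "{k \<in> {1..}. L k = t} = Suc ` {k. l k = t}" for t
  proof (intro equalityI subsetI)
    fix k assume "k \<in> {k \<in> {1..}. L k = t}"
    then show "k \<in> Suc ` {k. l k = t}" by (intro image_eqI[of _ _ "k - 1"]) (auto simp: L_def)
  qed (auto simp: L_def)
  have fin: "finite {k \<in> {1..}. L k = t}" for t
    unfolding eq by (intro finite_imageI finite_eigenvalue[OF basis])
  have card: "card {k \<in> {1..}. L k = t} = card {k. l k = t}" for t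
    unfolding eq by (rule card_image) simp
  have mono: "mono_on {1..} L"
    using basis by (auto simp: L_def eigenbasis_def mono_def intro!: mono_onI)
  have spec: "dirichlet_spectrum \<Omega> L"
    unfolding dirichlet_spectrum_def dirichlet_multiplicity_eq[OF \<Omega> basis]
    by (intro conjI allI mono fin) (simp only: card)
  show ?thesis
    unfolding dirichlet_eigenvalue_def
  proof (rule the_equality)
    show "\<exists>l'. dirichlet_spectrum \<Omega> l' \<and> l' k = l (k - 1)" using spec by (auto simp: L_def)
    fix t assume "\<exists>l'. dirichlet_spectrum \<Omega> l' \<and> l' k = t"
    then obtain l' where l': "dirichlet_spectrum \<Omega> l'" "l' k = t" by blast
    then have 1: "mono_on {1..} l'" "\<And>t. finite {k \<in> {1..}. l' k = t}"
      "\<And>t. card {k \<in> {1..}. l' k = t} = card {k \<in> {1..}. L k = t}"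
      using spec unfolding dirichlet_spectrum_def by (metis, metis, metis enat.inject)
    have "l' k = L k"
      using counting_le[OF mono 1(1) fin 1(2) 1(3)[symmetric] k] counting_le[OF 1(1) mono 1(2) fin 1(3) k] by simp
    then show "t = l (k - 1)" using l'(2) by (simp add: L_def)
  qed
qed

text \<open>With \<open>dirichlet_eigenvectors\<close> this is the min-max principle in the form
  used from here on: eigenvalues enter the remaining proof only through these two bounds.
  Orthonormality lets coefficients replace norms.\<close>

lemma dirichlet_eigenvalue_le:
  assumes \<Omega>: "open \<Omega>" "\<Omega> \<noteq> {}" "bounded \<Omega>"
    and x: "\<And>i. i \<le> k \<Longrightarrow> x i \<in> H10 \<Omega>"
    and orth: "\<And>i j. i \<le> k \<Longrightarrow> j \<le> k \<Longrightarrow> fst (x i) \<bullet> fst (x j) = (if i = j then 1 else 0)"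
    and rayleigh: "\<And>c. (norm (\<Sum>i\<le>k. c i *\<^sub>R snd (x i)))\<^sup>2 \<le> T * (\<Sum>i\<le>k. (c i)\<^sup>2)"
  shows "dirichlet_eigenvalue (Suc k) \<Omega> \<le> T"
proof -
  interpret compact_form "H10 \<Omega>" using compact_form_H10[OF \<Omega>] .
  obtain e l where basis: "eigenbasis e l" using exists_eigenbasis by blast
  have inner: "(\<Sum>i\<le>k. c i *\<^sub>R fst (x i)) \<bullet> fst (x j) = c j" if "j \<le> k" for c j
  proof -
    have "(\<Sum>i\<le>k. c i *\<^sub>R fst (x i)) \<bullet> fst (x j) = (\<Sum>i\<le>k. if i = j then c i else 0)"
      unfolding inner_sum_left by (rule sum.cong) (use that in \<open>auto simp: orth\<close>)
    then show ?thesis using that by simp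
  qed
  have "(norm (\<Sum>i\<le>k. c i *\<^sub>R fst (x i)))\<^sup>2 = (\<Sum>i\<le>k. (c i)\<^sup>2)" for c
    unfolding power2_norm_eq_inner inner_sum_right by (simp add: inner power2_eq_square)
  then have ray: "(norm (\<Sum>i\<le>k. c i *\<^sub>R snd (x i)))\<^sup>2 \<le> T * (norm (\<Sum>i\<le>k. c i *\<^sub>R fst (x i)))\<^sup>2" for c
    using rayleigh by simp
  have indep: "\<forall>i\<le>k. c i = 0" if "(\<Sum>i\<le>k. c i *\<^sub>R fst (x i)) = 0" for c
    using inner[of _ c] unfolding that by simp
  have "l k \<le> T"
    using eigenvalue_le_rayleigh[OF basis, of k x T] x indep ray by blast
  then show ?thesis using dirichlet_eigenvalue_eq[OF \<Omega> basis, of "Suc k"] by simp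
qed

lemma dirichlet_eigenvectors:
  assumes \<Omega>: "open \<Omega>" "\<Omega> \<noteq> {}" "bounded \<Omega>"
  shows "\<exists>x. (\<forall>i. x i \<in> H10 \<Omega>) \<and> (\<forall>i j. fst (x i) \<bullet> fst (x j) = (if i = j then 1 else 0)) \<and>
    (\<forall>c. (norm (\<Sum>i\<le>k. c i *\<^sub>R snd (x i)))\<^sup>2 \<le> dirichlet_eigenvalue (Suc k) \<Omega> * (\<Sum>i\<le>k. (c i)\<^sup>2))"
proof -
  interpret compact_form "H10 \<Omega>" using compact_form_H10[OF \<Omega>] .
  obtain e l where basis: "eigenbasis e l" using exists_eigenbasis by blast
  have "dirichlet_eigenvalue (Suc k) \<Omega> = l k"
    using dirichlet_eigenvalue_eq[OF \<Omega> basis, of "Suc k"] by simp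
  then show ?thesis
    using basis_in[OF basis] basis_orth[OF basis] rayleigh_basis[OF basis, of _ k]
    by (intro exI[of _ e]) simp
qed

section \<open>Dilations and support\<close>


definition bounded_op :: "real \<Rightarrow> (('a::euclidean_space \<Rightarrow> 'b::euclidean_space) \<Rightarrow> 'a \<Rightarrow> 'c::euclidean_space) \<Rightarrow> bool" where
  "bounded_op M T \<longleftrightarrow>
     (\<forall>f. square_integrable f \<longrightarrow> square_integrable (T f) \<and> norm (abs_l2 (T f)) \<le> M * norm (abs_l2 f)) \<and>
     (\<forall>f g. T (\<lambda>x. f x + g x) = (\<lambda>x. T f x + T g x)) \<and>
     (\<forall>c f. T (\<lambda>x. c *\<^sub>R f x) = (\<lambda>x. c *\<^sub>R T f x))"

definition l2_op :: "(('a::euclidean_space \<Rightarrow> 'b::euclidean_space) \<Rightarrow> 'a \<Rightarrow> 'c::euclidean_space) \<Rightarrow> ('a, 'b) l2 \<Rightarrow> ('a, 'c) l2" where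
  "l2_op T x = abs_l2 (T (rep_l2 x))"

lemma bounded_op_square_integrable: "bounded_op M T \<Longrightarrow> square_integrable f \<Longrightarrow> square_integrable (T f)"
  by (simp add: bounded_op_def)

lemma bounded_op_add: "bounded_op M T \<Longrightarrow> T (\<lambda>x. f x + g x) = (\<lambda>x. T f x + T g x)"
  by (simp add: bounded_op_def)

lemma bounded_op_scale: "bounded_op M T \<Longrightarrow> T (\<lambda>x. c *\<^sub>R f x) = (\<lambda>x. c *\<^sub>R T f x)"
  by (simp add: bounded_op_def)

text \<open>Two representatives differ by a null function; by linearity and the norm bound the image
  of the difference has norm zero, so the induced operator does not depend on the
  representative.\<close>

lemma l2_op_abs:
  assumes T: "bounded_op M T" and f: "square_integrable f"
  shows "l2_op T (abs_l2 f) = abs_l2 (T f)"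
proof -
  let ?g = "rep_l2 (abs_l2 f)"
  have g: "square_integrable ?g" by (rule square_integrable_rep)
  have "T (\<lambda>x. ?g x + (-1) *\<^sub>R f x) = (\<lambda>x. T ?g x + T (\<lambda>x. (-1) *\<^sub>R f x) x)"
    by (rule bounded_op_add[OF T, of ?g "\<lambda>x. (-1) *\<^sub>R f x"])
  also have "T (\<lambda>x. (-1) *\<^sub>R f x) = (\<lambda>x. (-1) *\<^sub>R T f x)"
    by (rule bounded_op_scale[OF T])
  finally have "T (\<lambda>x. ?g x - f x) = (\<lambda>x. T ?g x - T f x)" by simp
  moreover have "norm (abs_l2 (T (\<lambda>x. ?g x - f x))) \<le> M * norm (abs_l2 (\<lambda>x. ?g x - f x))"
    using T square_integrable_diff[OF g f] by (simp add: bounded_op_def)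
  ultimately have "norm (abs_l2 (T ?g) - abs_l2 (T f)) \<le> M * norm (abs_l2 ?g - abs_l2 f)"
    using f g by (simp add: abs_l2_diff bounded_op_square_integrable[OF T])
  then show ?thesis by (simp add: l2_op_def abs_rep_l2)
qed

lemma bounded_linear_l2_op:
  assumes T: "bounded_op M T"
  shows "bounded_linear (l2_op T)"
proof (rule bounded_linear_intro[where K=M])
  fix x y :: "('a, 'b) l2" and c :: real
  note sq = square_integrable_rep[of x] square_integrable_rep[of y]
  note Tsq = bounded_op_square_integrable[OF T sq(1)] bounded_op_square_integrable[OF T sq(2)]
  have "l2_op T (x + y) = abs_l2 (T (\<lambda>t. rep_l2 x t + rep_l2 y t))"
    using l2_op_abs[OF T square_integrable_add[OF sq]] by (simp add: abs_l2_add sq abs_rep_l2)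
  also have "T (\<lambda>t. rep_l2 x t + rep_l2 y t) = (\<lambda>t. T (rep_l2 x) t + T (rep_l2 y) t)"
    using T unfolding bounded_op_def by blast
  finally show "l2_op T (x + y) = l2_op T x + l2_op T y" by (simp add: abs_l2_add Tsq l2_op_def)
  have "l2_op T (c *\<^sub>R x) = abs_l2 (T (\<lambda>t. c *\<^sub>R rep_l2 x t))"
    using l2_op_abs[OF T square_integrable_scaleR[OF sq(1), of c]] by (simp add: abs_l2_scaleR sq abs_rep_l2)
  also have "T (\<lambda>t. c *\<^sub>R rep_l2 x t) = (\<lambda>t. c *\<^sub>R T (rep_l2 x) t)"
    using T unfolding bounded_op_def by blast
  finally show "l2_op T (c *\<^sub>R x) = c *\<^sub>R l2_op T x" by (simp add: abs_l2_scaleR Tsq l2_op_def)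
  show "norm (l2_op T x) \<le> norm x * M"
    using T sq(1) unfolding bounded_op_def l2_op_def by (metis abs_rep_l2 mult.commute)
qed

lemma bounded_op_pointwise:
  fixes T :: "'a::euclidean_space \<Rightarrow> 'b::euclidean_space \<Rightarrow> 'c::euclidean_space"
  assumes lin: "\<And>x. linear (T x)" and bd: "\<And>x y. norm (T x y) \<le> M * norm y" and M: "M \<ge> 0"
    and meas: "\<And>f. f \<in> borel_measurable borel \<Longrightarrow> (\<lambda>x. T x (f x)) \<in> borel_measurable borel"
  shows "bounded_op M (\<lambda>f x. T x (f x))"
proof -
  have "square_integrable (\<lambda>x. T x (f x)) \<and> norm (abs_l2 (\<lambda>x. T x (f x))) \<le> M * norm (abs_l2 f)"
    if f: "square_integrable f" for f
  proof -
    have m: "(\<lambda>x. T x (f x)) \<in> borel_measurable lborel"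
      using f meas by (simp add: square_integrable_def)
    have le: "(norm (T x (f x)))\<^sup>2 \<le> M\<^sup>2 * (norm (f x))\<^sup>2" for x
      using power_mono[OF bd[of x "f x"] norm_ge_zero, of 2] by (simp add: power_mult_distrib)
    have i: "integrable lborel (\<lambda>x. M\<^sup>2 * (norm (f x))\<^sup>2)"
      using f by (simp add: square_integrable_def)
    have i2: "integrable lborel (\<lambda>x. (norm (T x (f x)))\<^sup>2)"
      by (rule Bochner_Integration.integrable_bound[OF i]) (use m le in \<open>auto intro!: borel_measurable_power borel_measurable_norm\<close>)
    then have sq: "square_integrable (\<lambda>x. T x (f x))" using m by (simp add: square_integrable_def)
    have "(norm (abs_l2 (\<lambda>x. T x (f x))))\<^sup>2 \<le> (M * norm (abs_l2 f))\<^sup>2"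
      unfolding power_mult_distrib norm_abs_l2[OF f] norm_abs_l2[OF sq]
      using integral_mono[OF i2 i le] by simp
    then show ?thesis using sq M by (auto intro: power2_le_imp_le)
  qed
  then show ?thesis
    unfolding bounded_op_def by (auto simp: linear_add[OF lin] linear_cmul[OF lin])
qed

lemma bounded_op_mult:
  fixes \<eta> :: "'a::euclidean_space \<Rightarrow> real"
  assumes "\<eta> \<in> borel_measurable borel" "\<And>x. \<bar>\<eta> x\<bar> \<le> M"
  shows "bounded_op M (\<lambda>(f :: 'a \<Rightarrow> 'b::euclidean_space) x. \<eta> x *\<^sub>R f x)"
proof (rule bounded_op_pointwise)
  show "linear (\<lambda>y :: 'b. \<eta> x *\<^sub>R y)" for x by (simp add: linear_iff scaleR_add_right)
  show "norm (\<eta> x *\<^sub>R y) \<le> M * norm y" for x and y :: 'b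
    using assms(2)[of x] by (simp add: mult_right_mono)
  show "M \<ge> 0" using assms(2)[of 0] by linarith
qed (use assms in measurable)

lemma bounded_op_scaleR_vector:
  fixes w :: "'a::euclidean_space \<Rightarrow> 'b::euclidean_space"
  assumes "w \<in> borel_measurable borel" "\<And>x. norm (w x) \<le> M"
  shows "bounded_op M (\<lambda>(f :: 'a \<Rightarrow> real) x. f x *\<^sub>R w x)"
proof (rule bounded_op_pointwise)
  show "linear (\<lambda>y. y *\<^sub>R w x)" for x by (simp add: linear_iff scaleR_add_left)
  show "norm (y *\<^sub>R w x) \<le> M * norm y" for x y
    using mult_left_mono[OF assms(2)[of x] abs_ge_zero[of y]] by (simp add: mult.commute)
  show "M \<ge> 0" using assms(2)[of 0] norm_ge_zero[of "w 0"] by linarith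
  show "(\<lambda>x. f x *\<^sub>R w x) \<in> borel_measurable borel" if "f \<in> borel_measurable borel" for f
    by (rule borel_measurable_scaleR[OF that assms(1)])
qed

lemma bounded_op_indicator:
  assumes "U \<in> sets borel"
  shows "bounded_op 1 (\<lambda>(f :: 'a::euclidean_space \<Rightarrow> 'b::euclidean_space) x. indicator U x *\<^sub>R f x)"
  by (rule bounded_op_mult) (use assms in \<open>auto simp: indicator_def\<close>)

lemma integral_affine:
  fixes f :: "'a::euclidean_space \<Rightarrow> real"
  assumes f: "integrable lborel f" and s: "s \<noteq> 0"
  shows "integrable lborel (\<lambda>x. f (s *\<^sub>R x + c))"
    "(\<integral>x. f (s *\<^sub>R x + c) \<partial>lborel) = (\<integral>x. f x \<partial>lborel) / \<bar>s\<bar> ^ DIM('a)"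
proof -
  have [measurable]: "f \<in> borel_measurable borel" using f by simp
  have eq: "lborel = density (distr lborel borel (\<lambda>x::'a. c + s *\<^sub>R x)) (\<lambda>_. ennreal (\<bar>s\<bar> ^ DIM('a)))"
    using lborel_affine[OF s, of c] by (simp add: ennreal_power)
  have "integrable (distr lborel borel (\<lambda>x::'a. c + s *\<^sub>R x)) (\<lambda>x. \<bar>s\<bar> ^ DIM('a) *\<^sub>R f x)"
    using f by (subst (asm) eq, subst (asm) integrable_density) auto
  then have "integrable lborel (\<lambda>x. \<bar>s\<bar> ^ DIM('a) *\<^sub>R f (c + s *\<^sub>R x))"
    by (subst (asm) integrable_distr_eq) auto
  then show "integrable lborel (\<lambda>x. f (s *\<^sub>R x + c))" using s by (simp add: add.commute)
  have "(\<integral>x. f x \<partial>lborel) = (\<integral>x. \<bar>s\<bar> ^ DIM('a) *\<^sub>R f x \<partial>(distr lborel borel (\<lambda>x::'a. c + s *\<^sub>R x)))"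
    by (subst eq, subst integral_density) auto
  also have "\<dots> = (\<integral>x. \<bar>s\<bar> ^ DIM('a) *\<^sub>R f (c + s *\<^sub>R x) \<partial>lborel)"
    by (rule integral_distr) auto
  finally show "(\<integral>x. f (s *\<^sub>R x + c) \<partial>lborel) = (\<integral>x. f x \<partial>lborel) / \<bar>s\<bar> ^ DIM('a)"
    using s by (simp add: add.commute)
qed

text \<open>Composition with an affine map. For \<open>c = (1 - s) *\<^sub>R p\<close> the map is
  the dilation about p, and composition with a factor s above 1 contracts supports towards p; s = 1
  gives the translations.\<close>

definition pull :: "real \<Rightarrow> 'a \<Rightarrow> ('a::euclidean_space \<Rightarrow> 'b) \<Rightarrow> 'a \<Rightarrow> 'b" where
  "pull s c f x = f (s *\<^sub>R x + c)"

lemma square_integrable_pull: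
  assumes f: "square_integrable f" and s: "s \<noteq> 0"
  shows "square_integrable (pull s c f)"
proof -
  have "f \<in> borel_measurable borel" using f by (simp add: square_integrable_def)
  then have "(\<lambda>x. f (s *\<^sub>R x + c)) \<in> borel_measurable borel" by measurable
  then show ?thesis
    using f integral_affine(1)[OF _ s, of "\<lambda>x. (norm (f x))\<^sup>2" c]
    by (simp add: square_integrable_def pull_def[abs_def])
qed

lemma inner_pull:
  fixes f g :: "'a::euclidean_space \<Rightarrow> 'b::euclidean_space"
  assumes "square_integrable f" "square_integrable g" "s \<noteq> 0"
  shows "abs_l2 (pull s c f) \<bullet> abs_l2 (pull s c g) = (abs_l2 f \<bullet> abs_l2 g) / \<bar>s\<bar> ^ DIM('a)"
  using integral_affine(2)[OF square_integrable_inner[OF assms(1,2)] assms(3), of c] assms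
  by (simp add: inner_abs_l2 square_integrable_pull pull_def)

lemma bounded_op_pull:
  assumes s: "s \<noteq> 0"
  shows "bounded_op (1 / sqrt (\<bar>s\<bar> ^ DIM('a))) (pull s c :: ('a::euclidean_space \<Rightarrow> 'b::euclidean_space) \<Rightarrow> _)"
  using s unfolding bounded_op_def
  by (auto simp: square_integrable_pull norm_eq_sqrt_inner inner_pull real_sqrt_divide) (auto simp: pull_def fun_eq_iff)

lemma inner_l2_op_pull:
  fixes x y :: "('a::euclidean_space, 'b::euclidean_space) l2"
  assumes "s \<noteq> 0"
  shows "l2_op (pull s c) x \<bullet> l2_op (pull s c) y = (x \<bullet> y) / \<bar>s\<bar> ^ DIM('a)"
  unfolding l2_op_def using assms by (simp add: inner_pull square_integrable_rep abs_rep_l2)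

text \<open>The factor s in front of the gradient is the chain rule; the rest is continuity of both
  sides on pairs.\<close>

lemma H10_pull:
  fixes \<Omega> :: "'a::euclidean_space set"
  assumes x: "x \<in> H10 \<Omega>" and s: "s \<noteq> 0"
  shows "(l2_op (pull s c) (fst x), s *\<^sub>R l2_op (pull s c) (snd x)) \<in> H10 {x. s *\<^sub>R x + c \<in> \<Omega>}"
proof -
  note bl = bounded_linear_l2_op[OF bounded_op_pull[OF s]]
  have "H10 \<Omega> \<subseteq> (\<lambda>x. (l2_op (pull s c) (fst x), s *\<^sub>R l2_op (pull s c) (snd x))) -` H10 {x. s *\<^sub>R x + c \<in> \<Omega>}"
  proof (rule H10_closed_induct)
    show "closed ((\<lambda>x. (l2_op (pull s c) (fst x), s *\<^sub>R l2_op (pull s c) (snd x))) -` H10 {x. s *\<^sub>R x + c \<in> \<Omega>})"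
      by (rule closed_vimage[OF closed_H10])
         (intro continuous_intros bounded_linear.continuous_on[OF bl])
    fix \<phi> assume \<phi>: "test_function \<Omega> \<phi>"
    have "grad (pull s c \<phi>) = (\<lambda>x. s *\<^sub>R pull s c (grad \<phi>) x)"
      using grad_affine[OF \<phi>, of s c] by (simp add: pull_def[abs_def] fun_eq_iff)
    then have "abs_l2 (grad (pull s c \<phi>)) = s *\<^sub>R l2_op (pull s c) (abs_l2 (grad \<phi>))"
      by (simp add: l2_op_abs[OF bounded_op_pull[OF s]] grad_square_integrable[OF \<phi>] abs_l2_scaleR square_integrable_pull s)
    moreover have "abs_l2 (pull s c \<phi>) = l2_op (pull s c) (abs_l2 \<phi>)"
      by (simp add: l2_op_abs[OF bounded_op_pull[OF s]] test_square_integrable[OF \<phi>])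
    moreover have "test_function {x. s *\<^sub>R x + c \<in> \<Omega>} (pull s c \<phi>)"
      using test_function_affine[OF \<phi> s, of c] by (simp add: pull_def[abs_def])
    ultimately show "(abs_l2 \<phi>, abs_l2 (grad \<phi>)) \<in> (\<lambda>x. (l2_op (pull s c) (fst x), s *\<^sub>R l2_op (pull s c) (snd x))) -` H10 {x. s *\<^sub>R x + c \<in> \<Omega>}"
      using test_in_H10 by fastforce
  qed
  with x show ?thesis by blast
qed

section \<open>Vanishing almost everywhere on a set\<close>

definition vanishes_on :: "'a set \<Rightarrow> ('a::euclidean_space, 'b::euclidean_space) l2 \<Rightarrow> bool" where
  "vanishes_on U f \<longleftrightarrow> (AE x in lborel. x \<in> U \<longrightarrow> rep_l2 f x = 0)"

text \<open>As the kernel of multiplication by an indicator, vanishing on a Borel set is a closed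
  linear condition, so it passes to convex combinations and to limits.\<close>

lemma vanishes_on_iff:
  assumes "U \<in> sets borel"
  shows "vanishes_on U f \<longleftrightarrow> l2_op (\<lambda>f x. indicator U x *\<^sub>R f x) f = 0"
proof -
  have "l2_op (\<lambda>f x. indicator U x *\<^sub>R f x) f = 0 \<longleftrightarrow> (AE x in lborel. indicator U x *\<^sub>R rep_l2 f x = 0)"
    unfolding l2_op_def abs_l2_zero[symmetric]
    by (rule abs_l2_eq_iff) (auto intro: square_integrable_zero bounded_op_square_integrable[OF bounded_op_indicator[OF assms]] square_integrable_rep)
  moreover have "(\<lambda>x. indicator U x *\<^sub>R rep_l2 f x = 0) = (\<lambda>x. x \<in> U \<longrightarrow> rep_l2 f x = 0)"
    by (auto simp: indicator_def)
  ultimately show ?thesis by (simp only: vanishes_on_def)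
qed

lemma vanishes_on_abs:
  assumes "square_integrable f" "\<And>x. x \<in> U \<Longrightarrow> f x = 0"
  shows "vanishes_on U (abs_l2 f)"
  unfolding vanishes_on_def using rep_abs_l2[OF assms(1)] by eventually_elim (use assms(2) in auto)

text \<open>Only countably many null sets may be united; this is why the limit set is later
  described through a countable basis.\<close>

lemma vanishes_on_Un:
  assumes "\<And>U. U \<in> \<U> \<Longrightarrow> vanishes_on U f" "countable \<U>"
  shows "vanishes_on (\<Union>\<U>) f"
proof -
  have "AE x in lborel. \<forall>U\<in>\<U>. x \<in> U \<longrightarrow> rep_l2 f x = 0"
    using assms by (subst AE_ball_countable) (auto simp: vanishes_on_def)
  then show ?thesis unfolding vanishes_on_def by eventually_elim auto
qed

lemma vanishes_on_mono: "vanishes_on U f \<Longrightarrow> V \<subseteq> U \<Longrightarrow> vanishes_on V f"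
  unfolding vanishes_on_def by (auto elim: eventually_mono)

lemma closed_vanishes_on:
  assumes "U \<in> sets borel"
  shows "closed {f. vanishes_on U f}"
  unfolding vanishes_on_iff[OF assms]
  by (intro closed_Collect_eq bounded_linear.continuous_on[OF bounded_linear_l2_op[OF bounded_op_indicator[OF assms]]] continuous_on_const continuous_on_id)

lemma subspace_vanishes_on:
  assumes "U \<in> sets borel"
  shows "subspace {f. vanishes_on U f}"
proof -
  note lin = bounded_linear.linear[OF bounded_linear_l2_op[OF bounded_op_indicator[OF assms]]]
  show ?thesis
    by (simp add: vanishes_on_iff[OF assms] subspace_def linear_0[OF lin] linear_add[OF lin] linear_cmul[OF lin])
qed

lemma H10_vanishes:
  fixes \<Omega> :: "'a::euclidean_space set"
  assumes U: "U \<in> sets borel" "U \<inter> \<Omega> = {}" and x: "x \<in> H10 \<Omega>"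
  shows "vanishes_on U (fst x)" "vanishes_on U (snd x)"
proof -
  have "H10 \<Omega> \<subseteq> {f. vanishes_on U f} \<times> {f. vanishes_on U f}"
  proof (rule H10_closed_induct)
    show "closed ({f :: ('a, real) l2. vanishes_on U f} \<times> {f :: ('a, 'a) l2. vanishes_on U f})"
      by (intro closed_Times closed_vanishes_on U)
    fix \<phi> assume \<phi>: "test_function \<Omega> \<phi>"
    obtain K where K: "compact K" "K \<subseteq> \<Omega>" "\<And>x. x \<notin> K \<Longrightarrow> \<phi> x = 0" "\<And>x. x \<notin> K \<Longrightarrow> grad \<phi> x = 0"
      using test_function_grad_supp[OF \<phi>] by blast
    have "\<phi> x = 0" "grad \<phi> x = 0" if "x \<in> U" for x using that K U by blast+
    then show "(abs_l2 \<phi>, abs_l2 (grad \<phi>)) \<in> {f. vanishes_on U f} \<times> {f. vanishes_on U f}"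
      by (simp add: vanishes_on_abs test_square_integrable[OF \<phi>] grad_square_integrable[OF \<phi>])
  qed
  with x show "vanishes_on U (fst x)" "vanishes_on U (snd x)" by auto
qed

lemma vanishes_on_pull:
  assumes U: "U \<in> sets borel" and f: "vanishes_on U f" and s: "s \<noteq> 0"
  shows "vanishes_on {x. s *\<^sub>R x + c \<in> U} (l2_op (pull s c) f)"
proof -
  let ?V = "{x. s *\<^sub>R x + c \<in> U}"
  note sq = square_integrable_rep[of f]
  note i = bounded_op_square_integrable[OF bounded_op_indicator[OF U] sq]
  have "(\<lambda>x. s *\<^sub>R x + c) -` U \<in> sets borel"
    using measurable_sets_borel[of "\<lambda>x. s *\<^sub>R x + c" borel U] U by measurable
  then have V: "?V \<in> sets borel" by (simp add: vimage_def)
  have "(\<lambda>x. indicator ?V x *\<^sub>R pull s c (rep_l2 f) x) = pull s c (\<lambda>x. indicator U x *\<^sub>R rep_l2 f x)"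
    by (auto simp: pull_def indicator_def)
  then have "l2_op (\<lambda>f x. indicator ?V x *\<^sub>R f x) (l2_op (pull s c) f) = l2_op (pull s c) (l2_op (\<lambda>f x. indicator U x *\<^sub>R f x) f)"
    unfolding l2_op_def[of "pull s c" f] l2_op_def[of "\<lambda>f x. indicator U x *\<^sub>R f x" f]
    by (simp add: l2_op_abs[OF bounded_op_indicator[OF V]] l2_op_abs[OF bounded_op_pull[OF s]] square_integrable_pull[OF sq s] i)
  also have "\<dots> = 0"
    using f linear_0[OF bounded_linear.linear[OF bounded_linear_l2_op[OF bounded_op_pull[OF s]]]]
    by (simp add: vanishes_on_iff[OF U])
  finally show ?thesis by (simp add: vanishes_on_iff[OF V])
qed

text \<open>Multiplication by a cutoff that is 1 near \<open>K\<close> maps into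
  \<open>H10 U\<close> by the product rule, and it fixes x: both components live on
  \<open>K\<close>, where the cutoff is 1 and its gradient 0.\<close>

lemma H10_cutoff:
  fixes \<Omega> U K :: "'a::euclidean_space set"
  assumes x: "x \<in> H10 \<Omega>" and K: "compact K" "K \<subseteq> U" "open U"
    and van: "vanishes_on (- K) (fst x)" "vanishes_on (- K) (snd x)"
  shows "x \<in> H10 U"
proof -
  obtain \<eta> W where \<eta>: "test_function U \<eta>" "open W" "K \<subseteq> W" "\<And>x. x \<in> W \<Longrightarrow> \<eta> x = 1"
    using smooth_cutoff[OF K(1,3,2)] by blast
  have \<eta>c: "continuous_on A \<eta>" for A by (rule C_k_continuous[OF test_function_C_k[OF \<eta>(1), of 0]])
  have \<eta>g: "grad \<eta> x = 0" if "x \<in> W" for x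
    by (rule grad_eq_on_open[OF \<eta>(2) that, of _ "\<lambda>_. 1"]) (use \<eta> in auto)
  obtain C where C: "compact C" "C \<subseteq> U" "\<And>x. x \<notin> C \<Longrightarrow> \<eta> x = 0" "\<And>x. x \<notin> C \<Longrightarrow> grad \<eta> x = 0"
    using test_function_grad_supp[OF \<eta>(1)] by blast
  have "bounded (\<eta> ` C)" "bounded (grad \<eta> ` C)"
    by (intro compact_imp_bounded compact_continuous_image \<eta>c continuous_on_grad[OF \<eta>(1)] C)+
  then obtain M1 M2 where M: "\<And>x. x \<in> C \<Longrightarrow> norm (\<eta> x) \<le> M1" "M1 > 0" "\<And>x. x \<in> C \<Longrightarrow> norm (grad \<eta> x) \<le> M2" "M2 > 0"
    unfolding bounded_pos by (metis imageI)
  have \<eta>M: "\<bar>\<eta> x\<bar> \<le> M1" "norm (grad \<eta> x) \<le> M2" for x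
    using M(1)[of x] M(3)[of x] M(2,4) C(3)[of x] C(4)[of x] by (cases "x \<in> C"; simp)+
  have meas: "\<eta> \<in> borel_measurable borel" "grad \<eta> \<in> borel_measurable borel"
    by (intro borel_measurable_continuous_onI \<eta>c continuous_on_grad[OF \<eta>(1)])+
  note o1 = bounded_op_mult[OF meas(1) \<eta>M(1)] and o3 = bounded_op_scaleR_vector[OF meas(2) \<eta>M(2)]
  let ?m = "\<lambda>f x. \<eta> x *\<^sub>R f x" and ?v = "\<lambda>f x. f x *\<^sub>R grad \<eta> x"
  \<comment> \<open>The product rule, written on pairs so that it extends by continuity from test
    functions to the closure.\<close>
  let ?\<Phi> = "\<lambda>x. (l2_op ?m (fst x), l2_op ?m (snd x) + l2_op ?v (fst x))"
  have "H10 \<Omega> \<subseteq> ?\<Phi> -` H10 U"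
  proof (rule H10_closed_induct)
    show "closed (?\<Phi> -` H10 U)"
      by (rule closed_vimage[OF closed_H10])
         (intro continuous_intros bounded_linear.continuous_on[OF bounded_linear_l2_op[OF o1]]
           bounded_linear.continuous_on[OF bounded_linear_l2_op[OF o3]])
    fix \<phi> assume \<phi>: "test_function \<Omega> \<phi>"
    have t: "test_function U (\<lambda>x. \<eta> x * \<phi> x)"
      by (rule test_function_mult[OF \<eta>(1) test_function_C_k[OF \<phi>]])
    have "grad (\<lambda>x. \<eta> x * \<phi> x) = (\<lambda>x. \<eta> x *\<^sub>R grad \<phi> x + \<phi> x *\<^sub>R grad \<eta> x)"
      by (simp add: fun_eq_iff grad_mult[OF \<eta>(1) \<phi>])
    then have "(abs_l2 (\<lambda>x. \<eta> x * \<phi> x), abs_l2 (grad (\<lambda>x. \<eta> x * \<phi> x))) = ?\<Phi> (abs_l2 \<phi>, abs_l2 (grad \<phi>))"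
      using test_square_integrable[OF \<phi>] grad_square_integrable[OF \<phi>]
      by (simp add: l2_op_abs[OF o1] l2_op_abs[OF o3] abs_l2_add bounded_op_square_integrable[OF o1] bounded_op_square_integrable[OF o3]
          del: real_scaleR_def) simp
    then show "(abs_l2 \<phi>, abs_l2 (grad \<phi>)) \<in> ?\<Phi> -` H10 U"
      using test_in_H10[OF t] by simp
  qed
  then have "?\<Phi> x \<in> H10 U" using x by blast
  moreover have id: "l2_op ?m f = f" if "vanishes_on (- K) f" for f :: "('a, 'c::euclidean_space) l2"
  proof -
    have "AE x in lborel. \<eta> x *\<^sub>R rep_l2 f x = rep_l2 f x"
      using that unfolding vanishes_on_def by eventually_elim (use \<eta> in auto)
    then have "abs_l2 (\<lambda>x. \<eta> x *\<^sub>R rep_l2 f x) = abs_l2 (rep_l2 f)"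
      by (subst abs_l2_eq_iff) (auto intro: square_integrable_rep bounded_op_square_integrable[OF o1])
    then show ?thesis by (simp add: l2_op_def abs_rep_l2)
  qed
  moreover have "l2_op ?v (fst x) = 0"
  proof -
    have "AE t in lborel. rep_l2 (fst x) t *\<^sub>R grad \<eta> t = 0"
      using van(1) unfolding vanishes_on_def by eventually_elim (use \<eta>(3) \<eta>g in auto)
    then show ?thesis
      unfolding l2_op_def abs_l2_zero[symmetric]
      by (subst abs_l2_eq_iff) (auto intro: square_integrable_rep square_integrable_zero bounded_op_square_integrable[OF o3])
  qed
  ultimately show ?thesis by (simp only: id[OF van(1)] id[OF van(2)] add_0_right prod.collapse)
qed

section \<open>Continuity of dilations and membership in \<open>H10\<close> of an interior\<close>

lemma closed_strong_limit:
  fixes T :: "nat \<Rightarrow> 'a::real_normed_vector \<Rightarrow> 'a"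
  assumes "\<And>n. linear (T n)" "\<And>n x. norm (T n x) \<le> norm x"
  shows "closed {x. (\<lambda>n. T n x) \<longlonglongrightarrow> x}"
proof (rule closed_sequential_limits[THEN iffD2], intro allI impI, elim conjE)
  fix X x assume X: "\<forall>k. X k \<in> {x. (\<lambda>n. T n x) \<longlonglongrightarrow> x}" "X \<longlonglongrightarrow> x"
  have "(\<lambda>n. T n x) \<longlonglongrightarrow> x"
  proof (rule metric_LIMSEQ_I)
    fix e :: real assume e: "e > 0"
    then obtain k where k: "dist (X k) x < e / 3"
      using metric_LIMSEQ_D[OF X(2), of "e / 3"] by auto
    have "(\<lambda>n. T n (X k)) \<longlonglongrightarrow> X k" using X(1) by blast
    then obtain N where N: "\<And>n. n \<ge> N \<Longrightarrow> dist (T n (X k)) (X k) < e / 3"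
      using metric_LIMSEQ_D[of _ _ "e / 3"] e by (metis divide_pos_pos zero_less_numeral)
    have "dist (T n x) x < e" if "n \<ge> N" for n
    proof -
      have "dist (T n x) (T n (X k)) \<le> dist x (X k)"
        using assms(2)[of n "x - X k"] by (simp add: dist_norm linear_diff[OF assms(1)])
      then show ?thesis
        using k N[OF that] dist_triangle[of "T n x" x "T n (X k)"] dist_triangle[of "T n (X k)" x "X k"]
        by (simp add: dist_commute)
    qed
    then show "\<exists>N. \<forall>n\<ge>N. dist (T n x) x < e" by blast
  qed
  then show "x \<in> {x. (\<lambda>n. T n x) \<longlonglongrightarrow> x}" by simp
qed

text \<open>Dominated convergence: for factors at least 1 the supports of the dilated functions stay
  in any ball about p that contains \<open>K\<close>, and there the difference is bounded by 2
  M.\<close>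

lemma dilation_tendsto_continuous:
  fixes f :: "'a::euclidean_space \<Rightarrow> 'b::euclidean_space"
  assumes f: "continuous_on UNIV f" "compact K" "\<And>x. x \<notin> K \<Longrightarrow> f x = 0"
    and s: "s \<longlonglongrightarrow> 1" "\<And>n. s n \<ge> 1"
  shows "(\<lambda>n. l2_op (pull (s n) ((1 - s n) *\<^sub>R p)) (abs_l2 f)) \<longlonglongrightarrow> abs_l2 f"
proof -
  have s0: "s n \<noteq> 0" for n using s(2)[of n] by auto
  have sq: "square_integrable f" by (rule square_integrable_continuous[OF f])
  have [measurable]: "f \<in> borel_measurable borel" by (rule borel_measurable_continuous_onI[OF f(1)])
  have "bounded (f ` K)"
    by (intro compact_imp_bounded compact_continuous_image f(2) continuous_on_subset[OF f(1)]) simp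
  then obtain M where M: "M > 0" "\<And>x. x \<in> K \<Longrightarrow> norm (f x) \<le> M" unfolding bounded_pos by blast
  then have fM: "norm (f x) \<le> M" for x using f(3)[of x] by (cases "x \<in> K") auto
  obtain R where "\<forall>y\<in>K. dist p y \<le> R"
    using compact_imp_bounded[OF f(2)] unfolding bounded_any_center[of K p] by (elim exE)
  then have R: "K \<subseteq> cball p R" by auto
  let ?w = "\<lambda>x. (2 * M)\<^sup>2 * indicator (cball p R) x"
  have "(\<lambda>n. \<integral>x. (norm (pull (s n) ((1 - s n) *\<^sub>R p) f x - f x))\<^sup>2 \<partial>lborel) \<longlonglongrightarrow> (\<integral>x. 0 \<partial>(lborel :: 'a measure))"
  proof (rule integral_dominated_convergence[where w="?w"])
    show "integrable lborel ?w"
      using borel_integrable_compact[OF compact_cball[of p R] continuous_on_const[of _ "(2 * M)\<^sup>2"]]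
      by (simp add: mult.commute)
    show "(\<lambda>x. (norm (pull (s n) ((1 - s n) *\<^sub>R p) f x - f x))\<^sup>2) \<in> borel_measurable lborel" for n
      unfolding pull_def by measurable
    show "AE x in lborel. (\<lambda>n. (norm (pull (s n) ((1 - s n) *\<^sub>R p) f x - f x))\<^sup>2) \<longlonglongrightarrow> 0"
    proof (rule always_eventually, rule allI)
      fix x
      have "(\<lambda>n. s n *\<^sub>R x + (1 - s n) *\<^sub>R p) \<longlonglongrightarrow> 1 *\<^sub>R x + (1 - 1) *\<^sub>R p"
        by (intro tendsto_intros s(1))
      then have "(\<lambda>n. s n *\<^sub>R x + (1 - s n) *\<^sub>R p) \<longlonglongrightarrow> x" by simp
      then have "(\<lambda>n. f (s n *\<^sub>R x + (1 - s n) *\<^sub>R p)) \<longlonglongrightarrow> f x"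
        by (rule continuous_on_tendsto_compose[OF f(1)]) auto
      then have "(\<lambda>n. (norm (f (s n *\<^sub>R x + (1 - s n) *\<^sub>R p) - f x))\<^sup>2) \<longlonglongrightarrow> (norm (f x - f x))\<^sup>2"
        by (intro tendsto_intros)
      then show "(\<lambda>n. (norm (pull (s n) ((1 - s n) *\<^sub>R p) f x - f x))\<^sup>2) \<longlonglongrightarrow> 0"
        by (simp add: pull_def)
    qed
    show "AE x in lborel. norm ((norm (pull (s n) ((1 - s n) *\<^sub>R p) f x - f x))\<^sup>2) \<le> ?w x" for n
    proof (rule always_eventually, rule allI)
      fix x
      let ?y = "s n *\<^sub>R x + (1 - s n) *\<^sub>R p"
      show "norm ((norm (pull (s n) ((1 - s n) *\<^sub>R p) f x - f x))\<^sup>2) \<le> ?w x"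
      proof (cases "x \<in> cball p R")
        case True
        have "norm (f ?y - f x) \<le> 2 * M"
          using norm_triangle_ineq4[of "f ?y" "f x"] fM[of ?y] fM[of x] by linarith
        then have "(norm (f ?y - f x))\<^sup>2 \<le> (2 * M)\<^sup>2" by (intro power_mono) auto
        then show ?thesis using True by (simp add: pull_def)
      next
        case False
        have "?y - p = s n *\<^sub>R (x - p)" by (simp add: algebra_simps)
        then have "norm (?y - p) = s n * norm (x - p)" using s(2)[of n] by simp
        moreover have "1 * norm (x - p) \<le> s n * norm (x - p)" using s(2)[of n] by (intro mult_right_mono) auto
        ultimately have "?y \<notin> cball p R"
          using False by (auto simp: dist_norm norm_minus_commute)
        then have "f ?y = 0" "f x = 0" using f(3) R False by blast+
        then show ?thesis by (simp add: pull_def)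
      qed
    qed
  qed auto
  then show ?thesis
    by (simp add: l2_op_abs[OF bounded_op_pull[OF s0] sq] tendsto_abs_l2_iff square_integrable_pull sq s0)
qed

lemma norm_pull_le:
  fixes f :: "('a::euclidean_space, 'b::euclidean_space) l2"
  assumes "s \<ge> 1" shows "norm (l2_op (pull s c) f) \<le> norm f"
proof -
  have "f \<bullet> f / \<bar>s\<bar> ^ DIM('a) \<le> f \<bullet> f / 1"
    using assms by (intro divide_left_mono) auto
  then show ?thesis
    using assms by (simp add: norm_eq_sqrt_inner inner_l2_op_pull)
qed

lemma H10_dilation_tendsto:
  fixes x :: "('a::euclidean_space, real) l2 \<times> ('a, 'a) l2"
  assumes x: "x \<in> H10 \<Omega>" and s: "s \<longlonglongrightarrow> 1" "\<And>n. s n \<ge> 1"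
  shows "(\<lambda>n. (l2_op (pull (s n) ((1 - s n) *\<^sub>R p)) (fst x), s n *\<^sub>R l2_op (pull (s n) ((1 - s n) *\<^sub>R p)) (snd x))) \<longlonglongrightarrow> x"
proof -
  have s0: "s n \<noteq> 0" for n using s(2)[of n] by auto
  let ?T = "\<lambda>n. l2_op (pull (s n) ((1 - s n) *\<^sub>R p))"
  have cl: "closed {f :: ('a, 'b::euclidean_space) l2. (\<lambda>n. ?T n f) \<longlonglongrightarrow> f}"
    by (rule closed_strong_limit)
       (rule bounded_linear.linear[OF bounded_linear_l2_op[OF bounded_op_pull[OF s0]]] norm_pull_le[OF s(2)])+
  have "H10 \<Omega> \<subseteq> {f. (\<lambda>n. ?T n f) \<longlonglongrightarrow> f} \<times> {f. (\<lambda>n. ?T n f) \<longlonglongrightarrow> f}"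
  proof (rule H10_closed_induct)
    show "closed ({f :: ('a, real) l2. (\<lambda>n. ?T n f) \<longlonglongrightarrow> f} \<times> {f :: ('a, 'a) l2. (\<lambda>n. ?T n f) \<longlonglongrightarrow> f})"
      by (intro closed_Times cl)
    fix \<phi> assume \<phi>: "test_function \<Omega> \<phi>"
    obtain K where K: "compact K" "K \<subseteq> \<Omega>" "\<And>x. x \<notin> K \<Longrightarrow> \<phi> x = 0" "\<And>x. x \<notin> K \<Longrightarrow> grad \<phi> x = 0"
      using test_function_grad_supp[OF \<phi>] by blast
    show "(abs_l2 \<phi>, abs_l2 (grad \<phi>)) \<in> {f. (\<lambda>n. ?T n f) \<longlonglongrightarrow> f} \<times> {f. (\<lambda>n. ?T n f) \<longlonglongrightarrow> f}"
      using dilation_tendsto_continuous[OF C_k_continuous[OF test_function_C_k[OF \<phi>, of 0]] K(1,3) s, of p]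
        dilation_tendsto_continuous[OF continuous_on_grad[OF \<phi>] K(1,4) s, of p] by simp
  qed
  then have "(\<lambda>n. ?T n (fst x)) \<longlonglongrightarrow> fst x" "(\<lambda>n. ?T n (snd x)) \<longlonglongrightarrow> snd x" using x by auto
  then have "(\<lambda>n. (?T n (fst x), s n *\<^sub>R ?T n (snd x))) \<longlonglongrightarrow> (fst x, 1 *\<^sub>R snd x)"
    by (intro tendsto_intros s(1))
  then show ?thesis by simp
qed

text \<open>The dilations of x by factors above 1 lie in \<open>H10 (interior K)\<close> by
  \<open>H10_cutoff\<close> and converge back to x, so closedness of \<open>H10\<close> concludes.
  Factors strictly above 1 are what brings the support into the interior.\<close>

lemma H10_interior_convex:
  fixes K :: "'a::euclidean_space set"
  assumes x: "x \<in> H10 \<Omega>" and K: "compact K" "convex K" "interior K \<noteq> {}"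
    and van: "vanishes_on (- K) (fst x)" "vanishes_on (- K) (snd x)"
  shows "x \<in> H10 (interior K)"
proof -
  obtain p where p: "p \<in> interior K" using K(3) by blast
  define s :: "nat \<Rightarrow> real" where "s n = 1 + inverse (real (Suc n))" for n
  have "(\<lambda>n. 1 + inverse (real (Suc n))) \<longlonglongrightarrow> 1 + 0"
    by (intro tendsto_add tendsto_const LIMSEQ_inverse_real_of_nat)
  then have s: "s \<longlonglongrightarrow> 1" "\<And>n. s n > 1"
    unfolding s_def[abs_def] by (simp_all del: of_nat_Suc)
  have s0: "s n \<noteq> 0" and s1: "s n \<ge> 1" for n using s(2)[of n] by auto
  define y where "y n = (l2_op (pull (s n) ((1 - s n) *\<^sub>R p)) (fst x), s n *\<^sub>R l2_op (pull (s n) ((1 - s n) *\<^sub>R p)) (snd x))" for n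
  have "y n \<in> H10 (interior K)" for n
  proof (rule H10_cutoff)
    let ?K = "{z. s n *\<^sub>R z + (1 - s n) *\<^sub>R p \<in> K}"
    show "y n \<in> H10 {z. s n *\<^sub>R z + (1 - s n) *\<^sub>R p \<in> \<Omega>}"
      unfolding y_def by (rule H10_pull[OF x s0])
    show sub: "?K \<subseteq> interior K"
    proof
      fix z assume "z \<in> ?K"
      then have q: "s n *\<^sub>R z + (1 - s n) *\<^sub>R p \<in> K" (is "?q \<in> K") by simp
      \<comment> \<open>This point is z, the convex combination of q and p with weights 1/s and 1 -
        1/s; the interior point p has positive weight.\<close>
      have "?q - (1 - 1 / s n) *\<^sub>R (?q - p) \<in> interior K"
        by (rule mem_interior_convex_shrink[OF K(2) p q]) (use s(2)[of n] in auto)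
      moreover have "?q - (1 - 1 / s n) *\<^sub>R (?q - p) = z"
      proof -
        have "(1 - 1 / s n) * s n = s n - 1" using s0[of n] by (simp add: left_diff_distrib)
        moreover have "?q - p = s n *\<^sub>R (z - p)" by (simp add: algebra_simps)
        ultimately have "(1 - 1 / s n) *\<^sub>R (?q - p) = (s n - 1) *\<^sub>R (z - p)" by (simp only: scaleR_scaleR)
        moreover have "?q - (s n - 1) *\<^sub>R (z - p) = z" by (simp add: algebra_simps)
        ultimately show ?thesis by (simp only:)
      qed
      ultimately show "z \<in> interior K" by simp
    qed
    have "closed ((\<lambda>z. s n *\<^sub>R z + (1 - s n) *\<^sub>R p) -` K)"
      by (intro closed_vimage compact_imp_closed K continuous_intros)
    moreover have "bounded ?K" using sub interior_subset compact_imp_bounded[OF K(1)] bounded_subset by blast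
    ultimately show "compact ?K" by (simp add: compact_eq_bounded_closed vimage_def)
    have B: "- K \<in> sets borel" using K(1) by (intro borel_open open_Compl compact_imp_closed)
    have "vanishes_on {z. s n *\<^sub>R z + (1 - s n) *\<^sub>R p \<in> - K} (fst (y n))"
      unfolding y_def by (simp only: fst_conv) (rule vanishes_on_pull[OF B van(1) s0])
    then show "vanishes_on (- ?K) (fst (y n))" by (simp add: Collect_neg_eq)
    have "vanishes_on {z. s n *\<^sub>R z + (1 - s n) *\<^sub>R p \<in> - K} (l2_op (pull (s n) ((1 - s n) *\<^sub>R p)) (snd x))"
      by (rule vanishes_on_pull[OF B van(2) s0])
    then have *: "vanishes_on (- ?K) (l2_op (pull (s n) ((1 - s n) *\<^sub>R p)) (snd x))" by (simp add: Collect_neg_eq)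
    have "- ?K \<in> sets borel" using \<open>compact ?K\<close> by (intro borel_open open_Compl compact_imp_closed)
    from subspace_scale[OF subspace_vanishes_on[OF this], of _ "s n"] *
    show "vanishes_on (- ?K) (snd (y n))" by (simp add: y_def)
  qed (rule open_interior)
  moreover have "y \<longlonglongrightarrow> x" unfolding y_def using H10_dilation_tendsto[OF x s(1) s1] .
  ultimately show ?thesis using closed_sequentially[OF closed_H10] by blast
qed

section \<open>Minimising sequences\<close>


text \<open>Convex combinations with dyadic weights of the tuples \<open>X m\<close> with m \<ge> n.
  Midpoints suffice for the parallelogram law, and generating them inductively avoids explicit
  weights; a tuple is combined as a whole, so its components share their weights.\<close>

inductive tail_mid :: "(nat \<Rightarrow> nat \<Rightarrow> 'h::real_vector) \<Rightarrow> nat \<Rightarrow> (nat \<Rightarrow> 'h) \<Rightarrow> bool" for X n where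
  base: "n \<le> m \<Longrightarrow> tail_mid X n (X m)"
| mid: "tail_mid X n z \<Longrightarrow> tail_mid X n w \<Longrightarrow> tail_mid X n (\<lambda>i. (1/2) *\<^sub>R (z i + w i))"

lemma tail_mid_antimono: "tail_mid X m z \<Longrightarrow> n \<le> m \<Longrightarrow> tail_mid X n z"
  by (induction rule: tail_mid.induct) (auto intro: tail_mid.intros)

text \<open>The map \<open>f\<close> has to respect midpoints of tuples only, so it may select one
  component or combine several.\<close>

lemma tail_mid_convex:
  assumes "tail_mid X n z" "convex C" "\<And>m. n \<le> m \<Longrightarrow> f (X m) \<in> C"
    and f: "\<And>z w. f (\<lambda>i. (1/2) *\<^sub>R (z i + w i)) = (1/2) *\<^sub>R (f z + f w)"
  shows "f z \<in> C"
  using assms(1)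
proof induction
  case (mid z w)
  then have "(1/2) *\<^sub>R f z + (1/2) *\<^sub>R f w \<in> C" by (intro convexD[OF assms(2)]) auto
  then have "(1/2) *\<^sub>R (f z + f w) \<in> C" by (simp only: scaleR_add_right)
  then show ?case by (simp only: f)
qed (use assms(3) in auto)

text \<open>Mazur's lemma with weights common to all components: near-minimisers of the norm over the
  midpoint closures of the tails form a Cauchy sequence by the parallelogram law.\<close>

lemma mazur_tuples:
  fixes X :: "nat \<Rightarrow> nat \<Rightarrow> 'h::{real_inner, complete_space}"
  assumes bound: "\<And>m. (\<Sum>i\<le>k. (norm (X m i))\<^sup>2) \<le> C"
  shows "\<exists>Z L. (\<forall>n. tail_mid X n (Z n)) \<and> (\<forall>i\<le>k. (\<lambda>n. Z n i) \<longlonglongrightarrow> L i)"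
proof -
  define N where "N z = (\<Sum>i\<le>k. (norm (z i :: 'h))\<^sup>2)" for z
  define S where "S n = N ` {z. tail_mid X n z}" for n
  define d where "d n = Inf (S n)" for n
  have tX: "tail_mid X n (X n)" for n by (rule tail_mid.base) simp
  have N0: "N z \<ge> 0" for z by (simp add: N_def sum_nonneg)
  have bdd: "bdd_below (S n)" for n by (rule bdd_belowI[of _ 0]) (auto simp: S_def N0)
  have ne: "S n \<noteq> {}" for n using tX[of n] by (auto simp: S_def)
  have d_le: "d n \<le> N z" if "tail_mid X n z" for n z
    unfolding d_def by (rule cInf_lower[OF _ bdd]) (use that in \<open>auto simp: S_def\<close>)
  \<comment> \<open>Later tails generate fewer combinations, so the infima increase; the bound C
    gives them a limit D.\<close>
  have "d n \<le> d m" if "n \<le> m" for n m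
    unfolding d_def by (rule cInf_superset_mono[OF ne bdd]) (use that in \<open>auto simp: S_def intro!: imageI intro: tail_mid_antimono\<close>)
  then have inc: "incseq d" by (rule monoI)
  have "d n \<le> C" for n using d_le[OF tX[of n]] bound[of n] unfolding N_def by linarith
  then obtain D where D: "d \<longlonglongrightarrow> D" "\<And>n. d n \<le> D" using incseq_convergent[OF inc] by metis
  have "\<exists>z. tail_mid X n z \<and> N z < d n + inverse (real (Suc n))" for n
  proof -
    have "Inf (S n) < d n + inverse (real (Suc n))" by (simp add: d_def)
    from cInf_lessD[OF ne this] show ?thesis by (auto simp: S_def)
  qed
  then obtain Z where Z: "\<And>n. tail_mid X n (Z n)" "\<And>n. N (Z n) < d n + inverse (real (Suc n))" by metis
  \<comment> \<open>The midpoint of \<open>Z n\<close> and \<open>Z m\<close> still belongs to the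
    earlier tail, so its \<open>N\<close> is at least \<open>d n\<close>; what remains is the growth
    of the infima and the two errors.\<close>
  have para: "N (\<lambda>i. Z n i - Z m i) \<le> 2 * (D - d n) + 4 * inverse (real (Suc n))" if nm: "n \<le> m" for n m
  proof -
    have "N (\<lambda>i. Z n i - Z m i) = 2 * N (Z n) + 2 * N (Z m) - 4 * N (\<lambda>i. (1/2) *\<^sub>R (Z n i + Z m i))"
    proof -
      have "(norm (a - b))\<^sup>2 = 2 * (norm a)\<^sup>2 + 2 * (norm b)\<^sup>2 - 4 * (norm ((1/2) *\<^sub>R (a + b)))\<^sup>2" for a b :: 'h
      proof -
        have "4 * (norm ((1/2) *\<^sub>R (a + b)))\<^sup>2 = (norm (a + b))\<^sup>2"
          unfolding norm_scaleR power_mult_distrib by (simp add: power_divide)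
        then show ?thesis by (simp only:) (simp add: power2_norm_eq_inner algebra_simps)
      qed
      then show ?thesis unfolding N_def by (simp only: sum.distrib sum_subtractf sum_distrib_left)
    qed
    moreover have "d n \<le> N (\<lambda>i. (1/2) *\<^sub>R (Z n i + Z m i))"
      by (intro d_le tail_mid.mid Z tail_mid_antimono[OF Z(1) nm])
    moreover have "inverse (real (Suc m)) \<le> inverse (real (Suc n))"
      using nm by (intro le_imp_inverse_le) auto
    moreover have "a \<le> 2 * (D - dn) + 4 * en"
      if "a = 2 * b + 2 * c - 4 * g" "dn \<le> g" "em \<le> en" "b < dn + en" "c < dm + em" "dm \<le> D"
      for a b c g dn dm em en :: real
      using that by argo
    ultimately show ?thesis using Z(2)[of n] Z(2)[of m] D(2)[of m] by blast
  qed
  have "Cauchy (\<lambda>n. Z n i)" if i: "i \<le> k" for i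
  proof (rule metric_CauchyI)
    fix e :: real assume e: "e > 0"
    have "(\<lambda>n. 2 * (D - d n) + 4 * inverse (real (Suc n))) \<longlonglongrightarrow> 2 * (D - D) + 4 * 0"
      by (intro tendsto_intros D LIMSEQ_inverse_real_of_nat)
    then have "eventually (\<lambda>n. 2 * (D - d n) + 4 * inverse (real (Suc n)) < (e/2)\<^sup>2) sequentially"
      using e by (intro order_tendstoD(2)[where y="2 * (D - D) + 4 * 0"]) auto
    then obtain M where M: "2 * (D - d M) + 4 * inverse (real (Suc M)) < (e/2)\<^sup>2"
      unfolding eventually_sequentially by blast
    have close: "dist (Z M i) (Z m i) < e/2" if "M \<le> m" for m
    proof -
      have "(norm (Z M i - Z m i))\<^sup>2 \<le> N (\<lambda>i. Z M i - Z m i)"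
        unfolding N_def by (rule member_le_sum) (use i in auto)
      then have "(norm (Z M i - Z m i))\<^sup>2 < (e/2)\<^sup>2" using para[OF that] M by linarith
      then show ?thesis unfolding dist_norm by (rule power2_less_imp_less) (use e in simp)
    qed
    have "dist (Z m i) (Z n i) < e" if "M \<le> m" "M \<le> n" for m n
      using close[OF that(1)] close[OF that(2)] dist_triangle3[of "Z m i" "Z n i" "Z M i"] by linarith
    then show "\<exists>M. \<forall>m\<ge>M. \<forall>n\<ge>M. dist (Z m i) (Z n i) < e" by blast
  qed
  then have "\<forall>i. \<exists>l. i \<le> k \<longrightarrow> (\<lambda>n. Z n i) \<longlonglongrightarrow> l"
    by (simp add: Cauchy_convergent_iff convergent_def)
  then obtain L where "\<forall>i. i \<le> k \<longrightarrow> (\<lambda>n. Z n i) \<longlonglongrightarrow> L i" by (rule choice[THEN exE])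
  with Z(1) show ?thesis by blast
qed

text \<open>Stands in for the weak closedness of closed convex sets: a closed convex condition that
  holds eventually along \<open>X\<close> survives in the limit of the combinations. Membership in
  \<open>H10\<close>, vanishing on a set and the Rayleigh bound all pass to the limit through
  it.\<close>

lemma tail_mid_limit:
  fixes X :: "nat \<Rightarrow> nat \<Rightarrow> 'h::real_normed_vector" and f :: "(nat \<Rightarrow> 'h) \<Rightarrow> 'v::real_normed_vector"
  assumes Z: "\<And>n. tail_mid X n (Z n)" and lim: "(\<lambda>n. f (Z n)) \<longlonglongrightarrow> l"
    and C: "convex C" "closed C" and ev: "eventually (\<lambda>n. f (X n) \<in> C) sequentially"
    and f: "\<And>z w. f (\<lambda>i. (1/2) *\<^sub>R (z i + w i)) = (1/2) *\<^sub>R (f z + f w)"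
  shows "l \<in> C"
proof -
  obtain N where N: "\<And>n. n \<ge> N \<Longrightarrow> f (X n) \<in> C" using ev unfolding eventually_sequentially by blast
  have "f (Z (n + N)) \<in> C" for n
    by (rule tail_mid_convex[OF Z C(1) _ f]) (use N in auto)
  moreover have "(\<lambda>n. f (Z (n + N))) \<longlonglongrightarrow> l" using lim by (rule LIMSEQ_ignore_initial_segment)
  ultimately show ?thesis by (rule closed_sequentially[OF C(2)])
qed

text \<open>Moving a point of the domain to the origin puts all domains into one ball, so that the
  compact embedding applies to the whole sequence. The diameter is restated through pairs of points,
  the form in which it passes to the limit set.\<close>

lemma translated_eigenvectors:
  fixes \<Omega> :: "'a::euclidean_space set"
  assumes adm: "admissible \<alpha> \<Omega>"
  shows "\<exists>(\<Omega>' :: 'a set) x. \<Omega>' \<subseteq> cball 0 \<alpha> \<and> (\<forall>a\<in>\<Omega>'. \<forall>b\<in>\<Omega>'. dist a b \<le> \<alpha>) \<and> (\<forall>i. x i \<in> H10 \<Omega>') \<and>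
    (\<forall>i j. fst (x i) \<bullet> fst (x j) = (if i = j then 1 else 0)) \<and>
    (\<forall>c. (norm (\<Sum>i\<le>k. c i *\<^sub>R snd (x i)))\<^sup>2 \<le> dirichlet_eigenvalue (Suc k) \<Omega> * (\<Sum>i\<le>k. (c i)\<^sup>2))"
proof -
  have \<Omega>: "open \<Omega>" "\<Omega> \<noteq> {}" "bounded \<Omega>" "diameter \<Omega> \<le> \<alpha>" using adm by (auto simp: admissible_def)
  obtain p where p: "p \<in> \<Omega>" using \<Omega>(2) by blast
  obtain x where x: "\<And>i. x i \<in> H10 \<Omega>" "\<And>i j. fst (x i) \<bullet> fst (x j) = (if i = j then 1 else 0)"
    "\<And>c. (norm (\<Sum>i\<le>k. c i *\<^sub>R snd (x i)))\<^sup>2 \<le> dirichlet_eigenvalue (Suc k) \<Omega> * (\<Sum>i\<le>k. (c i)\<^sup>2)"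
    using dirichlet_eigenvectors[OF \<Omega>(1-3), of k] by auto
  have dist: "dist a b \<le> \<alpha>" if "a \<in> \<Omega>" "b \<in> \<Omega>" for a b
    using diameter_bounded_bound[OF \<Omega>(3) that] \<Omega>(4) by linarith
  define \<Omega>' where "\<Omega>' = {y. 1 *\<^sub>R y + p \<in> \<Omega>}"
  let ?T = "l2_op (pull 1 p)"
  \<comment> \<open>A dilation of factor 1 is a translation: inner products are preserved and
    gradients are not rescaled.\<close>
  define y where "y i = (?T (fst (x i)), 1 *\<^sub>R ?T (snd (x i)))" for i
  have lin: "linear (?T :: ('a, 'a) l2 \<Rightarrow> _)"
    by (rule bounded_linear.linear[OF bounded_linear_l2_op[OF bounded_op_pull]]) simp
  have 1: "\<Omega>' \<subseteq> cball 0 \<alpha>"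
  proof
    fix y assume "y \<in> \<Omega>'"
    then have "dist (y + p) p \<le> \<alpha>" using dist[OF _ p] by (simp add: \<Omega>'_def)
    then show "y \<in> cball 0 \<alpha>" by (simp add: dist_norm)
  qed
  have 2: "dist a b \<le> \<alpha>" if "a \<in> \<Omega>'" "b \<in> \<Omega>'" for a b
    using dist[of "a + p" "b + p"] that by (simp add: \<Omega>'_def dist_norm)
  have 3: "y i \<in> H10 \<Omega>'" for i
    unfolding y_def \<Omega>'_def by (rule H10_pull[OF x(1)]) simp
  have 4: "fst (y i) \<bullet> fst (y j) = (if i = j then 1 else 0)" for i j
    by (simp add: y_def inner_l2_op_pull x(2))
  have 5: "(norm (\<Sum>i\<le>k. c i *\<^sub>R snd (y i)))\<^sup>2 \<le> dirichlet_eigenvalue (Suc k) \<Omega> * (\<Sum>i\<le>k. (c i)\<^sup>2)" for c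
  proof -
    have "(\<Sum>i\<le>k. c i *\<^sub>R snd (y i)) = ?T (\<Sum>i\<le>k. c i *\<^sub>R snd (x i))"
      by (simp add: y_def linear_sum[OF lin] linear_cmul[OF lin])
    then have "norm (\<Sum>i\<le>k. c i *\<^sub>R snd (y i)) = norm (\<Sum>i\<le>k. c i *\<^sub>R snd (x i))"
      by (simp add: norm_eq_sqrt_inner inner_l2_op_pull)
    then show ?thesis using x(3)[of c] by simp
  qed
  show ?thesis
    by (rule exI[of _ \<Omega>'], rule exI[of _ y]) (intro conjI allI ballI 1 2 3 4 5)
qed

lemma constant_subsequence:
  fixes Q :: "nat \<Rightarrow> bool"
  obtains r :: "nat \<Rightarrow> nat" where "strict_mono r" "(\<forall>n. Q (r n)) \<or> (\<forall>n. \<not> Q (r n))"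
proof -
  have "infinite {n. Q n} \<or> infinite {n. \<not> Q n}"
    using finite_UnI[of "{n. Q n}" "{n. \<not> Q n}"] infinite_UNIV_nat by (auto simp: Un_def)
  then show thesis
  proof
    assume "infinite {n. Q n}"
    from infinite_enumerate[OF this] obtain r :: "nat \<Rightarrow> nat" where "strict_mono r" "\<forall>n. r n \<in> {n. Q n}" by blast
    then show thesis using that[of r] by simp
  next
    assume "infinite {n. \<not> Q n}"
    from infinite_enumerate[OF this] obtain r :: "nat \<Rightarrow> nat" where "strict_mono r" "\<forall>n. r n \<in> {n. \<not> Q n}" by blast
    then show thesis using that[of r] by simp
  qed
qed

text \<open>Excludes the collapse of the limit domain: a nonzero element of L^2 cannot be carried by
  a null set.\<close>

lemma vanishes_outside_null_set:
  assumes K: "negligible K" "K \<in> sets borel" and f: "vanishes_on (- K) f"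
  shows "f = 0"
proof -
  have "K \<in> null_sets lborel"
    using K by (auto simp: negligible_iff_null_sets null_sets_completion_iff)
  then have "AE x in lborel. x \<notin> K" by (rule AE_not_in)
  then have "AE x in lborel. rep_l2 f x = 0"
    using f unfolding vanishes_on_def by eventually_elim auto
  then have "abs_l2 (rep_l2 f) = abs_l2 (\<lambda>x. 0)"
    by (subst abs_l2_eq_iff) (auto intro: square_integrable_rep square_integrable_zero)
  then show ?thesis by (simp add: abs_rep_l2 abs_l2_zero)
qed

text \<open>In place of a Hausdorff limit of the domains the proof uses the closed set \<open>S\<close> of the points
  none of whose neighbourhoods is eventually missed by the domains.\<close>

lemma minimising_limit:
  fixes \<Omega> :: "nat \<Rightarrow> 'a::euclidean_space set" and k :: nat
  assumes \<Omega>: "\<And>n. \<Omega> n \<subseteq> cball 0 \<alpha>" "\<And>n. \<forall>a\<in>\<Omega> n. \<forall>b\<in>\<Omega> n. dist a b \<le> \<alpha>"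
    and x: "\<And>n i. x n i \<in> H10 (\<Omega> n)"
    and orth: "\<And>n i j. fst (x n i) \<bullet> fst (x n j) = (if i = j then 1 else 0)"
    and rayleigh: "\<And>n c. (norm (\<Sum>i\<le>k. c i *\<^sub>R snd (x n i)))\<^sup>2 \<le> E n * (\<Sum>i\<le>k. (c i)\<^sup>2)"
    and E: "E \<longlonglongrightarrow> \<Lambda>"
  shows "\<exists>(K :: 'a set) L. compact K \<and> convex K \<and> (\<forall>a\<in>K. \<forall>b\<in>K. dist a b \<le> \<alpha>) \<and>
    (\<forall>i\<le>k. L i \<in> H10 (cball 0 \<alpha>) \<and> vanishes_on (- K) (fst (L i)) \<and> vanishes_on (- K) (snd (L i))) \<and>
    (\<forall>i\<le>k. \<forall>j\<le>k. fst (L i) \<bullet> fst (L j) = (if i = j then 1 else 0)) \<and>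
    (\<forall>c. (norm (\<Sum>i\<le>k. c i *\<^sub>R snd (L i)))\<^sup>2 \<le> \<Lambda> * (\<Sum>i\<le>k. (c i)\<^sup>2))"
proof -
  have xB: "x n i \<in> H10 (cball 0 \<alpha>)" for n i using x H10_mono[OF \<Omega>(1)] by blast
  obtain M where M: "\<And>n. E n \<le> M"
    using Bseq_bdd_above[OF convergent_imp_Bseq[of E]] E by (auto simp: convergent_def bdd_above_def)
  \<comment> \<open>The Rayleigh bound with the i-th unit vector as coefficients bounds the i-th
    gradient alone.\<close>
  have x_norm: "(norm (x n i))\<^sup>2 \<le> 1 + M" if "i \<le> k" for n i
  proof -
    have "(norm (\<Sum>j\<le>k. (if j = i then 1 else 0) *\<^sub>R snd (x n j)))\<^sup>2 \<le> E n * (\<Sum>j\<le>k. (if j = i then 1 else 0)\<^sup>2)"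
      by (rule rayleigh)
    moreover have "(\<Sum>j\<le>k. (if j = i then 1 else 0) *\<^sub>R snd (x n j)) = snd (x n i)"
      using that by (simp add: if_distrib[of "\<lambda>t. t *\<^sub>R _"] cong: if_cong)
    moreover have "(\<Sum>j\<le>k. (if j = i then 1 else 0)\<^sup>2) = (1::real)"
      using that by (simp add: if_distrib[of "\<lambda>t. t\<^sup>2"] cong: if_cong)
    ultimately have "(norm (snd (x n i)))\<^sup>2 \<le> E n" by simp
    moreover have "(norm (x n i))\<^sup>2 = (norm (fst (x n i)))\<^sup>2 + (norm (snd (x n i)))\<^sup>2"
      by (simp add: norm_prod_def)
    moreover have "(norm (fst (x n i)))\<^sup>2 = 1" by (simp add: power2_norm_eq_inner orth)
    ultimately show ?thesis using M[of n] by linarith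
  qed
  have x_bdd: "bounded (range (\<lambda>n. x (r n) i))" if "i \<le> k" for r i
    unfolding bounded_iff using real_le_rsqrt[OF x_norm[OF that]] by auto
  \<comment> \<open>Countability serves twice: for the diagonal selection and for the union of the
    exceptional null sets.\<close>
  obtain \<B> :: "'a set set" where \<B>: "countable \<B>" "topological_basis \<B>" using ex_countable_basis by blast
  then have "\<B> \<noteq> {}" by (metis UNIV_I equals0D open_UNIV topological_basisE)
  then obtain b :: "nat \<Rightarrow> 'a set" where b: "\<B> = range b"
    using range_from_nat_into[OF _ \<B>(1)] by metis
  define hit where "hit j n \<longleftrightarrow> b j \<inter> \<Omega> n \<noteq> {}" for j n
  \<comment> \<open>Index i carries two unrelated demands, strong convergence of the i-th functions
    for i \<le> k and a final decision whether the i-th basis set meets the domains; one diagonal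
    selection then handles both.\<close>
  define P where "P i r \<longleftrightarrow> (i \<le> k \<longrightarrow> Cauchy (\<lambda>n. fst (x (r n) i))) \<and>
     (eventually (\<lambda>n. hit i (r n)) sequentially \<or> eventually (\<lambda>n. \<not> hit i (r n)) sequentially)" for i and r :: "nat \<Rightarrow> nat"
  obtain r where r: "strict_mono r" "\<And>i. P i (id \<circ> r)"
  proof (rule subsequence_diagonalization_lemma[of P id])
    fix i and r :: "nat \<Rightarrow> nat"
    obtain q :: "nat \<Rightarrow> nat" where q: "strict_mono q" "i \<le> k \<longrightarrow> Cauchy (\<lambda>n. fst (x (r (q n)) i))"
    proof (cases "i \<le> k")
      case True
      from H10_compact[of "cball 0 \<alpha>" "\<lambda>n. x (r n) i", OF bounded_cball xB x_bdd[OF True]]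
      show thesis using that by blast
    qed (use strict_mono_id that in blast)
    obtain q' :: "nat \<Rightarrow> nat" where q': "strict_mono q'" "(\<forall>n. hit i (r (q (q' n)))) \<or> (\<forall>n. \<not> hit i (r (q (q' n))))"
      using constant_subsequence[of "\<lambda>n. hit i (r (q n))"] by blast
    have "Cauchy (\<lambda>n. fst (x (r (q (q' n))) i))" if "i \<le> k"
      using Cauchy_subseq_Cauchy[OF _ q'(1), of "\<lambda>n. fst (x (r (q n)) i)"] q(2) that by (simp add: o_def)
    then have "P i (r \<circ> (q \<circ> q'))" using q'(2) by (auto simp: P_def)
    then show "\<exists>k. strict_mono k \<and> P i (r \<circ> k)" using strict_mono_o[OF q(1) q'(1)] by blast
  next
    \<comment> \<open>Both demands concern tails only, hence persist for a sequence whose late terms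
      are late terms of the old one.\<close>
    fix i r and k1 k2 :: "nat \<Rightarrow> nat" and N
    assume P1: "P i (r \<circ> k1)" and k2: "\<And>j. N \<le> j \<Longrightarrow> \<exists>j'\<ge>j. k2 j = k1 j'"
    have ev: "eventually (\<lambda>n. Q (k2 n)) sequentially" if Q: "eventually (\<lambda>n. Q (k1 n)) sequentially" for Q
    proof -
      obtain N' where N': "\<And>n. n \<ge> N' \<Longrightarrow> Q (k1 n)" using Q unfolding eventually_sequentially by blast
      have "Q (k2 n)" if "n \<ge> max N N'" for n using k2[of n] N' that by (metis max.bounded_iff order_trans)
      then show ?thesis unfolding eventually_sequentially by blast
    qed
    have "Cauchy (\<lambda>n. fst (x (r (k2 n)) i))" if c: "Cauchy (\<lambda>n. fst (x (r (k1 n)) i))"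
    proof (rule metric_CauchyI)
      fix e :: real assume "e > 0"
      then obtain N' where N': "\<And>m n. m \<ge> N' \<Longrightarrow> n \<ge> N' \<Longrightarrow> dist (fst (x (r (k1 m)) i)) (fst (x (r (k1 n)) i)) < e"
        using metric_CauchyD[OF c] by metis
      have "dist (fst (x (r (k2 m)) i)) (fst (x (r (k2 n)) i)) < e" if "m \<ge> max N N'" "n \<ge> max N N'" for m n
        using k2[of m] k2[of n] N' that by (metis max.bounded_iff order_trans)
      then show "\<exists>M. \<forall>m\<ge>M. \<forall>n\<ge>M. dist (fst (x (r (k2 m)) i)) (fst (x (r (k2 n)) i)) < e" by blast
    qed
    then show "P i (r \<circ> k2)"
      using P1 ev[of "\<lambda>n. hit i (r n)"] ev[of "\<lambda>n. \<not> hit i (r n)"] by (auto simp: P_def)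
  qed (rule that)
  define X where "X n = x (r n)" for n
  define miss where "miss j \<longleftrightarrow> eventually (\<lambda>n. \<not> hit j (r n)) sequentially" for j
  have hit: "eventually (\<lambda>n. hit j (r n)) sequentially" if "\<not> miss j" for j
    using r(2)[of j] that by (auto simp: P_def miss_def)
  have "\<forall>i. \<exists>u. i \<le> k \<longrightarrow> (\<lambda>n. fst (X n i)) \<longlonglongrightarrow> u"
    using r(2) by (auto simp: P_def X_def Cauchy_convergent_iff convergent_def)
  from choice[OF this] obtain u where u: "\<And>i. i \<le> k \<Longrightarrow> (\<lambda>n. fst (X n i)) \<longlonglongrightarrow> u i" by blast
  have "(\<Sum>i\<le>k. (norm (X n i))\<^sup>2) \<le> (\<Sum>i\<le>k. 1 + M)" for n
    unfolding X_def by (intro sum_mono x_norm) simp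
  then obtain Z L where Z: "\<And>n. tail_mid X n (Z n)" and L: "\<And>i. i \<le> k \<Longrightarrow> (\<lambda>n. Z n i) \<longlonglongrightarrow> L i"
    using mazur_tuples[of X k] by blast
  \<comment> \<open>The functions converge strongly, so combinations of late terms have the same
    limits. This rescues orthonormality, which convex combinations need not preserve.\<close>
  have fstL: "fst (L i) = u i" if i: "i \<le> k" for i
  proof -
    have "fst (L i) \<in> cball (u i) e" if "e > 0" for e
    proof (rule tail_mid_limit[OF Z, of "\<lambda>z. fst (z i)"])
      show "(\<lambda>n. fst (Z n i)) \<longlonglongrightarrow> fst (L i)" by (intro tendsto_intros L i)
      show "eventually (\<lambda>n. fst (X n i) \<in> cball (u i) e) sequentially"
        using tendstoD[OF u[OF i] that] by eventually_elim (simp add: dist_commute)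
    qed auto
    then have "dist (u i) (fst (L i)) \<le> e" if "e > 0" for e using that by simp
    then show ?thesis using zero_less_dist_iff[of "u i" "fst (L i)"] dense[of 0 "dist (u i) (fst (L i))"] by force
  qed
  have Lorth: "fst (L i) \<bullet> fst (L j) = (if i = j then 1 else 0)" if "i \<le> k" "j \<le> k" for i j
  proof -
    have "(\<lambda>n. fst (X n i) \<bullet> fst (X n j)) \<longlonglongrightarrow> u i \<bullet> u j" by (intro tendsto_intros u that)
    then have "(\<lambda>n. if i = j then 1 else 0) \<longlonglongrightarrow> u i \<bullet> u j" by (simp only: X_def orth)
    then show ?thesis using LIMSEQ_unique tendsto_const fstL that by metis
  qed
  have LB: "L i \<in> H10 (cball 0 \<alpha>)" if i: "i \<le> k" for i
    by (rule tail_mid_limit[OF Z, of "\<lambda>z. z i"])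
       (use i L xB in \<open>auto simp: X_def closed_H10 intro!: subspace_imp_convex subspace_H10\<close>)
  have Er: "(\<lambda>n. E (r n)) \<longlonglongrightarrow> \<Lambda>" using LIMSEQ_subseq_LIMSEQ[OF E r(1)] by (simp add: o_def)
  have Lray: "(norm (\<Sum>i\<le>k. c i *\<^sub>R snd (L i)))\<^sup>2 \<le> \<Lambda> * (\<Sum>i\<le>k. (c i)\<^sup>2)" for c
  proof (rule LIMSEQ_le_const)
    define s where "s = (\<Sum>i\<le>k. (c i)\<^sup>2)"
    have s0: "s \<ge> 0" by (simp add: s_def sum_nonneg)
    show "(\<lambda>m. (\<Lambda> + inverse (real (Suc m))) * (\<Sum>i\<le>k. (c i)\<^sup>2)) \<longlonglongrightarrow> \<Lambda> * (\<Sum>i\<le>k. (c i)\<^sup>2)"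
    proof -
      have "(\<lambda>m. (\<Lambda> + inverse (real (Suc m))) * s) \<longlonglongrightarrow> (\<Lambda> + 0) * s"
        by (intro tendsto_intros LIMSEQ_inverse_real_of_nat)
      then show ?thesis by (simp add: s_def)
    qed
    \<comment> \<open>For T above \<Lambda> the bound holds eventually and describes a ball, which
      is closed and convex; \<Lambda> itself is reached by letting T decrease.\<close>
    have "(norm (\<Sum>i\<le>k. c i *\<^sub>R snd (L i)))\<^sup>2 \<le> T * s" if T: "\<Lambda> < T" for T
    proof -
      have "eventually (\<lambda>n. E (r n) < T) sequentially" using order_tendstoD(2)[OF Er T] .
      then have "eventually (\<lambda>n. (\<Sum>i\<le>k. c i *\<^sub>R snd (X n i)) \<in> cball 0 (sqrt (T * s))) sequentially"
      proof eventually_elim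
        fix n assume "E (r n) < T"
        then have "(norm (\<Sum>i\<le>k. c i *\<^sub>R snd (X n i)))\<^sup>2 \<le> T * s"
          using rayleigh[of c "r n"] mult_right_mono[of "E (r n)" T s] s0 by (simp add: X_def s_def)
        then show "(\<Sum>i\<le>k. c i *\<^sub>R snd (X n i)) \<in> cball 0 (sqrt (T * s))"
          using real_le_rsqrt by simp
      qed
      then have "(\<Sum>i\<le>k. c i *\<^sub>R snd (L i)) \<in> cball 0 (sqrt (T * s))"
      proof (rule tail_mid_limit[OF Z, of "\<lambda>z. \<Sum>i\<le>k. c i *\<^sub>R snd (z i)", rotated 3])
        show "(\<lambda>n. \<Sum>i\<le>k. c i *\<^sub>R snd (Z n i)) \<longlonglongrightarrow> (\<Sum>i\<le>k. c i *\<^sub>R snd (L i))"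
          by (intro tendsto_intros L) simp
      qed (auto simp: scaleR_sum_right sum.distrib[symmetric] scaleR_add_right)
      then have "norm (\<Sum>i\<le>k. c i *\<^sub>R snd (L i)) \<le> sqrt (T * s)" by simp
      then have "(norm (\<Sum>i\<le>k. c i *\<^sub>R snd (L i)))\<^sup>2 \<le> (sqrt (T * s))\<^sup>2" by (rule power_mono) simp
      \<comment> \<open>The sign is needed to recover T s from the square of its square root; it
        holds because the bounds along the sequence dominate squares.\<close>
      moreover have "0 \<le> T * s"
      proof -
        have "eventually (\<lambda>n. 0 \<le> E (r n) * s) sequentially"
          using order_trans[OF zero_le_power2 rayleigh[of c]] by (simp add: s_def)
        then have "0 \<le> \<Lambda> * s"
          by (intro tendsto_lowerbound[OF tendsto_mult_right[OF Er]]) auto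
        then show ?thesis using T s0 mult_right_mono[of \<Lambda> T s] by linarith
      qed
      ultimately show ?thesis by simp
    qed
    then show "\<exists>N. \<forall>n\<ge>N. (norm (\<Sum>i\<le>k. c i *\<^sub>R snd (L i)))\<^sup>2 \<le> (\<Lambda> + inverse (real (Suc n))) * (\<Sum>i\<le>k. (c i)\<^sup>2)"
      by (simp add: s_def)
  qed
  define S where "S = - (\<Union>(b ` {j. miss j}))"
  have b_open: "open (b j)" for j using \<B>(2) b topological_basis_open by blast
  have basis: "\<exists>j. y \<in> b j \<and> b j \<subseteq> U" if "open U" "y \<in> U" for y U
    using topological_basisE[OF \<B>(2) that] b by (metis rangeE)
  have Svan: "vanishes_on (- S) (fst (L i)) \<and> vanishes_on (- S) (snd (L i))" if i: "i \<le> k" for i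
  proof -
    have "vanishes_on (b j) (fst (L i)) \<and> vanishes_on (b j) (snd (L i))" if "miss j" for j
    proof -
      have bj: "b j \<in> sets borel" using b_open by simp
      have ev: "eventually (\<lambda>n. vanishes_on (b j) (fst (X n i)) \<and> vanishes_on (b j) (snd (X n i))) sequentially"
        using \<open>miss j\<close> unfolding miss_def
      proof eventually_elim
        fix n assume "\<not> hit j (r n)"
        then have "b j \<inter> \<Omega> (r n) = {}" by (simp add: hit_def)
        from H10_vanishes[OF bj this x]
        show "vanishes_on (b j) (fst (X n i)) \<and> vanishes_on (b j) (snd (X n i))" by (simp add: X_def)
      qed
      have "fst (L i) \<in> {f. vanishes_on (b j) f}"
      proof (rule tail_mid_limit[OF Z, of "\<lambda>z. fst (z i)"])
        show "(\<lambda>n. fst (Z n i)) \<longlonglongrightarrow> fst (L i)" by (intro tendsto_intros L i)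
        show "eventually (\<lambda>n. fst (X n i) \<in> {f. vanishes_on (b j) f}) sequentially"
          using ev by eventually_elim simp
      qed (auto intro!: subspace_imp_convex subspace_vanishes_on closed_vanishes_on bj)
      moreover have "snd (L i) \<in> {f. vanishes_on (b j) f}"
      proof (rule tail_mid_limit[OF Z, of "\<lambda>z. snd (z i)"])
        show "(\<lambda>n. snd (Z n i)) \<longlonglongrightarrow> snd (L i)" by (intro tendsto_intros L i)
        show "eventually (\<lambda>n. snd (X n i) \<in> {f. vanishes_on (b j) f}) sequentially"
          using ev by eventually_elim simp
      qed (auto intro!: subspace_imp_convex subspace_vanishes_on closed_vanishes_on bj)
      ultimately show ?thesis by simp
    qed
    then show ?thesis unfolding S_def by (auto intro!: vanishes_on_Un)
  qed
  have Scball: "S \<subseteq> cball 0 \<alpha>"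
  proof
    fix y assume y: "y \<in> S"
    show "y \<in> cball 0 \<alpha>"
    proof (rule ccontr)
      assume "y \<notin> cball 0 \<alpha>"
      then obtain j where "y \<in> b j" "b j \<subseteq> - cball 0 \<alpha>" using basis[of "- cball 0 \<alpha>" y] by auto
      moreover from this have "miss j" using \<Omega>(1) by (auto simp: miss_def hit_def intro!: always_eventually)
      ultimately show False using y by (auto simp: S_def)
    qed
  qed
  have Sdist: "dist y z \<le> \<alpha>" if "y \<in> S" "z \<in> S" for y z
  proof (rule field_le_epsilon)
    fix e :: real assume e: "e > 0"
    obtain i j where ij: "y \<in> b i" "b i \<subseteq> ball y (e/2)" "z \<in> b j" "b j \<subseteq> ball z (e/2)"
      using basis[of "ball y (e/2)" y] basis[of "ball z (e/2)" z] e by auto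
    \<comment> \<open>Along the chosen subsequence a basis set that is not eventually missed is
      eventually hit, so a single domain meets both neighbourhoods.\<close>
    then have "\<not> miss i" "\<not> miss j" using that by (auto simp: S_def)
    then have "eventually (\<lambda>n. hit i (r n) \<and> hit j (r n)) sequentially" using hit by (simp add: eventually_conj)
    then obtain n where "hit i (r n)" "hit j (r n)" unfolding eventually_sequentially by blast
    then obtain p q where pq: "p \<in> b i" "p \<in> \<Omega> (r n)" "q \<in> b j" "q \<in> \<Omega> (r n)" by (auto simp: hit_def)
    have "dist y p < e/2" "dist z q < e/2" "dist p q \<le> \<alpha>" using pq ij \<Omega>(2) by auto
    then show "dist y z \<le> \<alpha> + e"
      using dist_triangle[of y z p] dist_triangle[of p z q] by (simp add: dist_commute)
  qed
  have "closed S" unfolding S_def by (intro closed_Compl open_UN ballI b_open)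
  then have "compact S" using Scball bounded_subset[OF bounded_cball] compact_eq_bounded_closed by blast
  define K where "K = convex hull S"
  have "S \<subseteq> K" unfolding K_def by (rule hull_subset)
  \<comment> \<open>Balls are convex, so the bound extends from \<open>S\<close> to its hull in one
    argument at a time.\<close>
  have Kdist: "dist y z \<le> \<alpha>" if "y \<in> K" "z \<in> K" for y z
  proof -
    have "K \<subseteq> cball w \<alpha>" if "w \<in> S" for w
      unfolding K_def by (rule hull_minimal) (use Sdist that in auto)
    then have "S \<subseteq> cball y \<alpha>" using \<open>y \<in> K\<close> by (force simp: dist_commute)
    then have "K \<subseteq> cball y \<alpha>" unfolding K_def by (rule hull_minimal) simp
    then show ?thesis using that by auto
  qed
  have "vanishes_on (- K) (fst (L i)) \<and> vanishes_on (- K) (snd (L i))" if "i \<le> k" for i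
    using Svan[OF that] \<open>S \<subseteq> K\<close> by (blast intro: vanishes_on_mono)
  moreover have "compact K" unfolding K_def using \<open>compact S\<close> by (rule compact_convex_hull)
  moreover have "convex K" unfolding K_def by (rule convex_convex_hull)
  ultimately show ?thesis using Kdist LB Lorth Lray by (intro exI[of _ K] exI[of _ L]) blast
qed

section \<open>Existence of a convex minimiser\<close>

lemma dirichlet_eigenvalue_nonneg:
  assumes "admissible \<alpha> \<Omega>" shows "0 \<le> dirichlet_eigenvalue (Suc k) \<Omega>"
proof -
  obtain x where "\<And>i. x i \<in> H10 \<Omega>" and ray: "\<And>c. (norm (\<Sum>i\<le>k. c i *\<^sub>R snd (x i)))\<^sup>2 \<le> dirichlet_eigenvalue (Suc k) \<Omega> * (\<Sum>i\<le>k. (c i)\<^sup>2)"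
    using dirichlet_eigenvectors[of \<Omega> k] assms unfolding admissible_def by auto
  \<comment> \<open>With all coefficients 1 the sum of squares is positive, and the left side is a
    square.\<close>
  from ray[of "\<lambda>_. 1"] have "0 \<le> dirichlet_eigenvalue (Suc k) \<Omega> * (\<Sum>i\<le>k. 1)"
    by (simp add: order_trans[OF zero_le_power2])
  then show ?thesis by (simp add: zero_le_mult_iff)
qed

theorem theorem3p1:
  fixes \<alpha> :: real and \<kappa> :: nat
  assumes "0 < \<alpha>" and "1 \<le> \<kappa>"
  shows "\<exists>\<Omega> :: (real ^ 'n) set.
           admissible \<alpha> \<Omega> \<and> convex \<Omega> \<and>
           (\<forall>\<Omega>' :: (real ^ 'n) set.
              admissible \<alpha> \<Omega>' \<longrightarrow> dirichlet_eigenvalue \<kappa> \<Omega> \<le> dirichlet_eigenvalue \<kappa> \<Omega>')"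
proof -
  obtain k where \<kappa>: "\<kappa> = Suc k" using assms(2) by (cases \<kappa>) auto
  define A where "A = dirichlet_eigenvalue (Suc k) ` {\<Omega> :: (real ^ 'n) set. admissible \<alpha> \<Omega>}"
  \<comment> \<open>A competitor exists and the eigenvalues are bounded below, so the infimum is
    meaningful.\<close>
  have "admissible \<alpha> (ball (0 :: real ^ 'n) (\<alpha> / 2))"
    using assms(1) diameter_ball[of "0 :: real ^ 'n" "\<alpha> / 2"] by (auto simp: admissible_def)
  then have A: "A \<noteq> {}" "bdd_below A"
    using dirichlet_eigenvalue_nonneg by (auto simp: A_def intro!: bdd_belowI[of _ 0])
  define \<Lambda> where "\<Lambda> = Inf A"
  have "\<exists>\<Omega> :: (real ^ 'n) set. admissible \<alpha> \<Omega> \<and> dirichlet_eigenvalue (Suc k) \<Omega> < \<Lambda> + inverse (real (Suc n))" for n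
  proof -
    have "Inf A < \<Lambda> + inverse (real (Suc n))" by (simp add: \<Lambda>_def)
    from cInf_lessD[OF A(1) this] show ?thesis by (auto simp: A_def)
  qed
  then obtain \<Omega>0 :: "nat \<Rightarrow> (real ^ 'n) set" where \<Omega>0: "\<And>n. admissible \<alpha> (\<Omega>0 n)"
    "\<And>n. dirichlet_eigenvalue (Suc k) (\<Omega>0 n) < \<Lambda> + inverse (real (Suc n))" by metis
  define E where "E n = dirichlet_eigenvalue (Suc k) (\<Omega>0 n)" for n
  have \<Lambda>: "\<Lambda> \<le> dirichlet_eigenvalue (Suc k) \<Omega>" if "admissible \<alpha> \<Omega>" for \<Omega> :: "(real ^ 'n) set"
    unfolding \<Lambda>_def by (rule cInf_lower[OF _ A(2)]) (use that in \<open>auto simp: A_def\<close>)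
  have E: "E \<longlonglongrightarrow> \<Lambda>"
  proof (rule tendsto_sandwich[OF _ _ tendsto_const])
    have "(\<lambda>n. \<Lambda> + inverse (real (Suc n))) \<longlonglongrightarrow> \<Lambda> + 0"
      by (intro tendsto_add tendsto_const LIMSEQ_inverse_real_of_nat)
    then show "(\<lambda>n. \<Lambda> + inverse (real (Suc n))) \<longlonglongrightarrow> \<Lambda>" by simp
    show "eventually (\<lambda>n. \<Lambda> \<le> E n) sequentially" using \<Lambda>[OF \<Omega>0(1)] by (simp add: E_def)
    show "eventually (\<lambda>n. E n \<le> \<Lambda> + inverse (real (Suc n))) sequentially"
      using \<Omega>0(2) by (simp add: E_def less_imp_le)
  qed
  \<comment> \<open>Packs a translated domain and its eigenvectors into one predicate, so that a
    single choice yields both sequences with matching indices.\<close>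
  define good where "good n \<Omega>' x \<longleftrightarrow> \<Omega>' \<subseteq> cball 0 \<alpha> \<and> (\<forall>a\<in>\<Omega>'. \<forall>b\<in>\<Omega>'. dist a b \<le> \<alpha>) \<and>
    (\<forall>i. x i \<in> H10 \<Omega>') \<and> (\<forall>i j. fst (x i) \<bullet> fst (x j) = (if i = j then 1 else 0)) \<and>
    (\<forall>c. (norm (\<Sum>i\<le>k. c i *\<^sub>R snd (x i)))\<^sup>2 \<le> E n * (\<Sum>i\<le>k. (c i)\<^sup>2))"
    for n and \<Omega>' :: "(real ^ 'n) set" and x
  have "\<forall>n. \<exists>p. good n (fst p) (snd p)"
    unfolding E_def good_def using translated_eigenvectors[OF \<Omega>0(1)] by simp
  then obtain p where p: "\<And>n. good n (fst (p n)) (snd (p n))" by metis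
  define \<Omega> where "\<Omega> n = fst (p n)" for n
  define x where "x n = snd (p n)" for n
  have \<Omega>: "\<Omega> n \<subseteq> cball 0 \<alpha>" "\<forall>a\<in>\<Omega> n. \<forall>b\<in>\<Omega> n. dist a b \<le> \<alpha>" for n
    using p[of n] unfolding good_def \<Omega>_def by blast+
  have x: "x n i \<in> H10 (\<Omega> n)" "fst (x n i) \<bullet> fst (x n j) = (if i = j then 1 else 0)"
    "(norm (\<Sum>i\<le>k. c i *\<^sub>R snd (x n i)))\<^sup>2 \<le> E n * (\<Sum>i\<le>k. (c i)\<^sup>2)" for n i j c
    using p[of n] unfolding good_def \<Omega>_def x_def by simp_all
  obtain K :: "(real ^ 'n) set" and L where K: "compact K" "convex K" "\<forall>a\<in>K. \<forall>b\<in>K. dist a b \<le> \<alpha>"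
    and L0: "\<forall>i\<le>k. L i \<in> H10 (cball 0 \<alpha>) \<and> vanishes_on (- K) (fst (L i)) \<and> vanishes_on (- K) (snd (L i))"
      "\<forall>i\<le>k. \<forall>j\<le>k. fst (L i) \<bullet> fst (L j) = (if i = j then 1 else 0)"
    and Lr: "\<forall>c. (norm (\<Sum>i\<le>k. c i *\<^sub>R snd (L i)))\<^sup>2 \<le> \<Lambda> * (\<Sum>i\<le>k. (c i)\<^sup>2)"
    using minimising_limit[of \<Omega> \<alpha> x k E \<Lambda>, OF \<Omega> x E] by (elim exE conjE)
  have L: "L i \<in> H10 (cball 0 \<alpha>)" "vanishes_on (- K) (fst (L i))" "vanishes_on (- K) (snd (L i))"
    if "i \<le> k" for i using L0(1) that by simp_all
  have Lo: "fst (L i) \<bullet> fst (L j) = (if i = j then 1 else 0)" if "i \<le> k" "j \<le> k" for i j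
    using L0(2) that by simp
  \<comment> \<open>A convex set with empty interior is negligible, whereas the first component of
    \<open>L 0\<close> has norm 1 and vanishes outside \<open>K\<close>.\<close>
  have ne: "interior K \<noteq> {}"
  proof
    assume "interior K = {}"
    then have "negligible K" using negligible_convex_interior[OF K(2)] by simp
    then have "fst (L 0) = 0"
      by (rule vanishes_outside_null_set[OF _ _ L(2)]) (use K(1) borel_compact in auto)
    then show False using Lo[of 0 0] by simp
  qed
  have bdd: "bounded (interior K)"
    using bounded_subset[OF compact_imp_bounded[OF K(1)] interior_subset] .
  have "diameter (interior K) \<le> \<alpha>"
    by (rule diameter_le) (use ne K(3) interior_subset in \<open>auto simp: dist_norm[symmetric]\<close>)
  then have adm: "admissible \<alpha> (interior K)" using ne bdd by (simp add: admissible_def)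
  have "dirichlet_eigenvalue (Suc k) (interior K) \<le> \<Lambda>"
    by (rule dirichlet_eigenvalue_le[OF open_interior ne bdd H10_interior_convex[OF L(1) K(1,2) ne L(2,3)] Lo Lr[rule_format]])
  then show ?thesis
    using adm convex_interior[OF K(2)] \<Lambda> order_trans unfolding \<kappa> by (intro exI[of _ "interior K"]) blast
qed

end
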